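(* Let $\Lambda$ be a ring, and let $N$ be a right $T$-nilpotent two-sided ideal of $\Lambda$. (i) Let $X$ be a projective right $\Lambda/N$-module. Then there exists a projective right $\Lambda$-module $P$ such that $P/PN\cong X$. All projective right $\Lambda$-modules with this property are isomorphic. In addition, $X$ is finitely generated (respectively, countably generated) if and only if $P$ is finitely generated (respectively, countably generated). (ii) Let $P$ and $P'$ be projective right $\Lambda$-modules, and let $f\colon P\to P'$ be a morphism of $\Lambda$-modules. Then $f$ is an isomorphism if and only if the induced map $P/PN\to P'/P'N$ is an isomorphism of $\Lambda/N$-modules. (iii) Let $I$ be an idempotent two-sided ideal of $\Lambda$ such that $(I+N)/N$ is the trace of a countably generated projective right $\Lambda/N$-module $X$. Then $I$ is the trace of any countably generated projective right $\Lambda$-module $P$ such that $P/PN\cong X$.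
   Context: Rings are associative with $1$. An ideal $N$ is right $T$-nilpotent if for every sequence $a_1,a_2,\dots$ of elements of $N$ there is $n$ with $a_na_{n-1}\cdots a_1=0$. The trace of a right module $M$ over a ring $\Lambda$ is the two-sided ideal $\mathrm{Tr}_\Lambda(M)=\sum_{f\in\mathrm{Hom}_\Lambda(M,\Lambda)}f(M)$. *)

theory Defs
  imports
    "HOL-Algebra.QuotRing"
    "HOL-Algebra.Ideal_Product"
    "HOL-Algebra.Generated_Groups"
    "HOL-Library.Countable_Set"
begin

section \<open>Right modules over a not necessarily commutative ring\<close>

text \<open>
  HOL-Algebra only has modules over commutative rings, with scalars on the left. As there, the
  record extends the ring record only in order to reuse its additive structure: the fields
  mult and one of a module carry no information.
\<close>

record ('a, 'b) right_module = "'b ring" +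
  rsmult :: "'b \<Rightarrow> 'a \<Rightarrow> 'b" (infixl \<open>\<star>\<index>\<close> 70)

locale right_module = R?: ring R + M?: abelian_group M
  for R :: "('a, 'r) ring_scheme" (structure)
    and M :: "('a, 'b, 'm) right_module_scheme" (structure) +
  assumes rsmult_closed [simp, intro]:
      "\<lbrakk> x \<in> carrier M; a \<in> carrier R \<rbrakk> \<Longrightarrow> x \<star>\<^bsub>M\<^esub> a \<in> carrier M"
    and rsmult_add_left:
      "\<lbrakk> x \<in> carrier M; y \<in> carrier M; a \<in> carrier R \<rbrakk> \<Longrightarrow>
        (x \<oplus>\<^bsub>M\<^esub> y) \<star>\<^bsub>M\<^esub> a = x \<star>\<^bsub>M\<^esub> a \<oplus>\<^bsub>M\<^esub> y \<star>\<^bsub>M\<^esub> a"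
    and rsmult_add_right:
      "\<lbrakk> x \<in> carrier M; a \<in> carrier R; b \<in> carrier R \<rbrakk> \<Longrightarrow>
        x \<star>\<^bsub>M\<^esub> (a \<oplus>\<^bsub>R\<^esub> b) = x \<star>\<^bsub>M\<^esub> a \<oplus>\<^bsub>M\<^esub> x \<star>\<^bsub>M\<^esub> b"
    and rsmult_assoc:
      "\<lbrakk> x \<in> carrier M; a \<in> carrier R; b \<in> carrier R \<rbrakk> \<Longrightarrow>
        x \<star>\<^bsub>M\<^esub> (a \<otimes>\<^bsub>R\<^esub> b) = (x \<star>\<^bsub>M\<^esub> a) \<star>\<^bsub>M\<^esub> b"
    and rsmult_one [simp]:
      "x \<in> carrier M \<Longrightarrow> x \<star>\<^bsub>M\<^esub> \<one>\<^bsub>R\<^esub> = x"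

definition right_hom ::
  "('a, 'r) ring_scheme \<Rightarrow> ('a, 'b, 'm) right_module_scheme \<Rightarrow> ('a, 'c, 'n) right_module_scheme
    \<Rightarrow> ('b \<Rightarrow> 'c) set" where
  "right_hom R M M' = {f \<in> hom (add_monoid M) (add_monoid M').
     \<forall>x\<in>carrier M. \<forall>a\<in>carrier R. f (x \<star>\<^bsub>M\<^esub> a) = f x \<star>\<^bsub>M'\<^esub> a}"

definition right_iso ::
  "('a, 'r) ring_scheme \<Rightarrow> ('a, 'b, 'm) right_module_scheme \<Rightarrow> ('a, 'c, 'n) right_module_scheme
    \<Rightarrow> ('b \<Rightarrow> 'c) set" where
  "right_iso R M M' = {f \<in> right_hom R M M'. bij_betw f (carrier M) (carrier M')}"

definition right_isomorphic ::
  "('a, 'r) ring_scheme \<Rightarrow> ('a, 'b, 'm) right_module_scheme \<Rightarrow> ('a, 'c, 'n) right_module_scheme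
    \<Rightarrow> bool" where
  "right_isomorphic R M M' \<longleftrightarrow> right_iso R M M' \<noteq> {}"

definition right_submodule ::
  "('a, 'r) ring_scheme \<Rightarrow> ('a, 'b, 'm) right_module_scheme \<Rightarrow> 'b set \<Rightarrow> bool" where
  "right_submodule R M H \<longleftrightarrow>
     additive_subgroup H M \<and> (\<forall>x\<in>H. \<forall>a\<in>carrier R. x \<star>\<^bsub>M\<^esub> a \<in> H)"

definition right_span ::
  "('a, 'r) ring_scheme \<Rightarrow> ('a, 'b, 'm) right_module_scheme \<Rightarrow> 'b set \<Rightarrow> 'b set" where
  "right_span R M S = \<Inter>{H. right_submodule R M H \<and> S \<subseteq> H}"

definition finitely_generated ::
  "('a, 'r) ring_scheme \<Rightarrow> ('a, 'b, 'm) right_module_scheme \<Rightarrow> bool" where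
  "finitely_generated R M \<longleftrightarrow>
     (\<exists>S\<subseteq>carrier M. finite S \<and> right_span R M S = carrier M)"

text \<open>Here countable means finite or countably infinite.\<close>

definition countably_generated ::
  "('a, 'r) ring_scheme \<Rightarrow> ('a, 'b, 'm) right_module_scheme \<Rightarrow> bool" where
  "countably_generated R M \<longleftrightarrow>
     (\<exists>S\<subseteq>carrier M. countable S \<and> right_span R M S = carrier M)"


section \<open>Free and projective modules\<close>

definition free_right_module ::
  "('a, 'r) ring_scheme \<Rightarrow> 's set \<Rightarrow> ('a, 's \<Rightarrow> 'a) right_module" where
  "free_right_module R S =
     \<lparr>carrier = {g. (\<forall>i\<in>S. g i \<in> carrier R) \<and> (\<forall>i. i \<notin> S \<longrightarrow> g i = \<zero>\<^bsub>R\<^esub>)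
                   \<and> finite {i. g i \<noteq> \<zero>\<^bsub>R\<^esub>}},
      mult = undefined, one = undefined,
      zero = (\<lambda>i. \<zero>\<^bsub>R\<^esub>), add = (\<lambda>g h i. g i \<oplus>\<^bsub>R\<^esub> h i),
      rsmult = (\<lambda>g a i. g i \<otimes>\<^bsub>R\<^esub> a)\<rparr>"

definition direct_summands ::
  "('a, 'r) ring_scheme \<Rightarrow> ('a, 'b, 'm) right_module_scheme \<Rightarrow> 'b set \<Rightarrow> 'b set \<Rightarrow> bool" where
  "direct_summands R M A B \<longleftrightarrow>
     right_submodule R M A \<and> right_submodule R M B \<and>
     A \<inter> B = {\<zero>\<^bsub>M\<^esub>} \<and> A <+>\<^bsub>M\<^esub> B = carrier M"

text \<open>
  A module is projective if it is isomorphic to a direct summand of a free module. The basis S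
  ranges over sets of elements of the type of the module only, since a definition cannot quantify
  over types. This is no restriction: by the theorems
  \<open>projective_lifts\<close> and \<open>projective_if_lifts\<close> below, the definition is
  equivalent to the lifting property with respect to surjections between modules of arbitrary types.
\<close>

definition projective ::
  "('a, 'r) ring_scheme \<Rightarrow> ('a, 'b, 'm) right_module_scheme \<Rightarrow> bool" where
  "projective R P \<longleftrightarrow> right_module R P \<and>
     (\<exists>(S :: 'b set) A B. direct_summands R (free_right_module R S) A B \<and>
        right_isomorphic R P ((free_right_module R S)\<lparr>carrier := A\<rparr>))"


section \<open>Reduction modulo an ideal\<close>

definition right_module_ideal_prod ::
  "('a, 'b, 'm) right_module_scheme \<Rightarrow> 'a set \<Rightarrow> 'b set" where
  "right_module_ideal_prod M N =
     generate (add_monoid M) {x \<star>\<^bsub>M\<^esub> a | x a. x \<in> carrier M \<and> a \<in> N}"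

text \<open>
  The quotient of M by a submodule H containing MN, as a module over R Quot N. As for the
  multiplication of R Quot N, a coset of H is multiplied by a coset of N by taking the
  union of the cosets of all products of representatives.
\<close>

definition right_module_quot ::
  "('a, 'b, 'm) right_module_scheme \<Rightarrow> 'b set \<Rightarrow> ('a set, 'b set) right_module" where
  "right_module_quot M H =
     \<lparr>carrier = a_rcosets\<^bsub>M\<^esub> H, mult = undefined, one = undefined,
      zero = H, add = set_add M,
      rsmult = (\<lambda>C A. \<Union>x\<in>C. \<Union>a\<in>A. H +>\<^bsub>M\<^esub> (x \<star>\<^bsub>M\<^esub> a))\<rparr>"

definition reduction ::
  "('a, 'b, 'm) right_module_scheme \<Rightarrow> 'a set \<Rightarrow> ('a set, 'b set) right_module" where
  "reduction M N = right_module_quot M (right_module_ideal_prod M N)"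

text \<open>The induced map sends the coset of x to the coset of f x; see \<open>reduction_map_coset\<close>.\<close>

definition reduction_map ::
  "('a, 'c, 'n) right_module_scheme \<Rightarrow> 'a set \<Rightarrow> ('b \<Rightarrow> 'c) \<Rightarrow> 'b set \<Rightarrow> 'c set" where
  "reduction_map M' N f C = (\<Union>x\<in>C. right_module_ideal_prod M' N +>\<^bsub>M'\<^esub> f x)"


section \<open>Trace ideals and T-nilpotence\<close>

definition regular_right_module :: "('a, 'r) ring_scheme \<Rightarrow> ('a, 'a) right_module" where
  "regular_right_module R =
     \<lparr>carrier = carrier R, mult = undefined, one = undefined,
      zero = \<zero>\<^bsub>R\<^esub>, add = (\<oplus>\<^bsub>R\<^esub>), rsmult = (\<otimes>\<^bsub>R\<^esub>)\<rparr>"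

definition trace_ideal ::
  "('a, 'r) ring_scheme \<Rightarrow> ('a, 'b, 'm) right_module_scheme \<Rightarrow> 'a set" where
  "trace_ideal R M =
     generate (add_monoid R) (\<Union>f\<in>right_hom R M (regular_right_module R). f ` carrier M)"

text \<open>The product a n \<open>\<otimes>\<close> ... \<open>\<otimes>\<close> a 1, the later factors being on the left.\<close>

primrec left_prod :: "('a, 'r) ring_scheme \<Rightarrow> (nat \<Rightarrow> 'a) \<Rightarrow> nat \<Rightarrow> 'a" where
  "left_prod R a 0 = \<one>\<^bsub>R\<^esub>"
| "left_prod R a (Suc n) = a (Suc n) \<otimes>\<^bsub>R\<^esub> left_prod R a n"

definition right_T_nilpotent :: "('a, 'r) ring_scheme \<Rightarrow> 'a set \<Rightarrow> bool" where
  "right_T_nilpotent R N \<longleftrightarrow>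
     (\<forall>a :: nat \<Rightarrow> 'a. (\<forall>i\<ge>1. a i \<in> N) \<longrightarrow> (\<exists>n\<ge>1. left_prod R a n = \<zero>\<^bsub>R\<^esub>))"


section \<open>Basic facts\<close>

lemma right_module_ring: "right_module R M \<Longrightarrow> ring R"
  by (simp add: right_module_def)

lemma right_module_abelian_group: "right_module R M \<Longrightarrow> abelian_group M"
  by (simp add: right_module_def)

lemma right_homI:
  assumes "\<And>x. x \<in> carrier M \<Longrightarrow> f x \<in> carrier M'"
    and "\<And>x y. \<lbrakk>x \<in> carrier M; y \<in> carrier M\<rbrakk> \<Longrightarrow> f (x \<oplus>\<^bsub>M\<^esub> y) = f x \<oplus>\<^bsub>M'\<^esub> f y"
    and "\<And>x a. \<lbrakk>x \<in> carrier M; a \<in> carrier R\<rbrakk> \<Longrightarrow> f (x \<star>\<^bsub>M\<^esub> a) = f x \<star>\<^bsub>M'\<^esub> a"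
  shows "f \<in> right_hom R M M'"
  using assms by (auto simp: right_hom_def hom_def)

lemma right_hom_closed: "\<lbrakk>f \<in> right_hom R M M'; x \<in> carrier M\<rbrakk> \<Longrightarrow> f x \<in> carrier M'"
  by (auto simp: right_hom_def hom_def)

lemma right_hom_add:
  "\<lbrakk>f \<in> right_hom R M M'; x \<in> carrier M; y \<in> carrier M\<rbrakk> \<Longrightarrow> f (x \<oplus>\<^bsub>M\<^esub> y) = f x \<oplus>\<^bsub>M'\<^esub> f y"
  by (auto simp: right_hom_def hom_def)

lemma right_hom_rsmult:
  "\<lbrakk>f \<in> right_hom R M M'; x \<in> carrier M; a \<in> carrier R\<rbrakk> \<Longrightarrow> f (x \<star>\<^bsub>M\<^esub> a) = f x \<star>\<^bsub>M'\<^esub> a"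
  by (auto simp: right_hom_def)

lemma right_hom_group_hom:
  assumes "abelian_group M" "abelian_group M'" "f \<in> right_hom R M M'"
  shows "group_hom (add_monoid M) (add_monoid M') f"
  using assms abelian_group.a_group[of M] abelian_group.a_group[of M']
  by (auto simp: group_hom_def group_hom_axioms_def right_hom_def)

lemma right_hom_zero:
  assumes "abelian_group M" "abelian_group M'" "f \<in> right_hom R M M'"
  shows "f \<zero>\<^bsub>M\<^esub> = \<zero>\<^bsub>M'\<^esub>"
  using group_hom.hom_one[OF right_hom_group_hom[OF assms]] by simp

lemma right_hom_a_inv:
  assumes "abelian_group M" "abelian_group M'" "f \<in> right_hom R M M'" "x \<in> carrier M"
  shows "f (\<ominus>\<^bsub>M\<^esub> x) = \<ominus>\<^bsub>M'\<^esub> f x"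
  using group_hom.hom_inv[OF right_hom_group_hom[OF assms(1-3)], of x] assms(4)
  by (simp add: a_inv_def)

lemma right_hom_comp:
  assumes "f \<in> right_hom R L M" "g \<in> right_hom R M M'"
  shows "g \<circ> f \<in> right_hom R L M'"
  using assms by (intro right_homI) (auto simp: right_hom_add right_hom_rsmult right_hom_closed)

lemma (in right_module) rsmult_zero_left [simp]:
  assumes "a \<in> carrier R" shows "\<zero>\<^bsub>M\<^esub> \<star>\<^bsub>M\<^esub> a = \<zero>\<^bsub>M\<^esub>"
proof -
  have "\<zero>\<^bsub>M\<^esub> \<star>\<^bsub>M\<^esub> a \<oplus>\<^bsub>M\<^esub> \<zero>\<^bsub>M\<^esub> \<star>\<^bsub>M\<^esub> a = \<zero>\<^bsub>M\<^esub> \<star>\<^bsub>M\<^esub> a \<oplus>\<^bsub>M\<^esub> \<zero>\<^bsub>M\<^esub>"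
    using rsmult_add_left[of "\<zero>\<^bsub>M\<^esub>" "\<zero>\<^bsub>M\<^esub>" a] assms by simp
  then show ?thesis using assms by (metis M.add.l_cancel_one M.zero_closed M.r_zero R.zero_closed rsmult_closed)
qed

lemma (in right_module) rsmult_zero_right [simp]:
  assumes "x \<in> carrier M" shows "x \<star>\<^bsub>M\<^esub> \<zero>\<^bsub>R\<^esub> = \<zero>\<^bsub>M\<^esub>"
proof -
  have "x \<star>\<^bsub>M\<^esub> \<zero>\<^bsub>R\<^esub> \<oplus>\<^bsub>M\<^esub> x \<star>\<^bsub>M\<^esub> \<zero>\<^bsub>R\<^esub> = x \<star>\<^bsub>M\<^esub> \<zero>\<^bsub>R\<^esub> \<oplus>\<^bsub>M\<^esub> \<zero>\<^bsub>M\<^esub>"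
    using rsmult_add_right[of x "\<zero>\<^bsub>R\<^esub>" "\<zero>\<^bsub>R\<^esub>"] assms by simp
  then show ?thesis using assms by (metis M.add.l_cancel_one M.zero_closed M.r_zero R.zero_closed rsmult_closed)
qed

lemma (in right_module) rsmult_minus_left:
  assumes "x \<in> carrier M" "a \<in> carrier R"
  shows "(\<ominus>\<^bsub>M\<^esub> x) \<star>\<^bsub>M\<^esub> a = \<ominus>\<^bsub>M\<^esub> (x \<star>\<^bsub>M\<^esub> a)"
proof -
  have "(\<ominus>\<^bsub>M\<^esub> x) \<star>\<^bsub>M\<^esub> a \<oplus>\<^bsub>M\<^esub> x \<star>\<^bsub>M\<^esub> a = \<zero>\<^bsub>M\<^esub>"
    using rsmult_add_left[of "\<ominus>\<^bsub>M\<^esub> x" x a] assms by (simp add: M.l_neg)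
  then show ?thesis using assms by (intro M.minus_equality[symmetric]) auto
qed


section \<open>Lifting property of projective modules\<close>

lemma free_right_module_is_right_module:
  assumes "ring R" shows "right_module R (free_right_module R S)"
proof -
  interpret R: ring R by fact
  let ?F = "free_right_module R S"
  have mem: "g i \<in> carrier R" if "g \<in> carrier ?F" for g i
    using that by (cases "i \<in> S") (auto simp: free_right_module_def)
  have ab: "abelian_group ?F"
  proof (rule abelian_groupI)
    fix x y assume xy: "x \<in> carrier ?F" "y \<in> carrier ?F"
    have "{i. x i \<oplus>\<^bsub>R\<^esub> y i \<noteq> \<zero>\<^bsub>R\<^esub>} \<subseteq> {i. x i \<noteq> \<zero>\<^bsub>R\<^esub>} \<union> {i. y i \<noteq> \<zero>\<^bsub>R\<^esub>}"
      using R.l_zero by auto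
    with xy show "x \<oplus>\<^bsub>?F\<^esub> y \<in> carrier ?F"
      by (auto simp: free_right_module_def intro: finite_subset)
  next
    fix x assume x: "x \<in> carrier ?F"
    have "{i. \<ominus>\<^bsub>R\<^esub> x i \<noteq> \<zero>\<^bsub>R\<^esub>} \<subseteq> {i. x i \<noteq> \<zero>\<^bsub>R\<^esub>}" by auto
    with x have "(\<lambda>i. \<ominus>\<^bsub>R\<^esub> x i) \<in> carrier ?F"
      by (auto simp: free_right_module_def intro: finite_subset)
    moreover have "(\<lambda>i. \<ominus>\<^bsub>R\<^esub> x i) \<oplus>\<^bsub>?F\<^esub> x = \<zero>\<^bsub>?F\<^esub>"
      using mem[OF x] by (simp add: free_right_module_def R.l_neg)
    ultimately show "\<exists>y\<in>carrier ?F. y \<oplus>\<^bsub>?F\<^esub> x = \<zero>\<^bsub>?F\<^esub>" by blast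
  next
    fix x y assume "x \<in> carrier ?F" "y \<in> carrier ?F"
    with mem show "x \<oplus>\<^bsub>?F\<^esub> y = y \<oplus>\<^bsub>?F\<^esub> x"
      by (simp add: free_right_module_def R.a_comm)
  next
    fix x y z assume "x \<in> carrier ?F" "y \<in> carrier ?F" "z \<in> carrier ?F"
    with mem show "x \<oplus>\<^bsub>?F\<^esub> y \<oplus>\<^bsub>?F\<^esub> z = x \<oplus>\<^bsub>?F\<^esub> (y \<oplus>\<^bsub>?F\<^esub> z)"
      by (simp add: free_right_module_def R.a_assoc)
  next
    fix x assume "x \<in> carrier ?F"
    with mem show "\<zero>\<^bsub>?F\<^esub> \<oplus>\<^bsub>?F\<^esub> x = x"
      by (simp add: free_right_module_def)
  qed (auto simp: free_right_module_def)
  show ?thesis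
  proof (intro right_module.intro right_module_axioms.intro assms ab)
    fix x a assume xa: "x \<in> carrier ?F" "a \<in> carrier R"
    have "{i. x i \<otimes>\<^bsub>R\<^esub> a \<noteq> \<zero>\<^bsub>R\<^esub>} \<subseteq> {i. x i \<noteq> \<zero>\<^bsub>R\<^esub>}" using xa by auto
    with xa show "x \<star>\<^bsub>?F\<^esub> a \<in> carrier ?F"
      by (auto simp: free_right_module_def intro: finite_subset)
  next
    fix x y a assume x: "x \<in> carrier ?F" and y: "y \<in> carrier ?F" and a: "a \<in> carrier R"
    show "(x \<oplus>\<^bsub>?F\<^esub> y) \<star>\<^bsub>?F\<^esub> a = x \<star>\<^bsub>?F\<^esub> a \<oplus>\<^bsub>?F\<^esub> y \<star>\<^bsub>?F\<^esub> a"
      using mem[OF x] mem[OF y] a by (simp add: free_right_module_def R.l_distr)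
  next
    fix x a b assume x: "x \<in> carrier ?F" and ab: "a \<in> carrier R" "b \<in> carrier R"
    show "x \<star>\<^bsub>?F\<^esub> (a \<oplus>\<^bsub>R\<^esub> b) = x \<star>\<^bsub>?F\<^esub> a \<oplus>\<^bsub>?F\<^esub> x \<star>\<^bsub>?F\<^esub> b"
      using mem[OF x] ab by (simp add: free_right_module_def R.r_distr)
    show "x \<star>\<^bsub>?F\<^esub> (a \<otimes>\<^bsub>R\<^esub> b) = (x \<star>\<^bsub>?F\<^esub> a) \<star>\<^bsub>?F\<^esub> b"
      using mem[OF x] ab by (simp add: free_right_module_def R.m_assoc)
  next
    fix x assume x: "x \<in> carrier ?F"
    show "x \<star>\<^bsub>?F\<^esub> \<one>\<^bsub>R\<^esub> = x"
      using mem[OF x] by (simp add: free_right_module_def)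
  qed
qed

definition free_basis :: "('a, 'r) ring_scheme \<Rightarrow> 's \<Rightarrow> 's \<Rightarrow> 'a" where
  "free_basis R i = (\<lambda>j. if j = i then \<one>\<^bsub>R\<^esub> else \<zero>\<^bsub>R\<^esub>)"

lemma free_basis_closed:
  assumes "ring R" "i \<in> S" shows "free_basis R i \<in> carrier (free_right_module R S)"
proof -
  interpret R: ring R by fact
  have "{j. free_basis R i j \<noteq> \<zero>\<^bsub>R\<^esub>} \<subseteq> {i}" by (auto simp: free_basis_def)
  then show ?thesis using assms
    by (auto simp: free_right_module_def free_basis_def)
qed

lemma free_right_hom_eq:
  assumes R: "ring R" and M: "right_module R M"
    and f: "f \<in> right_hom R (free_right_module R S) M"
    and g: "g \<in> right_hom R (free_right_module R S) M"
    and eq: "\<And>i. i \<in> S \<Longrightarrow> f (free_basis R i) = g (free_basis R i)"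
    and x: "x \<in> carrier (free_right_module R S)"
  shows "f x = g x"
proof -
  interpret R: ring R by fact
  let ?F = "free_right_module R S"
  interpret F: right_module R ?F by (rule free_right_module_is_right_module[OF R])
  have "\<forall>x\<in>carrier ?F. {i. x i \<noteq> \<zero>\<^bsub>R\<^esub>} \<subseteq> T \<longrightarrow> f x = g x" if "finite T" for T
    using that
  proof (induction T rule: finite_induct)
    case empty
    show ?case
    proof (intro ballI impI)
      fix x assume "x \<in> carrier ?F" "{i. x i \<noteq> \<zero>\<^bsub>R\<^esub>} \<subseteq> {}"
      then have "x = \<zero>\<^bsub>?F\<^esub>" by (auto simp: free_right_module_def)
      then show "f x = g x"
        using right_hom_zero[OF F.abelian_group_axioms right_module_abelian_group[OF M]] f g by metis
    qed
  next
    case (insert i T)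
    show ?case
    proof (intro ballI impI)
      fix x assume x: "x \<in> carrier ?F" and supp: "{i. x i \<noteq> \<zero>\<^bsub>R\<^esub>} \<subseteq> insert i T"
      show "f x = g x"
      proof (cases "i \<in> S")
        case False
        then have "{i. x i \<noteq> \<zero>\<^bsub>R\<^esub>} \<subseteq> T" using x supp by (auto simp: free_right_module_def)
        then show ?thesis using insert.IH x by blast
      next
        case True
        let ?y = "x(i := \<zero>\<^bsub>R\<^esub>)"
        have "{j. ?y j \<noteq> \<zero>\<^bsub>R\<^esub>} \<subseteq> {i. x i \<noteq> \<zero>\<^bsub>R\<^esub>}" by auto
        then have y: "?y \<in> carrier ?F" using x True
          by (auto simp: free_right_module_def intro: finite_subset)
        have "{j. ?y j \<noteq> \<zero>\<^bsub>R\<^esub>} \<subseteq> T" using supp by auto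
        then have fy: "f ?y = g ?y" using insert.IH y by blast
        have xi: "x i \<in> carrier R" using x True by (auto simp: free_right_module_def)
        have xc: "x j \<in> carrier R" for j using x by (cases "j \<in> S") (auto simp: free_right_module_def)
        have b: "free_basis R i \<in> carrier ?F" by (rule free_basis_closed[OF R True])
        have decomp: "x = free_basis R i \<star>\<^bsub>?F\<^esub> x i \<oplus>\<^bsub>?F\<^esub> ?y"
          using xc by (auto simp: free_right_module_def free_basis_def fun_eq_iff)
        have bx: "free_basis R i \<star>\<^bsub>?F\<^esub> x i \<in> carrier ?F" using b xi by simp
        have "h x = h (free_basis R i) \<star>\<^bsub>M\<^esub> x i \<oplus>\<^bsub>M\<^esub> h ?y" if "h \<in> right_hom R ?F M" for h
          using right_hom_add[OF that bx y] right_hom_rsmult[OF that b xi] decomp by simp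
        from this[OF f] this[OF g] show ?thesis unfolding fy eq[OF True] by simp
      qed
    qed
  qed
  moreover have "finite {i. x i \<noteq> \<zero>\<^bsub>R\<^esub>}" using x by (simp add: free_right_module_def)
  ultimately show ?thesis using x by blast
qed

lemma free_right_hom_exists:
  fixes R :: "('a, 'r) ring_scheme" and S :: "'s set"
  assumes R: "ring R" and M: "right_module R M" and t: "\<And>i. i \<in> S \<Longrightarrow> t i \<in> carrier M"
  shows "\<exists>k\<in>right_hom R (free_right_module R S) M. \<forall>i\<in>S. k (free_basis R i) = t i"
proof -
  interpret M: right_module R M by fact
  let ?F = "free_right_module R S"
  interpret F: right_module R ?F by (rule free_right_module_is_right_module[OF R])
  define supp :: "('s \<Rightarrow> 'a) \<Rightarrow> 's set" where "supp x = {i. x i \<noteq> \<zero>\<^bsub>R\<^esub>}" for x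
  define k where "k x = (\<Oplus>\<^bsub>M\<^esub>i\<in>supp x. t i \<star>\<^bsub>M\<^esub> x i)" for x
  have supp: "finite (supp x)" "supp x \<subseteq> S" if "x \<in> carrier ?F" for x
    using that by (auto simp: free_right_module_def supp_def)
  have xc: "x i \<in> carrier R" if "x \<in> carrier ?F" for x i
    using that by (cases "i \<in> S") (auto simp: free_right_module_def)
  have keq: "k x = (\<Oplus>\<^bsub>M\<^esub>i\<in>T. t i \<star>\<^bsub>M\<^esub> x i)"
    if "x \<in> carrier ?F" "finite T" "supp x \<subseteq> T" "T \<subseteq> S" for x T
    unfolding k_def using that t xc[OF that(1)]
    by (intro M.add.finprod_mono_neutral_cong_left) (auto simp: supp_def subset_iff Pi_def)
  have kh: "k \<in> right_hom R ?F M"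
  proof (rule right_homI)
    fix x assume x: "x \<in> carrier ?F"
    show "k x \<in> carrier M" unfolding k_def using supp[OF x] xc[OF x] t
      by (intro M.finsum_closed) auto
  next
    fix x y assume x: "x \<in> carrier ?F" and y: "y \<in> carrier ?F"
    let ?T = "supp x \<union> supp y"
    have T: "finite ?T" "?T \<subseteq> S" using supp x y by auto
    have xy: "x \<oplus>\<^bsub>?F\<^esub> y \<in> carrier ?F" using x y by simp
    have s: "supp (x \<oplus>\<^bsub>?F\<^esub> y) \<subseteq> ?T" by (auto simp: supp_def free_right_module_def)
    have "k (x \<oplus>\<^bsub>?F\<^esub> y) = (\<Oplus>\<^bsub>M\<^esub>i\<in>?T. t i \<star>\<^bsub>M\<^esub> (x \<oplus>\<^bsub>?F\<^esub> y) i)"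
      by (rule keq[OF xy T(1) s T(2)])
    also have "\<dots> = (\<Oplus>\<^bsub>M\<^esub>i\<in>?T. t i \<star>\<^bsub>M\<^esub> x i \<oplus>\<^bsub>M\<^esub> t i \<star>\<^bsub>M\<^esub> y i)"
      using T t xc[OF x] xc[OF y]
      by (intro M.finsum_cong') (auto simp: free_right_module_def M.rsmult_add_right subset_iff)
    also have "\<dots> = k x \<oplus>\<^bsub>M\<^esub> k y"
      unfolding keq[OF x T(1) Un_upper1 T(2)] keq[OF y T(1) Un_upper2 T(2)]
      using T t xc[OF x] xc[OF y] by (intro M.finsum_addf) auto
    finally show "k (x \<oplus>\<^bsub>?F\<^esub> y) = k x \<oplus>\<^bsub>M\<^esub> k y" .
  next
    fix x a assume x: "x \<in> carrier ?F" and a: "a \<in> carrier R"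
    have T: "finite (supp x)" "supp x \<subseteq> S" using supp x by auto
    have xa: "x \<star>\<^bsub>?F\<^esub> a \<in> carrier ?F" using x a by simp
    have s: "supp (x \<star>\<^bsub>?F\<^esub> a) \<subseteq> supp x" using a by (auto simp: supp_def free_right_module_def)
    have "k (x \<star>\<^bsub>?F\<^esub> a) = (\<Oplus>\<^bsub>M\<^esub>i\<in>supp x. t i \<star>\<^bsub>M\<^esub> (x \<star>\<^bsub>?F\<^esub> a) i)"
      by (rule keq[OF xa T(1) s T(2)])
    also have "\<dots> = (\<Oplus>\<^bsub>M\<^esub>i\<in>supp x. (t i \<star>\<^bsub>M\<^esub> x i) \<star>\<^bsub>M\<^esub> a)"
      using T t xc[OF x] a
      by (intro M.finsum_cong') (auto simp: free_right_module_def M.rsmult_assoc subset_iff)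
    also have "\<dots> = (\<Oplus>\<^bsub>M\<^esub>i\<in>supp x. t i \<star>\<^bsub>M\<^esub> x i) \<star>\<^bsub>M\<^esub> a"
    proof -
      have "(\<Oplus>\<^bsub>M\<^esub>i\<in>U. (t i \<star>\<^bsub>M\<^esub> x i) \<star>\<^bsub>M\<^esub> a) = (\<Oplus>\<^bsub>M\<^esub>i\<in>U. t i \<star>\<^bsub>M\<^esub> x i) \<star>\<^bsub>M\<^esub> a"
        if "finite U" "U \<subseteq> S" for U
        using that
      proof (induction U rule: finite_induct)
        case (insert j U)
        then have "(\<lambda>i. t i \<star>\<^bsub>M\<^esub> x i) \<in> U \<rightarrow> carrier M"
          "(\<lambda>i. (t i \<star>\<^bsub>M\<^esub> x i) \<star>\<^bsub>M\<^esub> a) \<in> U \<rightarrow> carrier M"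
          "t j \<star>\<^bsub>M\<^esub> x j \<in> carrier M"
          using t xc[OF x] a by auto
        with insert a show ?case by (simp add: M.rsmult_add_left)
      qed (simp add: a)
      with T show ?thesis by blast
    qed
    finally show "k (x \<star>\<^bsub>?F\<^esub> a) = k x \<star>\<^bsub>M\<^esub> a" unfolding k_def .
  qed
  have "k (free_basis R i) = t i" if i: "i \<in> S" for i
  proof -
    have "k (free_basis R i) = (\<Oplus>\<^bsub>M\<^esub>j\<in>{i}. t j \<star>\<^bsub>M\<^esub> free_basis R i j)"
      using i by (intro keq free_basis_closed[OF R]) (auto simp: supp_def free_basis_def)
    also have "\<dots> = t i" using t[OF i] by (simp add: free_basis_def)
    finally show ?thesis .
  qed
  with kh show ?thesis by blast
qed

lemma right_submodule_module:
  assumes M: "right_module R M" and H: "right_submodule R M H"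
  shows "right_module R (M\<lparr>carrier := H\<rparr>)"
proof -
  interpret M: right_module R M by fact
  have ag: "additive_subgroup H M" using H by (simp add: right_submodule_def)
  interpret H: additive_subgroup H M by (rule ag)
  have "abelian_group (M\<lparr>carrier := H\<rparr>)"
  proof (rule abelian_groupI)
    fix x assume "x \<in> carrier (M\<lparr>carrier := H\<rparr>)"
    then have "\<ominus>\<^bsub>M\<^esub> x \<in> H" "\<ominus>\<^bsub>M\<^esub> x \<oplus>\<^bsub>M\<^esub> x = \<zero>\<^bsub>M\<^esub>"
      using M.l_neg M.abelian_group_axioms by (auto intro: H.a_inv_closed)
    then show "\<exists>y\<in>carrier (M\<lparr>carrier := H\<rparr>). y \<oplus>\<^bsub>M\<lparr>carrier := H\<rparr>\<^esub> x = \<zero>\<^bsub>M\<lparr>carrier := H\<rparr>\<^esub>"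
      by auto
  qed (auto simp: M.a_assoc intro: M.a_comm)
  then show ?thesis
    using H M.ring_axioms
    by (auto simp: right_module_def right_module_axioms_def right_submodule_def
        M.rsmult_add_left M.rsmult_add_right M.rsmult_assoc)
qed

lemma (in abelian_group) minus_eq_minus_if_add_eq:
  assumes c: "u \<in> carrier G" "v \<in> carrier G" "u' \<in> carrier G" "v' \<in> carrier G"
    and eq: "u \<oplus> v = u' \<oplus> v'"
  shows "u \<ominus> u' = v' \<ominus> v"
proof -
  have "u \<ominus> u' = (u \<oplus> v) \<oplus> (\<ominus> v \<oplus> \<ominus> u')"
    using c by (simp add: minus_eq a_assoc r_neg2)
  also have "\<dots> = (v' \<oplus> u') \<oplus> (\<ominus> u' \<oplus> \<ominus> v)"
    unfolding eq using c by (simp add: a_comm[of u' v'] a_comm[of "\<ominus> v" "\<ominus> u'"])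
  also have "\<dots> = v' \<ominus> v"
    using c by (simp add: minus_eq a_assoc r_neg2)
  finally show ?thesis .
qed

theorem projective_lifts:
  fixes P :: "('a, 'b, 'm) right_module_scheme"
  assumes P: "projective R P" and A: "right_module R A" and B: "right_module R B"
    and g: "g \<in> right_hom R A B" and surj: "g ` carrier A = carrier B"
    and h: "h \<in> right_hom R P B"
  shows "\<exists>k\<in>right_hom R P A. \<forall>x\<in>carrier P. g (k x) = h x"
proof -
  have P': "right_module R P" using P by (simp add: projective_def)
  have R: "ring R" using P' by (rule right_module_ring)
  interpret P: right_module R P by (rule P')
  obtain S :: "'b set" and U V \<phi> where ds: "direct_summands R (free_right_module R S) U V"
    and \<phi>: "\<phi> \<in> right_iso R P ((free_right_module R S)\<lparr>carrier := U\<rparr>)"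
    using P by (auto simp: projective_def right_isomorphic_def)
  let ?F = "free_right_module R S"
  interpret F: right_module R ?F by (rule free_right_module_is_right_module[OF R])
  interpret U: additive_subgroup U ?F using ds by (simp add: direct_summands_def right_submodule_def)
  interpret V: additive_subgroup V ?F using ds by (simp add: direct_summands_def right_submodule_def)
  have Umul: "u \<star>\<^bsub>?F\<^esub> a \<in> U" if "u \<in> U" "a \<in> carrier R" for u a
    using that ds by (simp add: direct_summands_def right_submodule_def)
  have Vmul: "u \<star>\<^bsub>?F\<^esub> a \<in> V" if "u \<in> V" "a \<in> carrier R" for u a
    using that ds by (simp add: direct_summands_def right_submodule_def)
  have ex: "\<exists>u\<in>U. \<exists>v\<in>V. x = u \<oplus>\<^bsub>?F\<^esub> v" if "x \<in> carrier ?F" for x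
    using that ds unfolding direct_summands_def set_add_def set_mult_def by fastforce
  have uniq: "u = u'" if "u \<in> U" "u' \<in> U" "v \<in> V" "v' \<in> V" "u \<oplus>\<^bsub>?F\<^esub> v = u' \<oplus>\<^bsub>?F\<^esub> v'" for u u' v v'
  proof -
    have c: "u \<in> carrier ?F" "u' \<in> carrier ?F" "v \<in> carrier ?F" "v' \<in> carrier ?F"
      using that by auto
    have "u \<ominus>\<^bsub>?F\<^esub> u' = v' \<ominus>\<^bsub>?F\<^esub> v"
      by (rule F.M.minus_eq_minus_if_add_eq[OF c(1,3,2,4) that(5)])
    moreover have "u \<ominus>\<^bsub>?F\<^esub> u' \<in> U"
      using that F.M.abelian_group_axioms by (auto simp: F.M.minus_eq)
    moreover have "v' \<ominus>\<^bsub>?F\<^esub> v \<in> V"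
      using that F.M.abelian_group_axioms by (auto simp: F.M.minus_eq)
    ultimately have "u \<ominus>\<^bsub>?F\<^esub> u' \<in> U \<inter> V" by simp
    then have "u \<ominus>\<^bsub>?F\<^esub> u' = \<zero>\<^bsub>?F\<^esub>" using ds by (auto simp: direct_summands_def)
    moreover have "u = (u \<ominus>\<^bsub>?F\<^esub> u') \<oplus>\<^bsub>?F\<^esub> u'"
      using c by (simp add: F.M.minus_eq F.M.a_assoc F.M.l_neg)
    ultimately show ?thesis using c by simp
  qed
  define \<pi> where "\<pi> x = (THE u. u \<in> U \<and> (\<exists>v\<in>V. x = u \<oplus>\<^bsub>?F\<^esub> v))" for x
  have pi: "\<pi> (u \<oplus>\<^bsub>?F\<^esub> v) = u" if "u \<in> U" "v \<in> V" for u v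
    unfolding \<pi>_def
  proof (rule the_equality)
    show "u \<in> U \<and> (\<exists>v'\<in>V. u \<oplus>\<^bsub>?F\<^esub> v = u \<oplus>\<^bsub>?F\<^esub> v')" using that by blast
  next
    fix u' assume "u' \<in> U \<and> (\<exists>v'\<in>V. u \<oplus>\<^bsub>?F\<^esub> v = u' \<oplus>\<^bsub>?F\<^esub> v')"
    then obtain v' where "u' \<in> U" "v' \<in> V" "u \<oplus>\<^bsub>?F\<^esub> v = u' \<oplus>\<^bsub>?F\<^esub> v'" by blast
    from uniq[OF that(1) this(1) that(2) this(2,3)] show "u' = u" by simp
  qed
  have \<pi>_hom: "\<pi> \<in> right_hom R ?F (?F\<lparr>carrier := U\<rparr>)"
  proof (rule right_homI)
    fix x assume "x \<in> carrier ?F"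
    from ex[OF this] obtain u v where "u \<in> U" "v \<in> V" "x = u \<oplus>\<^bsub>?F\<^esub> v" by blast
    then show "\<pi> x \<in> carrier (?F\<lparr>carrier := U\<rparr>)" using pi by simp
  next
    fix x y assume xy: "x \<in> carrier ?F" "y \<in> carrier ?F"
    from ex[OF xy(1)] ex[OF xy(2)] obtain u v u' v' where uv: "u \<in> U" "v \<in> V" "x = u \<oplus>\<^bsub>?F\<^esub> v" "u' \<in> U" "v' \<in> V" "y = u' \<oplus>\<^bsub>?F\<^esub> v'"
      by blast
    then have "x \<oplus>\<^bsub>?F\<^esub> y = (u \<oplus>\<^bsub>?F\<^esub> u') \<oplus>\<^bsub>?F\<^esub> (v \<oplus>\<^bsub>?F\<^esub> v')"
      by (simp add: F.M.a_ac)
    then show "\<pi> (x \<oplus>\<^bsub>?F\<^esub> y) = \<pi> x \<oplus>\<^bsub>?F\<lparr>carrier := U\<rparr>\<^esub> \<pi> y"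
      using uv pi by simp
  next
    fix x a assume x: "x \<in> carrier ?F" and a: "a \<in> carrier R"
    from ex[OF x] obtain u v where uv: "u \<in> U" "v \<in> V" "x = u \<oplus>\<^bsub>?F\<^esub> v" by blast
    then have "x \<star>\<^bsub>?F\<^esub> a = u \<star>\<^bsub>?F\<^esub> a \<oplus>\<^bsub>?F\<^esub> v \<star>\<^bsub>?F\<^esub> a"
      using a by (simp add: F.rsmult_add_left)
    then show "\<pi> (x \<star>\<^bsub>?F\<^esub> a) = \<pi> x \<star>\<^bsub>?F\<lparr>carrier := U\<rparr>\<^esub> a"
      using uv pi Umul Vmul a by simp
  qed
  have \<pi>_id: "\<pi> u = u" if "u \<in> U" for u
    using pi[OF that V.zero_closed] that by simp
  have \<phi>h: "\<phi> \<in> right_hom R P (?F\<lparr>carrier := U\<rparr>)" and bij: "bij_betw \<phi> (carrier P) U"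
    using \<phi> by (auto simp: right_iso_def)
  define \<psi> where "\<psi> = inv_into (carrier P) \<phi>"
  have \<psi>c: "\<psi> u \<in> carrier P" "\<phi> (\<psi> u) = u" if "u \<in> U" for u
    using that bij unfolding \<psi>_def bij_betw_def by (auto intro: inv_into_into f_inv_into_f)
  have \<psi>\<phi>: "\<psi> (\<phi> x) = x" if "x \<in> carrier P" for x
    using that bij unfolding \<psi>_def bij_betw_def by auto
  have \<psi>h: "\<psi> \<in> right_hom R (?F\<lparr>carrier := U\<rparr>) P"
  proof (rule right_homI)
    fix x assume "x \<in> carrier (?F\<lparr>carrier := U\<rparr>)" then show "\<psi> x \<in> carrier P" using \<psi>c by simp
  next
    fix x y assume "x \<in> carrier (?F\<lparr>carrier := U\<rparr>)" "y \<in> carrier (?F\<lparr>carrier := U\<rparr>)"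
    then show "\<psi> (x \<oplus>\<^bsub>?F\<lparr>carrier := U\<rparr>\<^esub> y) = \<psi> x \<oplus>\<^bsub>P\<^esub> \<psi> y"
      using right_hom_add[OF \<phi>h \<psi>c(1) \<psi>c(1), of x y] \<psi>\<phi>[of "\<psi> x \<oplus>\<^bsub>P\<^esub> \<psi> y"] \<psi>c by simp
  next
    fix x a assume "x \<in> carrier (?F\<lparr>carrier := U\<rparr>)" "a \<in> carrier R"
    then show "\<psi> (x \<star>\<^bsub>?F\<lparr>carrier := U\<rparr>\<^esub> a) = \<psi> x \<star>\<^bsub>P\<^esub> a"
      using right_hom_rsmult[OF \<phi>h \<psi>c(1), of x a] \<psi>\<phi>[of "\<psi> x \<star>\<^bsub>P\<^esub> a"] \<psi>c by simp
  qed
  define q where "q = h \<circ> (\<psi> \<circ> \<pi>)"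
  have q: "q \<in> right_hom R ?F B"
    unfolding q_def by (intro right_hom_comp[OF _ h] right_hom_comp[OF \<pi>_hom \<psi>h])
  have "\<forall>i\<in>S. \<exists>a\<in>carrier A. g a = q (free_basis R i)"
    using right_hom_closed[OF q free_basis_closed[OF R]] surj by (metis imageE)
  then obtain t where t: "\<And>i. i \<in> S \<Longrightarrow> t i \<in> carrier A" "\<And>i. i \<in> S \<Longrightarrow> g (t i) = q (free_basis R i)"
    by metis
  obtain l where l: "l \<in> right_hom R ?F A" "\<And>i. i \<in> S \<Longrightarrow> l (free_basis R i) = t i"
    using free_right_hom_exists[OF R A, of S t] t(1) by blast
  have gl: "g (l x) = q x" if "x \<in> carrier ?F" for x
    using free_right_hom_eq[OF R B right_hom_comp[OF l(1) g] q _ that] l(2) t(2) by simp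
  have "\<phi> \<in> right_hom R P ?F"
    using \<phi>h U.a_subset by (auto simp: right_hom_def hom_def)
  then have "l \<circ> \<phi> \<in> right_hom R P A" using l(1) by (rule right_hom_comp)
  moreover have "g ((l \<circ> \<phi>) x) = h x" if x: "x \<in> carrier P" for x
  proof -
    have "\<phi> x \<in> U" using right_hom_closed[OF \<phi>h x] by simp
    then show ?thesis using gl[of "\<phi> x"] \<pi>_id \<psi>\<phi>[OF x] by (simp add: q_def)
  qed
  ultimately show ?thesis by blast
qed

text \<open>Conversely, it suffices that all surjections onto P, from modules of one fixed type, split.\<close>

theorem projective_if_lifts:
  fixes P :: "('a, 'b, 'm) right_module_scheme"
  assumes P: "right_module R P"
    and split: "\<And>(A :: ('a, 'b \<Rightarrow> 'a) right_module) g.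
      \<lbrakk>right_module R A; g \<in> right_hom R A P; g ` carrier A = carrier P\<rbrakk>
      \<Longrightarrow> \<exists>k\<in>right_hom R P A. \<forall>x\<in>carrier P. g (k x) = x"
  shows "projective R P"
proof -
  have R: "ring R" using P by (rule right_module_ring)
  interpret P: right_module R P by (rule P)
  let ?F = "free_right_module R (carrier P)"
  have F: "right_module R ?F" by (rule free_right_module_is_right_module[OF R])
  interpret F: right_module R ?F by (rule F)
  obtain g where g: "g \<in> right_hom R ?F P" "\<And>x. x \<in> carrier P \<Longrightarrow> g (free_basis R x) = x"
    using free_right_hom_exists[OF R P, of "carrier P" "\<lambda>x. x"] by auto
  have "g ` carrier ?F = carrier P"
  proof
    show "g ` carrier ?F \<subseteq> carrier P" using right_hom_closed[OF g(1)] by blast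
    show "carrier P \<subseteq> g ` carrier ?F"
      using g(2) free_basis_closed[OF R] by (metis image_eqI subsetI)
  qed
  then obtain k where k: "k \<in> right_hom R P ?F" and gk: "\<And>x. x \<in> carrier P \<Longrightarrow> g (k x) = x"
    using split[OF F g(1)] by blast
  define U where "U = k ` carrier P"
  define V where "V = {x \<in> carrier ?F. g x = \<zero>\<^bsub>P\<^esub>}"
  have kgh: "group_hom (add_monoid P) (add_monoid ?F) k"
    by (rule right_hom_group_hom[OF P.abelian_group_axioms F.abelian_group_axioms k])
  have ggh: "group_hom (add_monoid ?F) (add_monoid P) g"
    by (rule right_hom_group_hom[OF F.abelian_group_axioms P.abelian_group_axioms g(1)])
  have Us: "right_submodule R ?F U"
    unfolding right_submodule_def
  proof
    show "additive_subgroup U ?F"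
      using group_hom.img_is_subgroup[OF kgh] by (intro additive_subgroupI) (simp add: U_def)
    show "\<forall>x\<in>U. \<forall>a\<in>carrier R. x \<star>\<^bsub>?F\<^esub> a \<in> U"
      using right_hom_rsmult[OF k, symmetric] by (auto simp: U_def)
  qed
  have Vs: "right_submodule R ?F V"
    unfolding right_submodule_def
  proof
    show "additive_subgroup V ?F"
      using group_hom.subgroup_kernel[OF ggh] by (intro additive_subgroupI) (simp add: V_def kernel_def)
    show "\<forall>x\<in>V. \<forall>a\<in>carrier R. x \<star>\<^bsub>?F\<^esub> a \<in> V"
      using right_hom_rsmult[OF g(1)] by (auto simp: V_def)
  qed
  have g0: "g \<zero>\<^bsub>?F\<^esub> = \<zero>\<^bsub>P\<^esub>"
    by (rule right_hom_zero[OF F.abelian_group_axioms P.abelian_group_axioms g(1)])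
  have k0: "k \<zero>\<^bsub>P\<^esub> = \<zero>\<^bsub>?F\<^esub>"
    by (rule right_hom_zero[OF P.abelian_group_axioms F.abelian_group_axioms k])
  have int: "U \<inter> V = {\<zero>\<^bsub>?F\<^esub>}"
  proof
    show "U \<inter> V \<subseteq> {\<zero>\<^bsub>?F\<^esub>}" using gk k0 by (auto simp: U_def V_def)
    have "\<zero>\<^bsub>?F\<^esub> \<in> U" using k0 by (metis P.M.zero_closed U_def image_eqI)
    then show "{\<zero>\<^bsub>?F\<^esub>} \<subseteq> U \<inter> V" using g0 by (simp add: V_def)
  qed
  have kc: "k y \<in> carrier ?F" if "y \<in> carrier P" for y using right_hom_closed[OF k that] .
  have gc: "g y \<in> carrier P" if "y \<in> carrier ?F" for y using right_hom_closed[OF g(1) that] .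
  have sum: "U <+>\<^bsub>?F\<^esub> V = carrier ?F"
  proof
    show "U <+>\<^bsub>?F\<^esub> V \<subseteq> carrier ?F"
      using kc by (auto simp: set_add_def set_mult_def U_def V_def)
    show "carrier ?F \<subseteq> U <+>\<^bsub>?F\<^esub> V"
    proof
      fix x assume x: "x \<in> carrier ?F"
      let ?u = "k (g x)" let ?v = "\<ominus>\<^bsub>?F\<^esub> ?u \<oplus>\<^bsub>?F\<^esub> x"
      have u: "?u \<in> carrier ?F" "?u \<in> U" using x kc gc by (auto simp: U_def)
      have "g ?v = \<ominus>\<^bsub>P\<^esub> g ?u \<oplus>\<^bsub>P\<^esub> g x"
        using right_hom_add[OF g(1), of "\<ominus>\<^bsub>?F\<^esub> ?u" x] x u
          right_hom_a_inv[OF F.abelian_group_axioms P.abelian_group_axioms g(1), of ?u] by simp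
      then have "g ?v = \<zero>\<^bsub>P\<^esub>" using gk gc[OF x] by (simp add: P.M.l_neg)
      then have "?v \<in> V" using x u by (simp add: V_def)
      moreover have "x = ?u \<oplus>\<^bsub>?F\<^esub> ?v" using x u by (simp add: F.M.r_neg2)
      ultimately show "x \<in> U <+>\<^bsub>?F\<^esub> V"
        using u by (auto simp: set_add_def set_mult_def)
    qed
  qed
  have "k \<in> right_iso R P (?F\<lparr>carrier := U\<rparr>)"
  proof -
    have "inj_on k (carrier P)" using gk by (metis inj_onI)
    then show ?thesis using k by (auto simp: right_iso_def right_hom_def hom_def U_def bij_betw_def)
  qed
  then show ?thesis
    using P Us Vs int sum unfolding projective_def direct_summands_def right_isomorphic_def by blast
qed


section \<open>The reduction of a module and the trace ideal\<close>

lemma right_module_ideal_prod_submodule: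
  assumes M: "right_module R M" and N: "ideal N R"
  shows "right_submodule R M (right_module_ideal_prod M N)"
proof -
  interpret M: right_module R M by (rule M)
  interpret N: ideal N R by (rule N)
  let ?G = "{x \<star>\<^bsub>M\<^esub> a | x a. x \<in> carrier M \<and> a \<in> N}"
  have G: "?G \<subseteq> carrier M" using N.a_Hcarr by auto
  have sub: "subgroup (right_module_ideal_prod M N) (add_monoid M)"
    unfolding right_module_ideal_prod_def by (rule M.add.generate_is_subgroup[OF G])
  have "h \<star>\<^bsub>M\<^esub> a \<in> generate (add_monoid M) ?G"
    if "h \<in> generate (add_monoid M) ?G" "a \<in> carrier R" for h a
    using that
  proof (induction h rule: generate.induct)
    case one
    then show ?case using generate.one[of "add_monoid M" ?G] by simp
  next
    case (incl h)
    then obtain x b where "x \<in> carrier M" "b \<in> N" "h = x \<star>\<^bsub>M\<^esub> b" by blast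
    then have "h \<star>\<^bsub>M\<^esub> a = x \<star>\<^bsub>M\<^esub> (b \<otimes>\<^bsub>R\<^esub> a)" "x \<in> carrier M" "b \<otimes>\<^bsub>R\<^esub> a \<in> N"
      using incl.prems N.a_Hcarr N.I_r_closed by (auto simp: M.rsmult_assoc)
    then show ?case by (intro generate.incl) blast
  next
    case (inv h)
    then obtain x b where xb: "x \<in> carrier M" "b \<in> N" "h = x \<star>\<^bsub>M\<^esub> b" by blast
    then have h: "h \<star>\<^bsub>M\<^esub> a = x \<star>\<^bsub>M\<^esub> (b \<otimes>\<^bsub>R\<^esub> a)" "x \<in> carrier M" "b \<otimes>\<^bsub>R\<^esub> a \<in> N" "h \<in> carrier M"
      using inv.prems N.a_Hcarr N.I_r_closed by (auto simp: M.rsmult_assoc)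
    then have "h \<star>\<^bsub>M\<^esub> a \<in> ?G" by blast
    then have "inv\<^bsub>add_monoid M\<^esub> (h \<star>\<^bsub>M\<^esub> a) \<in> generate (add_monoid M) ?G" by (rule generate.inv)
    then show ?case using M.rsmult_minus_left[OF h(4) inv.prems] by (simp add: a_inv_def)
  next
    case (eng h1 h2)
    have "h1 \<in> carrier M" "h2 \<in> carrier M"
      using eng.hyps M.add.generate_in_carrier[OF G] by auto
    then show ?case
      using eng.IH eng.prems generate.eng[of "h1 \<star>\<^bsub>M\<^esub> a" "add_monoid M" ?G "h2 \<star>\<^bsub>M\<^esub> a"]
      by (simp add: M.rsmult_add_left)
  qed
  with sub show ?thesis
    unfolding right_submodule_def by (auto intro: additive_subgroupI simp: right_module_ideal_prod_def)
qed

lemma UN_const_eq: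
  assumes "\<And>x. x \<in> X \<Longrightarrow> F x = C" and "x \<in> X"
  shows "(\<Union>x\<in>X. F x) = C"
  using assms by (metis SUP_eq_const empty_iff)

lemma UN_UN_const:
  assumes "\<And>x y. \<lbrakk>x \<in> X; y \<in> Y\<rbrakk> \<Longrightarrow> F x y = C" and "x \<in> X" and "y \<in> Y"
  shows "(\<Union>x\<in>X. \<Union>y\<in>Y. F x y) = C"
proof -
  have "(\<Union>x\<in>X. \<Union>y\<in>Y. F x y) = (\<Union>x\<in>X. \<Union>y\<in>Y. C)" using assms(1) by simp
  also have "\<dots> = C" using assms(2,3) by blast
  finally show ?thesis .
qed

lemma right_module_quot_rsmult:
  assumes M: "right_module R M" and N: "ideal N R" and H: "right_submodule R M H"
    and HN: "right_module_ideal_prod M N \<subseteq> H"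
    and x: "x \<in> carrier M" and a: "a \<in> carrier R"
  shows "(H +>\<^bsub>M\<^esub> x) \<star>\<^bsub>right_module_quot M H\<^esub> (N +>\<^bsub>R\<^esub> a) = H +>\<^bsub>M\<^esub> (x \<star>\<^bsub>M\<^esub> a)"
proof -
  interpret M: right_module R M by (rule M)
  interpret N: ideal N R by (rule N)
  interpret H: abelian_subgroup H M
    using H M.abelian_group_axioms by (intro abelian_subgroupI3) (auto simp: right_submodule_def)
  have "H +>\<^bsub>M\<^esub> (y \<star>\<^bsub>M\<^esub> b) = H +>\<^bsub>M\<^esub> (x \<star>\<^bsub>M\<^esub> a)" if y: "y \<in> H +>\<^bsub>M\<^esub> x" and b: "b \<in> N +>\<^bsub>R\<^esub> a" for y b
  proof -
    obtain h where h: "h \<in> H" "y = h \<oplus>\<^bsub>M\<^esub> x" using y by (auto simp: a_r_coset_def r_coset_def)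
    obtain n where n: "n \<in> N" "b = n \<oplus>\<^bsub>R\<^esub> a" using b by (auto simp: a_r_coset_def r_coset_def)
    have c: "h \<in> carrier M" "n \<in> carrier R" "b \<in> carrier R" using h n a N.a_Hcarr H.a_Hcarr by auto
    have "x \<star>\<^bsub>M\<^esub> n \<in> H"
      using HN x n(1) unfolding right_module_ideal_prod_def by (blast intro: generate.incl)
    moreover have "h \<star>\<^bsub>M\<^esub> b \<in> H" using H h c by (simp add: right_submodule_def)
    ultimately have k: "h \<star>\<^bsub>M\<^esub> b \<oplus>\<^bsub>M\<^esub> x \<star>\<^bsub>M\<^esub> n \<in> H" by (rule H.a_closed[rotated])
    have "y \<star>\<^bsub>M\<^esub> b = h \<star>\<^bsub>M\<^esub> b \<oplus>\<^bsub>M\<^esub> (x \<star>\<^bsub>M\<^esub> n \<oplus>\<^bsub>M\<^esub> x \<star>\<^bsub>M\<^esub> a)"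
      using h(2) n(2) c x a M.rsmult_add_left[of h x b] M.rsmult_add_right[of x n a] by simp
    also have "\<dots> = (h \<star>\<^bsub>M\<^esub> b \<oplus>\<^bsub>M\<^esub> x \<star>\<^bsub>M\<^esub> n) \<oplus>\<^bsub>M\<^esub> x \<star>\<^bsub>M\<^esub> a"
      using c x a by (simp add: M.M.a_assoc)
    finally have "y \<star>\<^bsub>M\<^esub> b \<in> H +>\<^bsub>M\<^esub> (x \<star>\<^bsub>M\<^esub> a)"
      using k by (auto simp: a_r_coset_def r_coset_def)
    then show ?thesis
      using H.a_repr_independence'[of "y \<star>\<^bsub>M\<^esub> b" "x \<star>\<^bsub>M\<^esub> a"] x a by simp
  qed
  note const = this
  have self: "x \<in> H +>\<^bsub>M\<^esub> x" "a \<in> N +>\<^bsub>R\<^esub> a"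
    using x a H.a_rcos_self N.a_rcos_self by auto
  show ?thesis
    unfolding right_module_quot_def right_module.simps by (rule UN_UN_const[OF const self])
qed

lemma reduction_rsmult:
  assumes "right_module R M" "ideal N R" "x \<in> carrier M" "a \<in> carrier R"
  shows "(right_module_ideal_prod M N +>\<^bsub>M\<^esub> x) \<star>\<^bsub>reduction M N\<^esub> (N +>\<^bsub>R\<^esub> a)
    = right_module_ideal_prod M N +>\<^bsub>M\<^esub> (x \<star>\<^bsub>M\<^esub> a)"
  using assms unfolding reduction_def
  by (intro right_module_quot_rsmult right_module_ideal_prod_submodule) auto

theorem reduction_is_right_module:
  assumes M: "right_module R M" and N: "ideal N R"
  shows "right_module (R Quot N) (reduction M N)"
proof -
  interpret M: right_module R M by (rule M)
  interpret N: ideal N R by (rule N)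
  let ?H = "right_module_ideal_prod M N"
  let ?Q = "reduction M N"
  interpret H: abelian_subgroup ?H M
    using right_module_ideal_prod_submodule[OF M N] M.abelian_group_axioms
    by (intro abelian_subgroupI3) (auto simp: right_submodule_def)
  have carr: "\<exists>x\<in>carrier M. C = ?H +>\<^bsub>M\<^esub> x" if "C \<in> carrier ?Q" for C
    using that by (auto simp: reduction_def right_module_quot_def A_RCOSETS_defs a_r_coset_def r_coset_def)
  have mem: "?H +>\<^bsub>M\<^esub> x \<in> carrier ?Q" if "x \<in> carrier M" for x
    using that by (auto simp: reduction_def right_module_quot_def A_RCOSETS_defs a_r_coset_def r_coset_def)
  have rcarr: "\<exists>a\<in>carrier R. A = N +>\<^bsub>R\<^esub> a" if "A \<in> carrier (R Quot N)" for A
    using that by (auto simp: FactRing_simps)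
  have add: "(?H +>\<^bsub>M\<^esub> x) \<oplus>\<^bsub>?Q\<^esub> (?H +>\<^bsub>M\<^esub> y) = ?H +>\<^bsub>M\<^esub> (x \<oplus>\<^bsub>M\<^esub> y)"
    if "x \<in> carrier M" "y \<in> carrier M" for x y
    using H.a_rcos_sum[OF that] by (simp add: reduction_def right_module_quot_def)
  have zero: "\<zero>\<^bsub>?Q\<^esub> = ?H +>\<^bsub>M\<^esub> \<zero>\<^bsub>M\<^esub>"
    using M.a_coset_add_zero[OF H.a_subset] by (simp add: reduction_def right_module_quot_def)
  have ab: "abelian_group ?Q"
  proof (rule abelian_groupI)
    fix C D assume "C \<in> carrier ?Q" "D \<in> carrier ?Q"
    with carr obtain x y where "x \<in> carrier M" "C = ?H +>\<^bsub>M\<^esub> x" "y \<in> carrier M" "D = ?H +>\<^bsub>M\<^esub> y"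
      by metis
    then show "C \<oplus>\<^bsub>?Q\<^esub> D \<in> carrier ?Q" and "C \<oplus>\<^bsub>?Q\<^esub> D = D \<oplus>\<^bsub>?Q\<^esub> C"
      by (simp_all add: add mem M.a_comm)
  next
    fix C D E assume "C \<in> carrier ?Q" "D \<in> carrier ?Q" "E \<in> carrier ?Q"
    with carr obtain x y z where "x \<in> carrier M" "C = ?H +>\<^bsub>M\<^esub> x" "y \<in> carrier M"
      "D = ?H +>\<^bsub>M\<^esub> y" "z \<in> carrier M" "E = ?H +>\<^bsub>M\<^esub> z"
      by metis
    then show "C \<oplus>\<^bsub>?Q\<^esub> D \<oplus>\<^bsub>?Q\<^esub> E = C \<oplus>\<^bsub>?Q\<^esub> (D \<oplus>\<^bsub>?Q\<^esub> E)"
      by (simp add: add M.a_assoc)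
  next
    fix C assume "C \<in> carrier ?Q"
    with carr obtain x where x: "x \<in> carrier M" "C = ?H +>\<^bsub>M\<^esub> x" by metis
    then show "\<zero>\<^bsub>?Q\<^esub> \<oplus>\<^bsub>?Q\<^esub> C = C" by (simp add: zero add)
    have "(?H +>\<^bsub>M\<^esub> (\<ominus>\<^bsub>M\<^esub> x)) \<oplus>\<^bsub>?Q\<^esub> C = \<zero>\<^bsub>?Q\<^esub>"
      using x by (simp add: zero add M.l_neg)
    then show "\<exists>D\<in>carrier ?Q. D \<oplus>\<^bsub>?Q\<^esub> C = \<zero>\<^bsub>?Q\<^esub>" using x mem by blast
  qed (simp add: zero mem)
  have radd: "(N +>\<^bsub>R\<^esub> a) \<oplus>\<^bsub>R Quot N\<^esub> (N +>\<^bsub>R\<^esub> b) = N +>\<^bsub>R\<^esub> (a \<oplus>\<^bsub>R\<^esub> b)"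
    if "a \<in> carrier R" "b \<in> carrier R" for a b
    using N.a_rcos_sum[OF that] by (simp add: FactRing_def)
  have rmul: "(N +>\<^bsub>R\<^esub> a) \<otimes>\<^bsub>R Quot N\<^esub> (N +>\<^bsub>R\<^esub> b) = N +>\<^bsub>R\<^esub> (a \<otimes>\<^bsub>R\<^esub> b)"
    if "a \<in> carrier R" "b \<in> carrier R" for a b
    using N.rcoset_mult_add[OF that] by (simp add: FactRing_def)
  have rone: "\<one>\<^bsub>R Quot N\<^esub> = N +>\<^bsub>R\<^esub> \<one>\<^bsub>R\<^esub>" by (simp add: FactRing_def)
  note mul = reduction_rsmult[OF M N]
  show ?thesis
  proof (intro right_module.intro right_module_axioms.intro N.quotient_is_ring ab)
    fix C A assume "C \<in> carrier ?Q" "A \<in> carrier (R Quot N)"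
    with carr rcarr obtain x a where "x \<in> carrier M" "C = ?H +>\<^bsub>M\<^esub> x" "a \<in> carrier R" "A = N +>\<^bsub>R\<^esub> a"
      by metis
    then show "C \<star>\<^bsub>?Q\<^esub> A \<in> carrier ?Q" by (simp add: mul mem)
  next
    fix C D A assume "C \<in> carrier ?Q" "D \<in> carrier ?Q" "A \<in> carrier (R Quot N)"
    with carr rcarr obtain x y a where "x \<in> carrier M" "C = ?H +>\<^bsub>M\<^esub> x"
      "y \<in> carrier M" "D = ?H +>\<^bsub>M\<^esub> y" "a \<in> carrier R" "A = N +>\<^bsub>R\<^esub> a"
      by metis
    then show "(C \<oplus>\<^bsub>?Q\<^esub> D) \<star>\<^bsub>?Q\<^esub> A = C \<star>\<^bsub>?Q\<^esub> A \<oplus>\<^bsub>?Q\<^esub> D \<star>\<^bsub>?Q\<^esub> A"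
      by (simp add: mul add M.rsmult_add_left)
  next
    fix C A B assume "C \<in> carrier ?Q" "A \<in> carrier (R Quot N)" "B \<in> carrier (R Quot N)"
    with carr rcarr obtain x a b where "x \<in> carrier M" "C = ?H +>\<^bsub>M\<^esub> x"
      "a \<in> carrier R" "A = N +>\<^bsub>R\<^esub> a" "b \<in> carrier R" "B = N +>\<^bsub>R\<^esub> b"
      by metis
    then show "C \<star>\<^bsub>?Q\<^esub> (A \<oplus>\<^bsub>R Quot N\<^esub> B) = C \<star>\<^bsub>?Q\<^esub> A \<oplus>\<^bsub>?Q\<^esub> C \<star>\<^bsub>?Q\<^esub> B"
      and "C \<star>\<^bsub>?Q\<^esub> (A \<otimes>\<^bsub>R Quot N\<^esub> B) = (C \<star>\<^bsub>?Q\<^esub> A) \<star>\<^bsub>?Q\<^esub> B"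
      by (simp_all add: mul add radd rmul M.rsmult_add_right M.rsmult_assoc)
  next
    fix C assume "C \<in> carrier ?Q"
    with carr obtain x where "x \<in> carrier M" "C = ?H +>\<^bsub>M\<^esub> x" by metis
    then show "C \<star>\<^bsub>?Q\<^esub> \<one>\<^bsub>R Quot N\<^esub> = C" by (simp add: mul rone)
  qed
qed

lemma right_hom_ideal_prod:
  assumes M: "right_module R M" and M': "right_module R M'" and N: "ideal N R"
    and f: "f \<in> right_hom R M M'" and h: "h \<in> right_module_ideal_prod M N"
  shows "f h \<in> right_module_ideal_prod M' N"
proof -
  interpret M: right_module R M by (rule M)
  interpret M': right_module R M' by (rule M')
  interpret N: ideal N R by (rule N)
  let ?G = "{x \<star>\<^bsub>M\<^esub> a | x a. x \<in> carrier M \<and> a \<in> N}"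
  let ?G' = "{x \<star>\<^bsub>M'\<^esub> a | x a. x \<in> carrier M' \<and> a \<in> N}"
  interpret f: group_hom "add_monoid M" "add_monoid M'" f
    by (rule right_hom_group_hom[OF M.abelian_group_axioms M'.abelian_group_axioms f])
  have G: "?G \<subseteq> carrier (add_monoid M)" using N.a_Hcarr by auto
  have G': "?G' \<subseteq> carrier (add_monoid M')" using N.a_Hcarr by auto
  have "f ` ?G \<subseteq> ?G'"
  proof
    fix z assume "z \<in> f ` ?G"
    then obtain x a where "x \<in> carrier M" "a \<in> N" "z = f (x \<star>\<^bsub>M\<^esub> a)" by blast
    then show "z \<in> ?G'"
      using right_hom_rsmult[OF f, of x a] right_hom_closed[OF f, of x] N.a_Hcarr[of a] by blast
  qed
  then have "generate (add_monoid M') (f ` ?G) \<subseteq> generate (add_monoid M') ?G'"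
    by (rule M'.add.mono_generate)
  moreover have "f h \<in> generate (add_monoid M') (f ` ?G)"
    using f.generate_img[OF G] h unfolding right_module_ideal_prod_def by blast
  ultimately show ?thesis unfolding right_module_ideal_prod_def by blast
qed

lemma reduction_map_coset:
  assumes M: "right_module R M" and M': "right_module R M'" and N: "ideal N R"
    and f: "f \<in> right_hom R M M'" and x: "x \<in> carrier M"
  shows "reduction_map M' N f (right_module_ideal_prod M N +>\<^bsub>M\<^esub> x)
    = right_module_ideal_prod M' N +>\<^bsub>M'\<^esub> f x"
proof -
  interpret M: right_module R M by (rule M)
  interpret M': right_module R M' by (rule M')
  let ?H = "right_module_ideal_prod M N"
  let ?H' = "right_module_ideal_prod M' N"
  interpret H: abelian_subgroup ?H M
    using right_module_ideal_prod_submodule[OF M N] M.abelian_group_axioms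
    by (intro abelian_subgroupI3) (auto simp: right_submodule_def)
  interpret H': abelian_subgroup ?H' M'
    using right_module_ideal_prod_submodule[OF M' N] M'.abelian_group_axioms
    by (intro abelian_subgroupI3) (auto simp: right_submodule_def)
  have "?H' +>\<^bsub>M'\<^esub> f y = ?H' +>\<^bsub>M'\<^esub> f x" if y: "y \<in> ?H +>\<^bsub>M\<^esub> x" for y
  proof -
    obtain h where h: "h \<in> ?H" "y = h \<oplus>\<^bsub>M\<^esub> x"
      using y by (auto simp: a_r_coset_def r_coset_def)
    then have "f y = f h \<oplus>\<^bsub>M'\<^esub> f x" using right_hom_add[OF f H.a_Hcarr[OF h(1)] x] by simp
    then have "f y \<in> ?H' +>\<^bsub>M'\<^esub> f x"
      using right_hom_ideal_prod[OF M M' N f h(1)] by (auto simp: a_r_coset_def r_coset_def)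
    then show ?thesis
      using H'.a_repr_independence'[of "f y" "f x"] right_hom_closed[OF f x] by simp
  qed
  from UN_const_eq[OF this H.a_rcos_self[OF x]]
  show ?thesis unfolding reduction_map_def by simp
qed

lemma reduction_map_right_hom:
  assumes M: "right_module R M" and M': "right_module R M'" and N: "ideal N R"
    and f: "f \<in> right_hom R M M'"
  shows "reduction_map M' N f \<in> right_hom (R Quot N) (reduction M N) (reduction M' N)"
proof -
  interpret M: right_module R M by (rule M)
  interpret M': right_module R M' by (rule M')
  interpret N: ideal N R by (rule N)
  let ?H = "right_module_ideal_prod M N"
  let ?H' = "right_module_ideal_prod M' N"
  interpret H: abelian_subgroup ?H M
    using right_module_ideal_prod_submodule[OF M N] M.abelian_group_axioms
    by (intro abelian_subgroupI3) (auto simp: right_submodule_def)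
  interpret H': abelian_subgroup ?H' M'
    using right_module_ideal_prod_submodule[OF M' N] M'.abelian_group_axioms
    by (intro abelian_subgroupI3) (auto simp: right_submodule_def)
  have carr: "\<exists>x\<in>carrier M. C = ?H +>\<^bsub>M\<^esub> x" if "C \<in> carrier (reduction M N)" for C
    using that by (auto simp: reduction_def right_module_quot_def A_RCOSETS_defs a_r_coset_def r_coset_def)
  have mem: "?H' +>\<^bsub>M'\<^esub> x \<in> carrier (reduction M' N)" if "x \<in> carrier M'" for x
    using that by (auto simp: reduction_def right_module_quot_def A_RCOSETS_defs a_r_coset_def r_coset_def)
  have rcarr: "\<exists>a\<in>carrier R. A = N +>\<^bsub>R\<^esub> a" if "A \<in> carrier (R Quot N)" for A
    using that by (auto simp: FactRing_simps)
  have add: "(?H +>\<^bsub>M\<^esub> x) \<oplus>\<^bsub>reduction M N\<^esub> (?H +>\<^bsub>M\<^esub> y) = ?H +>\<^bsub>M\<^esub> (x \<oplus>\<^bsub>M\<^esub> y)"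
    if "x \<in> carrier M" "y \<in> carrier M" for x y
    using H.a_rcos_sum[OF that] by (simp add: reduction_def right_module_quot_def)
  have add': "(?H' +>\<^bsub>M'\<^esub> x) \<oplus>\<^bsub>reduction M' N\<^esub> (?H' +>\<^bsub>M'\<^esub> y) = ?H' +>\<^bsub>M'\<^esub> (x \<oplus>\<^bsub>M'\<^esub> y)"
    if "x \<in> carrier M'" "y \<in> carrier M'" for x y
    using H'.a_rcos_sum[OF that] by (simp add: reduction_def right_module_quot_def)
  note red = reduction_map_coset[OF M M' N f] and fc = right_hom_closed[OF f]
    and fadd = right_hom_add[OF f] and fmul = right_hom_rsmult[OF f]
    and mul = reduction_rsmult[OF M N] and mul' = reduction_rsmult[OF M' N]
  show ?thesis
  proof (rule right_homI)
    fix C assume "C \<in> carrier (reduction M N)"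
    with carr obtain x where "x \<in> carrier M" "C = ?H +>\<^bsub>M\<^esub> x" by metis
    then show "reduction_map M' N f C \<in> carrier (reduction M' N)" by (simp add: red fc mem)
  next
    fix C D assume "C \<in> carrier (reduction M N)" "D \<in> carrier (reduction M N)"
    with carr obtain x y where "x \<in> carrier M" "C = ?H +>\<^bsub>M\<^esub> x" "y \<in> carrier M" "D = ?H +>\<^bsub>M\<^esub> y"
      by metis
    then show "reduction_map M' N f (C \<oplus>\<^bsub>reduction M N\<^esub> D)
        = reduction_map M' N f C \<oplus>\<^bsub>reduction M' N\<^esub> reduction_map M' N f D"
      by (simp add: red fc add add' fadd)
  next
    fix C A assume "C \<in> carrier (reduction M N)" "A \<in> carrier (R Quot N)"
    with carr rcarr obtain x a where "x \<in> carrier M" "C = ?H +>\<^bsub>M\<^esub> x" "a \<in> carrier R" "A = N +>\<^bsub>R\<^esub> a"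
      by metis
    then show "reduction_map M' N f (C \<star>\<^bsub>reduction M N\<^esub> A)
        = reduction_map M' N f C \<star>\<^bsub>reduction M' N\<^esub> A"
      by (simp add: red fc mul mul' fmul)
  qed
qed

lemma regular_right_module_is_right_module:
  assumes "ring R" shows "right_module R (regular_right_module R)"
proof -
  interpret R: ring R by fact
  let ?L = "regular_right_module R"
  have "abelian_group ?L"
  proof (rule abelian_groupI)
    fix x assume "x \<in> carrier ?L"
    then have "\<ominus>\<^bsub>R\<^esub> x \<in> carrier ?L" "(\<ominus>\<^bsub>R\<^esub> x) \<oplus>\<^bsub>?L\<^esub> x = \<zero>\<^bsub>?L\<^esub>"
      by (simp_all add: regular_right_module_def R.l_neg)
    then show "\<exists>y\<in>carrier ?L. y \<oplus>\<^bsub>?L\<^esub> x = \<zero>\<^bsub>?L\<^esub>" by blast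
  qed (simp_all add: regular_right_module_def R.a_ac)
  then show ?thesis
    using R.ring_axioms
    by (auto simp: right_module_def right_module_axioms_def regular_right_module_def
        R.l_distr R.r_distr R.m_assoc)
qed

theorem trace_ideal_is_ideal:
  assumes M: "right_module R M"
  shows "ideal (trace_ideal R M) R"
proof -
  interpret M: right_module R M by (rule M)
  let ?L = "regular_right_module R"
  define G where "G = (\<Union>f\<in>right_hom R M ?L. f ` carrier M)"
  have tr: "trace_ideal R M = generate (add_monoid R) G" by (simp add: trace_ideal_def G_def)
  have Gc: "G \<subseteq> carrier R"
    using right_hom_closed by (fastforce simp: G_def regular_right_module_def)
  have Gr: "g \<otimes>\<^bsub>R\<^esub> a \<in> G" if ga: "g \<in> G" "a \<in> carrier R" for g a
  proof -
    obtain f x where f: "f \<in> right_hom R M ?L" "x \<in> carrier M" "g = f x" using ga by (auto simp: G_def)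
    then have "g \<otimes>\<^bsub>R\<^esub> a = f (x \<star>\<^bsub>M\<^esub> a)"
      using right_hom_rsmult[OF f(1,2) ga(2)] by (simp add: regular_right_module_def)
    then show ?thesis using f(1,2) ga(2) M.rsmult_closed unfolding G_def by blast
  qed
  have Gl: "a \<otimes>\<^bsub>R\<^esub> g \<in> G" if ga: "g \<in> G" "a \<in> carrier R" for g a
  proof -
    obtain f x where f: "f \<in> right_hom R M ?L" "x \<in> carrier M" "g = f x" using ga by (auto simp: G_def)
    have fc: "f y \<in> carrier R" if "y \<in> carrier M" for y
      using right_hom_closed[OF f(1) that] by (simp add: regular_right_module_def)
    have "(\<lambda>y. a \<otimes>\<^bsub>R\<^esub> f y) \<in> right_hom R M ?L"
      using right_hom_add[OF f(1)] right_hom_rsmult[OF f(1)] fc ga(2)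
      by (intro right_homI) (auto simp: regular_right_module_def M.R.r_distr M.R.m_assoc)
    then show ?thesis using f(2,3) unfolding G_def by blast
  qed
  have sub: "subgroup (trace_ideal R M) (add_monoid R)"
    unfolding tr by (rule M.R.add.generate_is_subgroup[OF Gc])
  have "h \<in> carrier R \<and> h \<otimes>\<^bsub>R\<^esub> a \<in> trace_ideal R M \<and> a \<otimes>\<^bsub>R\<^esub> h \<in> trace_ideal R M"
    if "h \<in> trace_ideal R M" "a \<in> carrier R" for h a
    using that unfolding tr
  proof (induction h rule: generate.induct)
    case one
    then show ?case using generate.one[of "add_monoid R" G] by simp
  next
    case (incl h)
    then show ?case using Gl Gr Gc by (auto intro: generate.incl)
  next
    case (inv h)
    then have "h \<in> carrier R" "h \<otimes>\<^bsub>R\<^esub> a \<in> G" "a \<otimes>\<^bsub>R\<^esub> h \<in> G" using Gl Gr Gc by auto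
    then show ?case
      using inv.prems generate.inv[of "h \<otimes>\<^bsub>R\<^esub> a" G "add_monoid R"] generate.inv[of "a \<otimes>\<^bsub>R\<^esub> h" G "add_monoid R"]
      by (simp add: a_inv_def[symmetric] M.R.l_minus M.R.r_minus)
  next
    case (eng h1 h2)
    then show ?case
      using generate.eng[of "h1 \<otimes>\<^bsub>R\<^esub> a" "add_monoid R" G "h2 \<otimes>\<^bsub>R\<^esub> a"]
        generate.eng[of "a \<otimes>\<^bsub>R\<^esub> h1" "add_monoid R" G "a \<otimes>\<^bsub>R\<^esub> h2"]
      by (simp add: M.R.l_distr M.R.r_distr)
  qed
  with sub show ?thesis
    by (intro idealI M.R.ring_axioms) blast+
qed

end

theory Submission
  imports Defs
begin

text \<open>
  Everything rests on one consequence of T-nilpotence. Let \<open>T\<close> be a submodule of \<open>M\<close> and \<open>\<phi>\<close> an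
  endomorphism that maps \<open>M\<close> into \<open>T + MN\<close> and no element outside \<open>T\<close> into \<open>T\<close>. Then \<open>T = M\<close>
  (\<open>T_nilpotent_exhausts\<close>): an element outside \<open>T\<close> would produce, by applying \<open>\<phi>\<close> again and again
  and each time selecting one summand of an element of \<open>MN\<close>, a sequence in \<open>N\<close> none of whose
  products vanishes. The identity map gives Nakayama's lemma for arbitrary modules: a submodule
  \<open>H\<close> with \<open>H + MN = M\<close> is \<open>M\<close>.

  Nakayama's lemma settles all the comparisons with the reduction. A homomorphism that is surjective
  modulo \<open>N\<close> is surjective. If \<open>f: P \<rightarrow> P'\<close> is bijective modulo \<open>N\<close> and \<open>P'\<close> is projective, then \<open>f\<close>
  is surjective and has a section \<open>g\<close>; modulo \<open>N\<close> this \<open>g\<close> is the inverse of \<open>f\<close>, so \<open>g\<close> is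
  surjective as well, and \<open>f\<close> is an isomorphism. An isomorphism between the reductions of two
  projective modules lifts to a homomorphism, which is then an isomorphism. A subset generates
  \<open>P\<close> as soon as its image generates \<open>P/PN\<close>.

  To lift a projective \<open>R/N\<close>-module \<open>X\<close>, write it as the image of an idempotent of a free module
  over \<open>R/N\<close> and lift that idempotent to an endomorphism \<open>e\<close> of the free \<open>R\<close>-module \<open>F\<close> on the same
  basis. Then \<open>e (1 - e)\<close> maps \<open>F\<close> into \<open>FN\<close>. The elements killed by a power of \<open>1 - e\<close> and those
  killed by a power of \<open>e\<close> form submodules \<open>A\<close> and \<open>B\<close> with \<open>A \<inter> B = 0\<close>, and \<open>A + B = F\<close> by the
  exhaustion lemma applied to \<open>e (1 - e)\<close> (\<open>fitting_decomposition\<close>). So \<open>e\<close> itself need not be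
  corrected to an idempotent: \<open>A\<close> is already the summand that lifts \<open>X\<close>.

  For the trace ideal \<open>J\<close> of a projective module \<open>P\<close>, a dual basis shows \<open>P = PJ\<close>, hence \<open>J = JJ\<close>,
  and lifting of homomorphisms shows that the trace of \<open>P/PN\<close> is \<open>(J + N)/N\<close>. It remains to see
  that idempotent ideals \<open>I\<close> and \<open>J\<close> with \<open>I + N = J + N\<close> coincide
  (\<open>idempotent_ideal_subset\<close>): since \<open>J = JJ\<close> is contained in \<open>J (I + N)\<close> and so in
  \<open>(I \<inter> J) + JN\<close>, Nakayama's lemma for the right module \<open>J\<close> gives \<open>I \<inter> J = J\<close>, and by symmetry
  \<open>I \<inter> J = I\<close>.
\<close>

section \<open>Submodules\<close>

context right_module
begin

lemma rsmult_minus_one: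
  assumes "x \<in> carrier M" shows "x \<star>\<^bsub>M\<^esub> (\<ominus>\<^bsub>R\<^esub> \<one>\<^bsub>R\<^esub>) = \<ominus>\<^bsub>M\<^esub> x"
proof -
  have "x \<star>\<^bsub>M\<^esub> (\<ominus>\<^bsub>R\<^esub> \<one>\<^bsub>R\<^esub>) \<oplus>\<^bsub>M\<^esub> x = \<zero>\<^bsub>M\<^esub>"
    using rsmult_add_right[of x "\<ominus>\<^bsub>R\<^esub> \<one>\<^bsub>R\<^esub>" "\<one>\<^bsub>R\<^esub>"] assms by (simp add: R.l_neg)
  then show ?thesis using assms by (intro M.minus_equality[symmetric]) auto
qed

text \<open>
  Closure under negatives comes for free, as \<open>- x = x (- 1)\<close>.
\<close>

lemma right_submoduleI:
  assumes "H \<subseteq> carrier M" "\<zero>\<^bsub>M\<^esub> \<in> H"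
    and "\<And>x y. \<lbrakk>x \<in> H; y \<in> H\<rbrakk> \<Longrightarrow> x \<oplus>\<^bsub>M\<^esub> y \<in> H"
    and rs: "\<And>x a. \<lbrakk>x \<in> H; a \<in> carrier R\<rbrakk> \<Longrightarrow> x \<star>\<^bsub>M\<^esub> a \<in> H"
  shows "right_submodule R M H"
  unfolding right_submodule_def
proof
  have "\<ominus>\<^bsub>M\<^esub> x \<in> H" if "x \<in> H" for x
    using rs[OF that, of "\<ominus>\<^bsub>R\<^esub> \<one>\<^bsub>R\<^esub>"] rsmult_minus_one[of x] that assms(1) by auto
  then show "additive_subgroup H M"
    using assms by (intro additive_subgroupI M.add.subgroupI) (auto simp: a_inv_def)
qed (use rs in blast)

context
  fixes H assumes H: "right_submodule R M H"
begin

interpretation H: additive_subgroup H M using H by (simp add: right_submodule_def)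

lemma right_submodule_subset: "H \<subseteq> carrier M"
  by (rule H.a_subset)

lemma right_submodule_zero: "\<zero>\<^bsub>M\<^esub> \<in> H"
  by (rule H.zero_closed)

lemma right_submodule_add: "\<lbrakk>x \<in> H; y \<in> H\<rbrakk> \<Longrightarrow> x \<oplus>\<^bsub>M\<^esub> y \<in> H"
  by (rule H.a_closed)

lemma right_submodule_rsmult: "\<lbrakk>x \<in> H; a \<in> carrier R\<rbrakk> \<Longrightarrow> x \<star>\<^bsub>M\<^esub> a \<in> H"
  using H by (simp add: right_submodule_def)

lemma right_submodule_diff: "\<lbrakk>x \<in> H; y \<in> H\<rbrakk> \<Longrightarrow> x \<ominus>\<^bsub>M\<^esub> y \<in> H"
  using H.a_inv_closed M.abelian_group_axioms by (simp add: M.minus_eq)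

lemma right_submodule_absorbs:
  assumes "x \<in> H" "y \<in> carrier M" "y \<ominus>\<^bsub>M\<^esub> x \<in> H" shows "y \<in> H"
proof -
  have "y = (y \<ominus>\<^bsub>M\<^esub> x) \<oplus>\<^bsub>M\<^esub> x"
    using assms H.a_subset by (auto simp: M.minus_eq M.a_assoc M.l_neg)
  then show ?thesis using right_submodule_add assms by metis
qed

end

lemma right_submodule_carrier: "right_submodule R M (carrier M)"
  by (rule right_submoduleI) auto

lemma right_span_eq_carrier_iff:
  assumes "S \<subseteq> carrier M"
  shows "right_span R M S = carrier M \<longleftrightarrow> (\<forall>H. right_submodule R M H \<and> S \<subseteq> H \<longrightarrow> H = carrier M)"
proof
  assume "right_span R M S = carrier M"
  then show "\<forall>H. right_submodule R M H \<and> S \<subseteq> H \<longrightarrow> H = carrier M"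
    using right_submodule_subset unfolding right_span_def by blast
next
  assume "\<forall>H. right_submodule R M H \<and> S \<subseteq> H \<longrightarrow> H = carrier M"
  then have "{H. right_submodule R M H \<and> S \<subseteq> H} = {carrier M}"
    using right_submodule_carrier assms by blast
  then show "right_span R M S = carrier M" by (simp add: right_span_def)
qed

lemma right_module_ideal_prod_least:
  assumes "right_submodule R M H"
    and "\<And>x a. \<lbrakk>x \<in> carrier M; a \<in> N\<rbrakk> \<Longrightarrow> x \<star>\<^bsub>M\<^esub> a \<in> H"
  shows "right_module_ideal_prod M N \<subseteq> H"
  unfolding right_module_ideal_prod_def
proof (rule M.add.generate_subgroup_incl)
  show "subgroup H (add_monoid M)"
    using assms(1) by (simp add: right_submodule_def additive_subgroup_def)
qed (use assms(2) in blast)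

lemma rsmult_in_ideal_prod:
  "\<lbrakk>x \<in> carrier M; a \<in> N\<rbrakk> \<Longrightarrow> x \<star>\<^bsub>M\<^esub> a \<in> right_module_ideal_prod M N"
  unfolding right_module_ideal_prod_def by (blast intro: generate.incl)

lemma diff_eq_zero_iff:
  assumes "x \<in> carrier M" "y \<in> carrier M"
  shows "x \<ominus>\<^bsub>M\<^esub> y = \<zero>\<^bsub>M\<^esub> \<longleftrightarrow> x = y"
  using assms by (simp add: M.minus_eq) (metis M.add.inv_closed M.r_neg M.minus_equality M.minus_minus)

lemma add_diff_cancel_left:
  assumes "x \<in> carrier M" "y \<in> carrier M" shows "(x \<oplus>\<^bsub>M\<^esub> y) \<ominus>\<^bsub>M\<^esub> x = y"
  using assms by (simp add: M.minus_eq M.a_comm[of x y] M.a_assoc M.r_neg)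

lemma diff_zero:
  assumes "x \<in> carrier M" shows "x \<ominus>\<^bsub>M\<^esub> \<zero>\<^bsub>M\<^esub> = x"
proof -
  have "\<ominus>\<^bsub>M\<^esub> \<zero>\<^bsub>M\<^esub> = \<zero>\<^bsub>M\<^esub>" by (rule M.minus_equality) auto
  then show ?thesis using assms by (simp add: M.minus_eq)
qed

end

lemma right_hom_diff:
  assumes M: "right_module R M" and M': "right_module R M'" and f: "f \<in> right_hom R M M'"
    and x: "x \<in> carrier M" and y: "y \<in> carrier M"
  shows "f (x \<ominus>\<^bsub>M\<^esub> y) = f x \<ominus>\<^bsub>M'\<^esub> f y"
proof -
  interpret M: right_module R M by fact
  interpret M': right_module R M' by fact
  show ?thesis
    using right_hom_add[OF f x, of "\<ominus>\<^bsub>M\<^esub> y"] x y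
      right_hom_a_inv[OF M.abelian_group_axioms M'.abelian_group_axioms f y]
    by (simp add: M.M.minus_eq M'.M.minus_eq)
qed

lemma right_hom_vimage_submodule:
  assumes M: "right_module R M" and M': "right_module R M'" and f: "f \<in> right_hom R M M'"
    and H: "right_submodule R M' H"
  shows "right_submodule R M {x \<in> carrier M. f x \<in> H}"
proof -
  interpret M: right_module R M by fact
  interpret M': right_module R M' by fact
  show ?thesis
    using right_hom_zero[OF M.abelian_group_axioms M'.abelian_group_axioms f]
      M'.right_submodule_zero[OF H] M'.right_submodule_add[OF H] M'.right_submodule_rsmult[OF H]
    by (intro M.right_submoduleI) (auto simp: right_hom_add[OF f] right_hom_rsmult[OF f])
qed

lemma right_hom_image_submodule:
  assumes M: "right_module R M" and M': "right_module R M'" and f: "f \<in> right_hom R M M'"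
    and H: "right_submodule R M H"
  shows "right_submodule R M' (f ` H)"
proof -
  interpret M: right_module R M by fact
  interpret M': right_module R M' by fact
  have sub: "x \<in> carrier M" if "x \<in> H" for x using M.right_submodule_subset[OF H] that by blast
  show ?thesis
  proof (rule M'.right_submoduleI)
    show "f ` H \<subseteq> carrier M'" using right_hom_closed[OF f] sub by blast
    show "\<zero>\<^bsub>M'\<^esub> \<in> f ` H"
      using right_hom_zero[OF M.abelian_group_axioms M'.abelian_group_axioms f]
        M.right_submodule_zero[OF H] by (metis image_eqI)
  next
    fix u v assume "u \<in> f ` H" "v \<in> f ` H"
    then show "u \<oplus>\<^bsub>M'\<^esub> v \<in> f ` H"
      using right_hom_add[OF f sub sub] M.right_submodule_add[OF H] by (auto simp flip: right_hom_add[OF f sub sub])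
  next
    fix u a assume "u \<in> f ` H" "a \<in> carrier R"
    then show "u \<star>\<^bsub>M'\<^esub> a \<in> f ` H"
      using M.right_submodule_rsmult[OF H] by (auto simp flip: right_hom_rsmult[OF f sub])
  qed
qed

lemma set_add_iff: "x \<in> A <+>\<^bsub>M\<^esub> B \<longleftrightarrow> (\<exists>a\<in>A. \<exists>b\<in>B. x = a \<oplus>\<^bsub>M\<^esub> b)"
  by (auto simp: set_add_def set_mult_def)

lemma direct_summand_projection:
  assumes M: "right_module R M" and ds: "direct_summands R M A B"
  shows "\<exists>p \<in> right_hom R M (M\<lparr>carrier := A\<rparr>). \<forall>x\<in>A. p x = x"
proof -
  interpret M: right_module R M by fact
  have A: "right_submodule R M A" and B: "right_submodule R M B" and int: "A \<inter> B = {\<zero>\<^bsub>M\<^esub>}"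
    and sum: "A <+>\<^bsub>M\<^esub> B = carrier M"
    using ds by (auto simp: direct_summands_def)
  have Ac: "x \<in> carrier M" if "x \<in> A" for x using M.right_submodule_subset[OF A] that by blast
  have Bc: "x \<in> carrier M" if "x \<in> B" for x using M.right_submodule_subset[OF B] that by blast
  have ex: "\<exists>u\<in>A. \<exists>v\<in>B. x = u \<oplus>\<^bsub>M\<^esub> v" if "x \<in> carrier M" for x
    using that unfolding set_add_iff[symmetric] sum .
  define p where "p x = (SOME u. u \<in> A \<and> (\<exists>v\<in>B. x = u \<oplus>\<^bsub>M\<^esub> v))" for x
  have p: "p (u \<oplus>\<^bsub>M\<^esub> v) = u" if u: "u \<in> A" and v: "v \<in> B" for u v
  proof -
    have "\<exists>u'. u' \<in> A \<and> (\<exists>v'\<in>B. u \<oplus>\<^bsub>M\<^esub> v = u' \<oplus>\<^bsub>M\<^esub> v')" using u v by blast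
    from someI_ex[OF this] obtain v' where u': "p (u \<oplus>\<^bsub>M\<^esub> v) \<in> A" and v': "v' \<in> B"
      and eq: "u \<oplus>\<^bsub>M\<^esub> v = p (u \<oplus>\<^bsub>M\<^esub> v) \<oplus>\<^bsub>M\<^esub> v'"
      unfolding p_def by blast
    have "u \<ominus>\<^bsub>M\<^esub> p (u \<oplus>\<^bsub>M\<^esub> v) = v' \<ominus>\<^bsub>M\<^esub> v"
      by (rule M.M.minus_eq_minus_if_add_eq[OF Ac[OF u] Bc[OF v] Ac[OF u'] Bc[OF v'] eq])
    then have "u \<ominus>\<^bsub>M\<^esub> p (u \<oplus>\<^bsub>M\<^esub> v) \<in> A \<inter> B"
      using M.right_submodule_diff[OF A u u'] M.right_submodule_diff[OF B v' v] by simp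
    then show ?thesis using int M.diff_eq_zero_iff[OF Ac[OF u] Ac[OF u']] by auto
  qed
  have "p \<in> right_hom R M (M\<lparr>carrier := A\<rparr>)"
  proof (rule right_homI)
    fix x assume "x \<in> carrier M"
    with ex[OF this] show "p x \<in> carrier (M\<lparr>carrier := A\<rparr>)" using p by auto
  next
    fix x y assume "x \<in> carrier M" "y \<in> carrier M"
    with ex obtain u v u' v' where uv: "u \<in> A" "v \<in> B" "x = u \<oplus>\<^bsub>M\<^esub> v" "u' \<in> A" "v' \<in> B" "y = u' \<oplus>\<^bsub>M\<^esub> v'"
      by metis
    then have "x \<oplus>\<^bsub>M\<^esub> y = (u \<oplus>\<^bsub>M\<^esub> u') \<oplus>\<^bsub>M\<^esub> (v \<oplus>\<^bsub>M\<^esub> v')"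
      using Ac Bc by (simp add: M.M.a_ac)
    then show "p (x \<oplus>\<^bsub>M\<^esub> y) = p x \<oplus>\<^bsub>M\<lparr>carrier := A\<rparr>\<^esub> p y"
      using uv p M.right_submodule_add[OF A] M.right_submodule_add[OF B] by simp
  next
    fix x a assume "x \<in> carrier M" and a: "a \<in> carrier R"
    with ex obtain u v where uv: "u \<in> A" "v \<in> B" "x = u \<oplus>\<^bsub>M\<^esub> v" by metis
    then have "x \<star>\<^bsub>M\<^esub> a = u \<star>\<^bsub>M\<^esub> a \<oplus>\<^bsub>M\<^esub> v \<star>\<^bsub>M\<^esub> a"
      using a Ac Bc by (simp add: M.rsmult_add_left)
    then show "p (x \<star>\<^bsub>M\<^esub> a) = p x \<star>\<^bsub>M\<lparr>carrier := A\<rparr>\<^esub> a"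
      using uv p M.right_submodule_rsmult[OF A] M.right_submodule_rsmult[OF B] a by simp
  qed
  moreover have "p x = x" if "x \<in> A" for x
    using p[OF that M.right_submodule_zero[OF B]] Ac[OF that] by simp
  ultimately show ?thesis by blast
qed


section \<open>Exhaustion by a submodule under T-nilpotence\<close>

text \<open>
  Suppose \<open>y p\<close> lies outside \<open>T\<close> for some ring element \<open>p\<close>. Then so does \<open>\<phi> (y p) = \<phi> y p\<close>; as
  \<open>\<phi> y\<close> is congruent modulo \<open>T\<close> to a sum of elements \<open>y' b\<close> with \<open>b\<close> in \<open>N\<close>, one of the terms
  \<open>y' (b p)\<close> is outside \<open>T\<close> too. Starting from \<open>p = 1\<close> this builds products \<open>b\<^sub>n ... b\<^sub>1\<close> that
  are never zero. Each new factor appears to the left of the old ones, which is why right modules go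
  with right T-nilpotence.

  The conclusion is for an arbitrary \<open>\<phi>\<close> because two instances are needed: the identity, for
  Nakayama's lemma, and \<open>e (1 - e)\<close> for an endomorphism \<open>e\<close> that is idempotent modulo \<open>N\<close>.
\<close>

lemma T_nilpotent_exhausts:
  assumes M: "right_module R M" and N: "ideal N R" and nil: "right_T_nilpotent R N"
    and T: "right_submodule R M T"
    and \<phi>: "\<phi> \<in> right_hom R M M"
    and reflects: "\<And>x. \<lbrakk>x \<in> carrier M; \<phi> x \<in> T\<rbrakk> \<Longrightarrow> x \<in> T"
    and mod: "\<And>x. x \<in> carrier M \<Longrightarrow> \<exists>t\<in>T. \<phi> x \<ominus>\<^bsub>M\<^esub> t \<in> right_module_ideal_prod M N"
  shows "T = carrier M"
proof (rule ccontr)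
  interpret M: right_module R M by (rule M)
  interpret N: ideal N R by (rule N)
  assume "T \<noteq> carrier M"
  then obtain x0 where x0: "x0 \<in> carrier M" "x0 \<notin> T" using M.right_submodule_subset[OF T] by blast
  have step: "\<exists>y'\<in>carrier M. \<exists>b\<in>N. y' \<star>\<^bsub>M\<^esub> (b \<otimes>\<^bsub>R\<^esub> p) \<notin> T"
    if y: "y \<in> carrier M" and p: "p \<in> carrier R" and yp: "y \<star>\<^bsub>M\<^esub> p \<notin> T" for y p
  proof (rule ccontr)
    assume "\<not> ?thesis"
    then have all: "y' \<star>\<^bsub>M\<^esub> (b \<otimes>\<^bsub>R\<^esub> p) \<in> T" if "y' \<in> carrier M" "b \<in> N" for y' b using that by blast
    \<comment> \<open>The elements \<open>x\<close> with \<open>x p\<close> in \<open>T\<close> form an additive subgroup but not a submodule, so the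
      induction runs over the additive generation of \<open>MN\<close>.\<close>
    have "x \<star>\<^bsub>M\<^esub> p \<in> T" if "x \<in> right_module_ideal_prod M N" for x
      using that unfolding right_module_ideal_prod_def
    proof (induction rule: generate.induct)
      case one then show ?case using M.right_submodule_zero[OF T] p by simp
    next
      case (incl h) then show ?case using all p N.a_Hcarr M.rsmult_assoc by fastforce
    next
      case (inv h)
      then obtain z b where zb: "z \<in> carrier M" "b \<in> N" "h = z \<star>\<^bsub>M\<^esub> b" by blast
      then have "h \<in> carrier M" "h \<star>\<^bsub>M\<^esub> p \<in> T" using all[OF zb(1,2)] p N.a_Hcarr M.rsmult_assoc by auto
      then show ?case
        using M.right_submodule_diff[OF T M.right_submodule_zero[OF T], of "h \<star>\<^bsub>M\<^esub> p"] p
        by (simp add: M.rsmult_minus_left M.M.minus_eq flip: a_inv_def)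
    next
      case (eng h1 h2)
      have "{x \<star>\<^bsub>M\<^esub> a | x a. x \<in> carrier M \<and> a \<in> N} \<subseteq> carrier M" using N.a_Hcarr by auto
      then have "h1 \<in> carrier M" "h2 \<in> carrier M"
        using eng.hyps M.add.generate_in_carrier by auto
      then show ?case using eng.IH M.right_submodule_add[OF T] p by (simp add: M.rsmult_add_left)
    qed
    moreover obtain t where t: "t \<in> T" "\<phi> y \<ominus>\<^bsub>M\<^esub> t \<in> right_module_ideal_prod M N" using mod[OF y] by blast
    ultimately have "(\<phi> y \<ominus>\<^bsub>M\<^esub> t) \<star>\<^bsub>M\<^esub> p \<in> T" by blast
    moreover have "t \<in> carrier M" using t M.right_submodule_subset[OF T] by blast
    moreover have fy: "\<phi> y \<in> carrier M" using right_hom_closed[OF \<phi> y] .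
    ultimately have "\<phi> y \<star>\<^bsub>M\<^esub> p \<ominus>\<^bsub>M\<^esub> t \<star>\<^bsub>M\<^esub> p \<in> T"
      using p by (simp add: M.M.minus_eq M.rsmult_add_left M.rsmult_minus_left)
    then have "\<phi> y \<star>\<^bsub>M\<^esub> p \<in> T"
      using M.right_submodule_absorbs[OF T M.right_submodule_rsmult[OF T t(1) p]] fy p by simp
    then have "\<phi> (y \<star>\<^bsub>M\<^esub> p) \<in> T" using right_hom_rsmult[OF \<phi> y p] by simp
    then show False using reflects[of "y \<star>\<^bsub>M\<^esub> p"] y p yp by simp
  qed
  \<comment> \<open>A state \<open>(y, p, b)\<close> records the product \<open>p\<close> of the factors found so far and the last of them,
    \<open>b\<close>; the initial state has no factor yet, whence the arbitrary third component.\<close>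
  define good where "good n s = (case s of (y, p, b) \<Rightarrow> y \<in> carrier M \<and> p \<in> carrier R \<and> y \<star>\<^bsub>M\<^esub> p \<notin> T
    \<and> (n = 0 \<longrightarrow> p = \<one>\<^bsub>R\<^esub>))" for n :: nat and s :: "'c \<times> 'a \<times> 'a"
  define succ where "succ s s' = (case (s, s') of ((y, p, b), (y', p', b')) \<Rightarrow> b' \<in> N \<and> p' = b' \<otimes>\<^bsub>R\<^esub> p)"
    for s s' :: "'c \<times> 'a \<times> 'a"
  obtain s where s: "\<And>n. good n (s n)" "\<And>n. succ (s n) (s (Suc n))"
  proof (rule dependent_nat_choice[of good "\<lambda>n. succ", THEN exE])
    show "\<exists>s. good 0 s" using x0 by (intro exI[of _ "(x0, \<one>\<^bsub>R\<^esub>, undefined)"]) (simp add: good_def)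
  next
    fix s n assume "good n s"
    then obtain y p b where "s = (y, p, b)" "y \<in> carrier M" "p \<in> carrier R" "y \<star>\<^bsub>M\<^esub> p \<notin> T"
      by (auto simp: good_def split: prod.splits)
    with step[of y p] obtain y' b' where "y' \<in> carrier M" "b' \<in> N" "y' \<star>\<^bsub>M\<^esub> (b' \<otimes>\<^bsub>R\<^esub> p) \<notin> T" by blast
    then show "\<exists>s'. good (Suc n) s' \<and> succ s s'"
      using \<open>s = _\<close> \<open>p \<in> carrier R\<close> N.a_Hcarr
      by (intro exI[of _ "(y', b' \<otimes>\<^bsub>R\<^esub> p, b')"]) (simp add: good_def succ_def)
  qed blast
  define a where "a n = snd (snd (s n))" for n
  have a: "a (Suc n) \<in> N" "fst (snd (s (Suc n))) = a (Suc n) \<otimes>\<^bsub>R\<^esub> fst (snd (s n))" for n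
    using s(2)[of n] by (auto simp: a_def succ_def split: prod.splits)
  have prod: "left_prod R a n = fst (snd (s n))" for n
    using a(2) s(1)[of 0] by (induction n) (auto simp: good_def split: prod.splits)
  have "left_prod R a n \<noteq> \<zero>\<^bsub>R\<^esub>" for n
    using s(1)[of n] M.right_submodule_zero[OF T] M.rsmult_zero_right unfolding prod
    by (metis (mono_tags, lifting) case_prod_unfold good_def)
  moreover have "a i \<in> N" if "i \<ge> 1" for i using a(1)[of "i - 1"] that by simp
  ultimately show False using nil unfolding right_T_nilpotent_def by blast
qed

lemma nakayama:
  assumes M: "right_module R M" and N: "ideal N R" and nil: "right_T_nilpotent R N"
    and H: "right_submodule R M H"
    and mod: "\<And>x. x \<in> carrier M \<Longrightarrow> \<exists>h\<in>H. x \<ominus>\<^bsub>M\<^esub> h \<in> right_module_ideal_prod M N"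
  shows "H = carrier M"
  by (rule T_nilpotent_exhausts[OF M N nil H, of "\<lambda>x. x"]) (auto intro: right_homI mod)


section \<open>Modules over the quotient ring\<close>

text \<open>
  Restriction of scalars along \<open>R \<rightarrow> R/N\<close>. It turns homomorphisms from an \<open>R\<close>-module to an
  \<open>R/N\<close>-module into homomorphisms over \<open>R\<close>, to which the lifting property of projective
  \<open>R\<close>-modules applies.
\<close>

definition inflation ::
  "('a, 'r) ring_scheme \<Rightarrow> 'a set \<Rightarrow> ('a set, 'x, 'm) right_module_scheme \<Rightarrow> ('a, 'x) right_module" where
  "inflation R N X =
     \<lparr>carrier = carrier X, mult = undefined, one = undefined,
      zero = \<zero>\<^bsub>X\<^esub>, add = (\<oplus>\<^bsub>X\<^esub>), rsmult = (\<lambda>x a. x \<star>\<^bsub>X\<^esub> (N +>\<^bsub>R\<^esub> a))\<rparr>"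

lemma inflation_simps [simp]:
  "carrier (inflation R N X) = carrier X" "\<zero>\<^bsub>inflation R N X\<^esub> = \<zero>\<^bsub>X\<^esub>"
  "x \<oplus>\<^bsub>inflation R N X\<^esub> y = x \<oplus>\<^bsub>X\<^esub> y" "x \<star>\<^bsub>inflation R N X\<^esub> a = x \<star>\<^bsub>X\<^esub> (N +>\<^bsub>R\<^esub> a)"
  by (simp_all add: inflation_def)

context ideal
begin

lemma FactRing_carrier_iff: "A \<in> carrier (R Quot I) \<longleftrightarrow> (\<exists>a\<in>carrier R. A = I +> a)"
  by (auto simp: FactRing_simps)

lemma FactRing_coset_closed: "a \<in> carrier R \<Longrightarrow> I +> a \<in> carrier (R Quot I)"
  by (auto simp: FactRing_carrier_iff)

lemma FactRing_coset_zero: "I +> \<zero> = \<zero>\<^bsub>R Quot I\<^esub>"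
  using a_coset_add_zero[OF a_subset] by (simp add: FactRing_def)

lemma FactRing_coset_one: "I +> \<one> = \<one>\<^bsub>R Quot I\<^esub>"
  by (simp add: FactRing_def)

lemma FactRing_coset_add:
  "\<lbrakk>a \<in> carrier R; b \<in> carrier R\<rbrakk> \<Longrightarrow> I +> (a \<oplus> b) = (I +> a) \<oplus>\<^bsub>R Quot I\<^esub> (I +> b)"
  using a_rcos_sum by (simp add: FactRing_def)

lemma FactRing_coset_mult:
  "\<lbrakk>a \<in> carrier R; b \<in> carrier R\<rbrakk> \<Longrightarrow> I +> (a \<otimes> b) = (I +> a) \<otimes>\<^bsub>R Quot I\<^esub> (I +> b)"
  using rcoset_mult_add by (simp add: FactRing_def)

lemma inflation_is_right_module:
  assumes "right_module (R Quot I) X" shows "right_module R (inflation R I X)"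
proof -
  interpret X: right_module "R Quot I" X by fact
  have "abelian_group (inflation R I X)"
  proof (rule abelian_groupI)
    fix x assume "x \<in> carrier (inflation R I X)"
    then show "\<exists>y\<in>carrier (inflation R I X). y \<oplus>\<^bsub>inflation R I X\<^esub> x = \<zero>\<^bsub>inflation R I X\<^esub>"
      by (intro bexI[of _ "\<ominus>\<^bsub>X\<^esub> x"]) (auto simp: X.M.l_neg)
  qed (auto simp: X.M.a_ac)
  then show ?thesis
    by (intro right_module.intro right_module_axioms.intro ring_axioms)
      (auto simp: FactRing_coset_closed FactRing_coset_add FactRing_coset_mult FactRing_coset_one
        X.rsmult_add_left X.rsmult_add_right X.rsmult_assoc)
qed

lemma right_hom_inflation:
  "right_hom R (inflation R I X) (inflation R I Y) = right_hom (R Quot I) X Y"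
  by (auto simp: right_hom_def hom_def FactRing_carrier_iff) (blast intro: FactRing_coset_closed)

lemma right_submodule_inflation:
  assumes "right_module (R Quot I) X"
  shows "right_submodule R (inflation R I X) H \<longleftrightarrow> right_submodule (R Quot I) X H"
proof -
  interpret X: right_module "R Quot I" X by fact
  interpret Y: right_module R "inflation R I X" by (rule inflation_is_right_module[OF assms])
  show ?thesis
  proof
    assume H: "right_submodule R (inflation R I X) H"
    show "right_submodule (R Quot I) X H"
      using Y.right_submodule_subset[OF H] Y.right_submodule_zero[OF H]
        Y.right_submodule_add[OF H] Y.right_submodule_rsmult[OF H]
      by (intro X.right_submoduleI) (auto simp: FactRing_carrier_iff)
  next
    assume H: "right_submodule (R Quot I) X H"
    show "right_submodule R (inflation R I X) H"
      using X.right_submodule_subset[OF H] X.right_submodule_zero[OF H]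
        X.right_submodule_add[OF H] X.right_submodule_rsmult[OF H]
      by (intro Y.right_submoduleI) (auto simp: FactRing_coset_closed)
  qed
qed

lemma right_span_inflation:
  assumes "right_module (R Quot I) X"
  shows "right_span R (inflation R I X) S = right_span (R Quot I) X S"
  unfolding right_span_def right_submodule_inflation[OF assms] ..

end

text \<open>
  The map \<open>\<pi>\<close> exhibits \<open>X\<close> as the quotient \<open>P/PN\<close>. Working with such a map in place of an isomorphism
  from the module of cosets avoids most computations with cosets; the two notions agree by
  \<open>right_isomorphic_reduction_iff\<close>.
\<close>

definition is_reduction ::
  "('a, 'r) ring_scheme \<Rightarrow> 'a set \<Rightarrow> ('a, 'b, 'm) right_module_scheme
    \<Rightarrow> ('a set, 'x, 'n) right_module_scheme \<Rightarrow> ('b \<Rightarrow> 'x) \<Rightarrow> bool" where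
  "is_reduction R N P X \<pi> \<longleftrightarrow>
     \<pi> \<in> right_hom R P (inflation R N X) \<and> \<pi> ` carrier P = carrier X \<and>
     (\<forall>x\<in>carrier P. \<pi> x = \<zero>\<^bsub>X\<^esub> \<longleftrightarrow> x \<in> right_module_ideal_prod P N)"

lemma is_reduction_eq_iff:
  assumes P: "right_module R P" and N: "ideal N R" and X: "right_module (R Quot N) X"
    and \<pi>: "is_reduction R N P X \<pi>" and x: "x \<in> carrier P" and y: "y \<in> carrier P"
  shows "\<pi> x = \<pi> y \<longleftrightarrow> x \<ominus>\<^bsub>P\<^esub> y \<in> right_module_ideal_prod P N"
proof -
  interpret P: right_module R P by (rule P)
  interpret N: ideal N R by (rule N)
  interpret X: right_module R "inflation R N X" by (rule N.inflation_is_right_module[OF X])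
  have \<pi>h: "\<pi> \<in> right_hom R P (inflation R N X)" using \<pi> by (simp add: is_reduction_def)
  have "\<pi> x = \<pi> y \<longleftrightarrow> \<pi> (x \<ominus>\<^bsub>P\<^esub> y) = \<zero>\<^bsub>inflation R N X\<^esub>"
    using X.diff_eq_zero_iff[of "\<pi> x" "\<pi> y"] right_hom_closed[OF \<pi>h x] right_hom_closed[OF \<pi>h y]
      right_hom_diff[OF P X.right_module_axioms \<pi>h x y] by simp
  then show ?thesis using \<pi> x y by (simp add: is_reduction_def)
qed

lemma reduction_carrier_iff:
  "C \<in> carrier (reduction P N) \<longleftrightarrow> (\<exists>x\<in>carrier P. C = right_module_ideal_prod P N +>\<^bsub>P\<^esub> x)"
  by (auto simp: reduction_def right_module_quot_def A_RCOSETS_defs a_r_coset_def r_coset_def)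

lemma is_reduction_reduction:
  assumes P: "right_module R P" and N: "ideal N R"
  shows "is_reduction R N P (reduction P N) (\<lambda>x. right_module_ideal_prod P N +>\<^bsub>P\<^esub> x)"
proof -
  interpret P: right_module R P by (rule P)
  let ?H = "right_module_ideal_prod P N"
  interpret H: abelian_subgroup ?H P
    using right_module_ideal_prod_submodule[OF P N] P.abelian_group_axioms
    by (intro abelian_subgroupI3) (auto simp: right_submodule_def)
  have "(\<lambda>x. ?H +>\<^bsub>P\<^esub> x) \<in> right_hom R P (inflation R N (reduction P N))"
    using H.a_rcos_sum by (intro right_homI)
      (auto simp: reduction_carrier_iff reduction_rsmult[OF P N], auto simp: reduction_def right_module_quot_def)
  moreover have "?H +>\<^bsub>P\<^esub> x = ?H \<longleftrightarrow> x \<in> ?H" if "x \<in> carrier P" for x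
    using H.a_rcos_self[OF that] H.a_rcos_const by blast
  moreover have "\<zero>\<^bsub>reduction P N\<^esub> = ?H" by (simp add: reduction_def right_module_quot_def)
  ultimately show ?thesis by (auto simp only: is_reduction_def reduction_carrier_iff)
qed

lemma is_reduction_iso:
  assumes N: "ideal N R" and X: "right_module (R Quot N) X" and Y: "right_module (R Quot N) Y"
    and \<pi>: "is_reduction R N P X \<pi>" and \<sigma>: "\<sigma> \<in> right_iso (R Quot N) X Y"
  shows "is_reduction R N P Y (\<sigma> \<circ> \<pi>)"
proof -
  interpret N: ideal N R by (rule N)
  have \<sigma>h: "\<sigma> \<in> right_hom (R Quot N) X Y" and bij: "bij_betw \<sigma> (carrier X) (carrier Y)"
    using \<sigma> by (auto simp: right_iso_def)
  have \<pi>h: "\<pi> \<in> right_hom R P (inflation R N X)" and img: "\<pi> ` carrier P = carrier X"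
    using \<pi> by (auto simp: is_reduction_def)
  have "\<sigma> \<circ> \<pi> \<in> right_hom R P (inflation R N Y)"
    using \<sigma>h by (intro right_hom_comp[OF \<pi>h]) (simp add: N.right_hom_inflation)
  moreover have "(\<sigma> \<circ> \<pi>) ` carrier P = carrier Y"
    using bij img by (simp only: bij_betw_def image_comp[symmetric])
  moreover have "\<sigma> (\<pi> x) = \<zero>\<^bsub>Y\<^esub> \<longleftrightarrow> \<pi> x = \<zero>\<^bsub>X\<^esub>" if "x \<in> carrier P" for x
  proof -
    have "\<sigma> \<zero>\<^bsub>X\<^esub> = \<zero>\<^bsub>Y\<^esub>"
      by (rule right_hom_zero[OF right_module_abelian_group[OF X] right_module_abelian_group[OF Y] \<sigma>h])
    moreover have "\<pi> x \<in> carrier X" "\<zero>\<^bsub>X\<^esub> \<in> carrier X"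
      using img that abelian_groupE(2)[OF right_module_abelian_group[OF X]] by auto
    ultimately show ?thesis
      using inj_on_eq_iff[of \<sigma> "carrier X" "\<pi> x" "\<zero>\<^bsub>X\<^esub>"] bij by (simp add: bij_betw_def)
  qed
  ultimately show ?thesis using \<pi> by (simp add: is_reduction_def)
qed

lemma inflation_hom_ideal_prod:
  assumes P: "right_module R P" and N: "ideal N R" and X: "right_module (R Quot N) X"
    and g: "g \<in> right_hom R P (inflation R N X)" and x: "x \<in> right_module_ideal_prod P N"
  shows "g x = \<zero>\<^bsub>X\<^esub>"
proof -
  interpret P: right_module R P by (rule P)
  interpret N: ideal N R by (rule N)
  have IX: "right_module R (inflation R N X)" by (rule N.inflation_is_right_module[OF X])
  interpret IX: right_module R "inflation R N X" by (rule IX)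
  have "right_submodule R (inflation R N X) {\<zero>\<^bsub>X\<^esub>}"
    using IX.M.zero_closed IX.M.l_zero IX.rsmult_zero_left by (intro IX.right_submoduleI) auto
  then have H: "right_submodule R P {y \<in> carrier P. g y \<in> {\<zero>\<^bsub>X\<^esub>}}"
    by (rule right_hom_vimage_submodule[OF P IX g])
  have "right_module_ideal_prod P N \<subseteq> {y \<in> carrier P. g y \<in> {\<zero>\<^bsub>X\<^esub>}}"
  proof (rule P.right_module_ideal_prod_least[OF H])
    fix y a assume y: "y \<in> carrier P" and a: "a \<in> N"
    have "N +>\<^bsub>R\<^esub> a = N +>\<^bsub>R\<^esub> \<zero>\<^bsub>R\<^esub>"
      using N.a_rcos_const[OF a] N.a_rcos_const[OF additive_subgroup.zero_closed[OF N.is_additive_subgroup]] by simp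
    then have "g (y \<star>\<^bsub>P\<^esub> a) = g y \<star>\<^bsub>inflation R N X\<^esub> \<zero>\<^bsub>R\<^esub>"
      using right_hom_rsmult[OF g y N.a_Hcarr[OF a]] by simp
    also have "\<dots> = \<zero>\<^bsub>X\<^esub>" using IX.rsmult_zero_right[OF right_hom_closed[OF g y]] by simp
    finally show "y \<star>\<^bsub>P\<^esub> a \<in> {y \<in> carrier P. g y \<in> {\<zero>\<^bsub>X\<^esub>}}" using y a N.a_Hcarr by simp
  qed
  then show ?thesis using x by blast
qed

text \<open>
  Every homomorphism from \<open>P\<close> to an \<open>R/N\<close>-module kills \<open>PN\<close>, so it factors through \<open>\<pi>\<close>.
\<close>

lemma reduction_universal:
  assumes P: "right_module R P" and N: "ideal N R"
    and X: "right_module (R Quot N) X" and Y: "right_module (R Quot N) Y"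
    and \<pi>: "is_reduction R N P X \<pi>" and g: "g \<in> right_hom R P (inflation R N Y)"
  shows "\<exists>h\<in>right_hom (R Quot N) X Y. \<forall>x\<in>carrier P. h (\<pi> x) = g x"
proof -
  interpret P: right_module R P by (rule P)
  interpret N: ideal N R by (rule N)
  have IY: "right_module R (inflation R N Y)" by (rule N.inflation_is_right_module[OF Y])
  interpret IY: right_module R "inflation R N Y" by (rule IY)
  have \<pi>h: "\<pi> \<in> right_hom R P (inflation R N X)" and \<pi>i: "carrier X = \<pi> ` carrier P"
    using \<pi> by (auto simp: is_reduction_def)
  have eq: "g x = g y" if xy: "x \<in> carrier P" "y \<in> carrier P" and "\<pi> x = \<pi> y" for x y
  proof -
    have "x \<ominus>\<^bsub>P\<^esub> y \<in> right_module_ideal_prod P N" using is_reduction_eq_iff[OF P N X \<pi> xy] that(3) by simp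
    then have "g x \<ominus>\<^bsub>inflation R N Y\<^esub> g y = \<zero>\<^bsub>inflation R N Y\<^esub>"
      using inflation_hom_ideal_prod[OF P N Y g] right_hom_diff[OF P IY g xy] by simp
    then show ?thesis using IY.diff_eq_zero_iff right_hom_closed[OF g] xy by blast
  qed
  define h where "h C = g (inv_into (carrier P) \<pi> C)" for C
  have h: "h (\<pi> x) = g x" if "x \<in> carrier P" for x
    unfolding h_def using that by (intro eq) (auto intro: inv_into_into f_inv_into_f)
  have "h \<in> right_hom R (inflation R N X) (inflation R N Y)"
  proof (rule right_homI)
    fix C assume "C \<in> carrier (inflation R N X)"
    then show "h C \<in> carrier (inflation R N Y)" using h right_hom_closed[OF g] \<pi>i by auto
  next
    fix C D assume "C \<in> carrier (inflation R N X)" "D \<in> carrier (inflation R N X)"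
    then obtain x y where "x \<in> carrier P" "y \<in> carrier P" "C = \<pi> x" "D = \<pi> y" using \<pi>i by auto
    then show "h (C \<oplus>\<^bsub>inflation R N X\<^esub> D) = h C \<oplus>\<^bsub>inflation R N Y\<^esub> h D"
      using right_hom_add[OF \<pi>h, of x y] right_hom_add[OF g, of x y] h by (metis P.M.a_closed)
  next
    fix C a assume "C \<in> carrier (inflation R N X)" "a \<in> carrier R"
    then obtain x where "x \<in> carrier P" "C = \<pi> x" using \<pi>i by auto
    then show "h (C \<star>\<^bsub>inflation R N X\<^esub> a) = h C \<star>\<^bsub>inflation R N Y\<^esub> a"
      using right_hom_rsmult[OF \<pi>h, of x a] right_hom_rsmult[OF g, of x a] h \<open>a \<in> carrier R\<close>
      by (metis P.rsmult_closed)
  qed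
  then show ?thesis using h by (auto simp: N.right_hom_inflation)
qed

lemma right_iso_of_reductions:
  assumes P: "right_module R P" and N: "ideal N R"
    and X: "right_module (R Quot N) X" and Y: "right_module (R Quot N) Y"
    and \<pi>: "is_reduction R N P X \<pi>" and \<rho>: "is_reduction R N P Y \<rho>"
  shows "\<exists>\<sigma>\<in>right_iso (R Quot N) X Y. \<forall>x\<in>carrier P. \<sigma> (\<pi> x) = \<rho> x"
proof -
  have \<pi>i: "carrier X = \<pi> ` carrier P" and \<rho>i: "carrier Y = \<rho> ` carrier P"
    and \<rho>h: "\<rho> \<in> right_hom R P (inflation R N Y)"
    using \<pi> \<rho> by (auto simp: is_reduction_def)
  have eq: "\<pi> x = \<pi> y \<longleftrightarrow> \<rho> x = \<rho> y" if "x \<in> carrier P" "y \<in> carrier P" for x y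
    using is_reduction_eq_iff[OF P N X \<pi> that] is_reduction_eq_iff[OF P N Y \<rho> that] by simp
  obtain \<sigma> where \<sigma>h: "\<sigma> \<in> right_hom (R Quot N) X Y"
    and \<sigma>: "\<And>x. x \<in> carrier P \<Longrightarrow> \<sigma> (\<pi> x) = \<rho> x"
    using reduction_universal[OF P N X Y \<pi> \<rho>h] by blast
  have "inj_on \<sigma> (carrier X)"
    unfolding \<pi>i using eq \<sigma> by (auto simp: inj_on_def)
  moreover have "\<sigma> ` carrier X = carrier Y"
    unfolding \<pi>i \<rho>i by (simp add: image_image \<sigma>)
  ultimately show ?thesis
    using \<sigma>h \<sigma> by (auto simp: right_iso_def bij_betw_def)
qed

lemma right_isomorphic_reduction_iff:
  assumes P: "right_module R P" and N: "ideal N R" and X: "right_module (R Quot N) X"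
  shows "right_isomorphic (R Quot N) (reduction P N) X \<longleftrightarrow> (\<exists>\<pi>. is_reduction R N P X \<pi>)"
  using is_reduction_iso[OF N reduction_is_right_module[OF P N] X is_reduction_reduction[OF P N]]
    right_iso_of_reductions[OF P N reduction_is_right_module[OF P N] X is_reduction_reduction[OF P N]]
  unfolding right_isomorphic_def by blast


section \<open>Isomorphisms and generators are detected modulo the ideal\<close>

lemma right_hom_surj_mod:
  assumes M: "right_module R M" and M': "right_module R M'"
    and N: "ideal N R" and nil: "right_T_nilpotent R N"
    and f: "f \<in> right_hom R M M'"
    and mod: "\<And>y. y \<in> carrier M' \<Longrightarrow> \<exists>x\<in>carrier M. y \<ominus>\<^bsub>M'\<^esub> f x \<in> right_module_ideal_prod M' N"
  shows "f ` carrier M = carrier M'"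
  using mod
  by (intro nakayama[OF M' N nil] right_hom_image_submodule[OF M M' f]
      right_module.right_submodule_carrier[OF M]) auto

text \<open>
  Nakayama's lemma is used twice, for \<open>f\<close> and for a section of \<open>f\<close>. The section exists because \<open>P'\<close> is
  projective, and a surjective section makes \<open>f\<close> injective.
\<close>

lemma right_iso_if_reductions:
  assumes P: "right_module R P" and P': "projective R P'"
    and N: "ideal N R" and nil: "right_T_nilpotent R N" and X: "right_module (R Quot N) X"
    and \<pi>: "is_reduction R N P X \<pi>" and \<pi>': "is_reduction R N P' X \<pi>'"
    and f: "f \<in> right_hom R P P'" and comm: "\<And>x. x \<in> carrier P \<Longrightarrow> \<pi>' (f x) = \<pi> x"
  shows "f \<in> right_iso R P P'"
proof -
  have M': "right_module R P'" using P' by (simp add: projective_def)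
  interpret P: right_module R P by (rule P)
  interpret P': right_module R P' by (rule M')
  note eq = is_reduction_eq_iff[OF P N X \<pi>] and eq' = is_reduction_eq_iff[OF M' N X \<pi>']
  have \<pi>i: "\<pi> ` carrier P = carrier X" "\<pi>' ` carrier P' = carrier X"
    using \<pi> \<pi>' by (auto simp: is_reduction_def)
  have surj: "f ` carrier P = carrier P'"
  proof (rule right_hom_surj_mod[OF P M' N nil f])
    fix y assume y: "y \<in> carrier P'"
    then obtain x where "x \<in> carrier P" "\<pi>' y = \<pi> x" using \<pi>i by blast
    then show "\<exists>x\<in>carrier P. y \<ominus>\<^bsub>P'\<^esub> f x \<in> right_module_ideal_prod P' N"
      using eq'[OF y right_hom_closed[OF f]] comm by auto
  qed
  have "(\<lambda>x. x) \<in> right_hom R P' P'" by (intro right_homI) auto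
  then obtain g where g: "g \<in> right_hom R P' P" and fg: "\<And>y. y \<in> carrier P' \<Longrightarrow> f (g y) = y"
    using projective_lifts[OF P' P M' f surj] by blast
  have gsurj: "g ` carrier P' = carrier P"
  proof (rule right_hom_surj_mod[OF M' P N nil g])
    fix x assume x: "x \<in> carrier P"
    have fx: "f x \<in> carrier P'" by (rule right_hom_closed[OF f x])
    have gfx: "g (f x) \<in> carrier P" by (rule right_hom_closed[OF g fx])
    have "\<pi> x = \<pi> (g (f x))" using comm[OF x] comm[OF gfx] fg[OF fx] by simp
    then show "\<exists>y\<in>carrier P'. x \<ominus>\<^bsub>P\<^esub> g y \<in> right_module_ideal_prod P N"
      using eq[OF x gfx] fx by blast
  qed
  have "inj_on f (carrier P)"
    unfolding gsurj[symmetric] by (intro inj_onI) (metis fg image_iff)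
  then show ?thesis using surj f by (simp add: right_iso_def bij_betw_def)
qed

lemma right_isomorphic_if_reductions:
  assumes P: "projective R P" and P': "projective R P'"
    and N: "ideal N R" and nil: "right_T_nilpotent R N" and X: "right_module (R Quot N) X"
    and \<pi>: "is_reduction R N P X \<pi>" and \<pi>': "is_reduction R N P' X \<pi>'"
  shows "right_isomorphic R P P'"
proof -
  interpret N: ideal N R by (rule N)
  have M: "right_module R P" and M': "right_module R P'" using P P' by (simp_all add: projective_def)
  obtain f where "f \<in> right_hom R P P'" "\<And>x. x \<in> carrier P \<Longrightarrow> \<pi>' (f x) = \<pi> x"
    using projective_lifts[OF P M' N.inflation_is_right_module[OF X], of \<pi>' \<pi>] \<pi> \<pi>'
    by (auto simp: is_reduction_def)
  then show ?thesis
    using right_iso_if_reductions[OF M P' N nil X \<pi> \<pi>'] by (auto simp: right_isomorphic_def)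
qed

text \<open>
  If the induced map is an isomorphism, then \<open>P \<rightarrow> P/PN \<rightarrow> P'/P'N\<close> is a reduction of \<open>P\<close>, and it is
  compatible with \<open>f\<close> and with \<open>P' \<rightarrow> P'/P'N\<close>. Conversely an isomorphism \<open>f\<close> carries \<open>PN\<close> onto
  \<open>P'N\<close>, so \<open>P \<rightarrow> P' \<rightarrow> P'/P'N\<close> is again a reduction of \<open>P\<close>, and two reductions of \<open>P\<close> differ by an
  isomorphism.
\<close>

lemma right_iso_iff_reduction_map:
  assumes M: "right_module R P" and P': "projective R P'"
    and N: "ideal N R" and nil: "right_T_nilpotent R N" and f: "f \<in> right_hom R P P'"
  shows "f \<in> right_iso R P P' \<longleftrightarrow>
    reduction_map P' N f \<in> right_iso (R Quot N) (reduction P N) (reduction P' N)"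
    (is "_ \<longleftrightarrow> ?f \<in> right_iso _ ?X ?X'")
proof -
  have M': "right_module R P'" using P' by (simp add: projective_def)
  interpret P: right_module R P by (rule M)
  interpret P': right_module R P' by (rule M')
  interpret N: ideal N R by (rule N)
  have X: "right_module (R Quot N) ?X" and X': "right_module (R Quot N) ?X'"
    by (rule reduction_is_right_module[OF M N], rule reduction_is_right_module[OF M' N])
  let ?\<pi> = "\<lambda>x. right_module_ideal_prod P N +>\<^bsub>P\<^esub> x"
  let ?\<pi>' = "\<lambda>x. right_module_ideal_prod P' N +>\<^bsub>P'\<^esub> x"
  have \<pi>: "is_reduction R N P ?X ?\<pi>" and \<pi>': "is_reduction R N P' ?X' ?\<pi>'"
    by (rule is_reduction_reduction[OF M N], rule is_reduction_reduction[OF M' N])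
  have comm: "?f (?\<pi> x) = ?\<pi>' (f x)" if "x \<in> carrier P" for x
    by (rule reduction_map_coset[OF M M' N f that])
  show ?thesis
  proof
    assume "?f \<in> right_iso (R Quot N) ?X ?X'"
    then have "is_reduction R N P ?X' (?f \<circ> ?\<pi>)" by (rule is_reduction_iso[OF N X X' \<pi>])
    then show "f \<in> right_iso R P P'"
      by (rule right_iso_if_reductions[OF M P' N nil X' _ \<pi>' f]) (simp add: comm)
  next
    assume "f \<in> right_iso R P P'"
    then have surj: "f ` carrier P = carrier P'" and inj: "inj_on f (carrier P)"
      by (auto simp: right_iso_def bij_betw_def)
    have sub: "right_submodule R P' (f ` right_module_ideal_prod P N)"
      by (rule right_hom_image_submodule[OF M M' f right_module_ideal_prod_submodule[OF M N]])
    have "right_module_ideal_prod P' N \<subseteq> f ` right_module_ideal_prod P N"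
    proof (rule P'.right_module_ideal_prod_least[OF sub])
      fix y a assume "y \<in> carrier P'" and a: "a \<in> N"
      then obtain x where x: "x \<in> carrier P" "y = f x" using surj by blast
      then show "y \<star>\<^bsub>P'\<^esub> a \<in> f ` right_module_ideal_prod P N"
        using right_hom_rsmult[OF f x(1) N.a_Hcarr[OF a]] P.rsmult_in_ideal_prod[OF x(1) a] by (metis image_eqI)
    qed
    then have "f x \<in> right_module_ideal_prod P' N \<longleftrightarrow> x \<in> right_module_ideal_prod P N"
      if "x \<in> carrier P" for x
      using inj that right_hom_ideal_prod[OF M M' N f]
        P.right_submodule_subset[OF right_module_ideal_prod_submodule[OF M N]]
      by (blast dest: inj_onD)
    moreover have "?\<pi>' \<circ> f \<in> right_hom R P (inflation R N ?X')"
      using right_hom_comp[OF f] \<pi>' by (auto simp: is_reduction_def)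
    moreover have "(?\<pi>' \<circ> f) ` carrier P = carrier ?X'"
      using surj \<pi>' by (metis image_comp is_reduction_def)
    ultimately have "is_reduction R N P ?X' (?\<pi>' \<circ> f)"
      using \<pi>' right_hom_closed[OF f] by (auto simp: is_reduction_def)
    from right_iso_of_reductions[OF M N X X' \<pi> this]
    obtain \<sigma> where \<sigma>: "\<sigma> \<in> right_iso (R Quot N) ?X ?X'"
      and "\<forall>x\<in>carrier P. \<sigma> (?\<pi> x) = (?\<pi>' \<circ> f) x"
      by (rule bexE)
    then have eq: "\<sigma> (?\<pi> x) = ?f (?\<pi> x)" if "x \<in> carrier P" for x using comm that by simp
    have "\<sigma> C = ?f C" if "C \<in> carrier ?X" for C
      using that eq by (auto simp: reduction_carrier_iff)
    then have "bij_betw ?f (carrier ?X) (carrier ?X')"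
      using \<sigma> by (auto simp: right_iso_def cong: bij_betw_cong)
    then show "?f \<in> right_iso (R Quot N) ?X ?X'"
      using reduction_map_right_hom[OF M M' N f] by (simp add: right_iso_def)
  qed
qed

text \<open>
  Submodules of \<open>X\<close> pull back to \<open>P\<close>, and the image in \<open>X\<close> of a submodule \<open>H\<close> of \<open>P\<close> is all of \<open>X\<close>
  only if \<open>H + PN = P\<close>, that is, only if \<open>H = P\<close>.
\<close>

lemma right_span_reduction:
  assumes P: "right_module R P" and N: "ideal N R" and nil: "right_T_nilpotent R N"
    and X: "right_module (R Quot N) X" and \<pi>: "is_reduction R N P X \<pi>" and S: "S \<subseteq> carrier P"
  shows "right_span (R Quot N) X (\<pi> ` S) = carrier X \<longleftrightarrow> right_span R P S = carrier P"
proof -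
  interpret P: right_module R P by (rule P)
  interpret N: ideal N R by (rule N)
  have Y: "right_module R (inflation R N X)" by (rule N.inflation_is_right_module[OF X])
  interpret Y: right_module R "inflation R N X" by (rule Y)
  have \<pi>h: "\<pi> \<in> right_hom R P (inflation R N X)" and \<pi>i: "\<pi> ` carrier P = carrier X"
    using \<pi> by (auto simp: is_reduction_def)
  have "right_span R (inflation R N X) (\<pi> ` S) = carrier (inflation R N X)
    \<longleftrightarrow> right_span R P S = carrier P" (is "?L \<longleftrightarrow> ?R")
  proof
    assume L: ?L
    have "H = carrier P" if H: "right_submodule R P H" "S \<subseteq> H" for H
    proof (rule nakayama[OF P N nil H(1)])
      fix x assume x: "x \<in> carrier P"
      have "\<pi> ` H = carrier X"
        using L Y.right_span_eq_carrier_iff[of "\<pi> ` S"] right_hom_image_submodule[OF P Y \<pi>h H(1)]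
          H(2) S \<pi>i by (metis image_mono inflation_simps(1))
      then obtain h where "h \<in> H" "\<pi> x = \<pi> h" using x \<pi>i by blast
      then show "\<exists>h\<in>H. x \<ominus>\<^bsub>P\<^esub> h \<in> right_module_ideal_prod P N"
        using is_reduction_eq_iff[OF P N X \<pi> x] P.right_submodule_subset[OF H(1)] by blast
    qed
    then show ?R using P.right_span_eq_carrier_iff[OF S] by blast
  next
    assume R: ?R
    have "H = carrier X" if H: "right_submodule R (inflation R N X) H" "\<pi> ` S \<subseteq> H" for H
    proof -
      have "{x \<in> carrier P. \<pi> x \<in> H} = carrier P"
        using R P.right_span_eq_carrier_iff[OF S] right_hom_vimage_submodule[OF P Y \<pi>h H(1)] H(2) S by blast
      then have "\<pi> ` carrier P \<subseteq> H" by blast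
      then show ?thesis using Y.right_submodule_subset[OF H(1)] \<pi>i by auto
    qed
    then show ?L using Y.right_span_eq_carrier_iff[of "\<pi> ` S"] \<pi>i S by auto
  qed
  then show ?thesis by (simp add: N.right_span_inflation[OF X])
qed

lemma generated_reduction_iff:
  assumes P: "right_module R P" and N: "ideal N R" and nil: "right_T_nilpotent R N"
    and X: "right_module (R Quot N) X" and \<pi>: "is_reduction R N P X \<pi>"
  shows "finitely_generated (R Quot N) X \<longleftrightarrow> finitely_generated R P"
    and "countably_generated (R Quot N) X \<longleftrightarrow> countably_generated R P"
proof -
  note span = right_span_reduction[OF P N nil X \<pi>]
  have \<pi>i: "\<pi> ` carrier P = carrier X" using \<pi> by (auto simp: is_reduction_def)
  have lift: "inv_into (carrier P) \<pi> ` S \<subseteq> carrier P \<and>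
      right_span R P (inv_into (carrier P) \<pi> ` S) = carrier P"
    if S: "S \<subseteq> carrier X" "right_span (R Quot N) X S = carrier X" for S
  proof -
    have "inv_into (carrier P) \<pi> ` S \<subseteq> carrier P"
      using S(1) \<pi>i by (intro image_subsetI inv_into_into) auto
    moreover have "\<pi> ` inv_into (carrier P) \<pi> ` S = S"
      using S(1) \<pi>i by (simp add: image_inv_into_cancel)
    ultimately show ?thesis using span[of "inv_into (carrier P) \<pi> ` S"] S(2) by simp
  qed
  have push: "\<pi> ` T \<subseteq> carrier X \<and> right_span (R Quot N) X (\<pi> ` T) = carrier X"
    if "T \<subseteq> carrier P" "right_span R P T = carrier P" for T
    using that span[of T] \<pi>i by blast
  show "finitely_generated (R Quot N) X \<longleftrightarrow> finitely_generated R P"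
    unfolding finitely_generated_def using lift push by (meson finite_imageI)
  show "countably_generated (R Quot N) X \<longleftrightarrow> countably_generated R P"
    unfolding countably_generated_def using lift push by (meson countable_image)
qed


section \<open>Free modules and their summands\<close>

lemma free_lifts:
  assumes R: "ring R" and A: "right_module R A" and B: "right_module R B"
    and g: "g \<in> right_hom R A B" and surj: "g ` carrier A = carrier B"
    and h: "h \<in> right_hom R (free_right_module R S) B"
  shows "\<exists>k\<in>right_hom R (free_right_module R S) A. \<forall>x\<in>carrier (free_right_module R S). g (k x) = h x"
proof -
  have "\<forall>i\<in>S. \<exists>a\<in>carrier A. g a = h (free_basis R i)"
    using right_hom_closed[OF h free_basis_closed[OF R]] surj by (metis imageE)
  then obtain t where t: "\<And>i. i \<in> S \<Longrightarrow> t i \<in> carrier A" "\<And>i. i \<in> S \<Longrightarrow> g (t i) = h (free_basis R i)"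
    by metis
  then obtain k where k: "k \<in> right_hom R (free_right_module R S) A"
    "\<And>i. i \<in> S \<Longrightarrow> k (free_basis R i) = t i"
    using free_right_hom_exists[OF R A, of S t] by blast
  have "g (k x) = h x" if "x \<in> carrier (free_right_module R S)" for x
    using free_right_hom_eq[OF R B right_hom_comp[OF k(1) g] h _ that] k(2) t(2) by simp
  then show ?thesis using k(1) by blast
qed

text \<open>
  Taking all of \<open>P\<close> as a basis gives a retraction \<open>g\<close> whose source is determined by \<open>P\<close>, unlike the
  free module in the definition of projectivity. The coordinates of \<open>k\<close> form a dual basis.
\<close>

lemma projective_free_retract:
  assumes P: "projective R P"
  shows "\<exists>g \<in> right_hom R (free_right_module R (carrier P)) P. \<exists>k \<in> right_hom R P (free_right_module R (carrier P)).
    g ` carrier (free_right_module R (carrier P)) = carrier P \<and> (\<forall>x\<in>carrier P. g (k x) = x)"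
proof -
  let ?F = "free_right_module R (carrier P)"
  have M: "right_module R P" using P by (simp add: projective_def)
  have R: "ring R" by (rule right_module_ring[OF M])
  obtain g where g: "g \<in> right_hom R ?F P" "\<And>x. x \<in> carrier P \<Longrightarrow> g (free_basis R x) = x"
    using free_right_hom_exists[OF R M, of "carrier P" "\<lambda>x. x"] by auto
  have surj: "g ` carrier ?F = carrier P"
    using right_hom_closed[OF g(1)] free_basis_closed[OF R, of _ "carrier P"] g(2)
    by (intro equalityI subsetI) (blast, metis image_eqI)
  have "(\<lambda>x. x) \<in> right_hom R P P" by (intro right_homI) auto
  then obtain k where "k \<in> right_hom R P ?F" "\<And>x. x \<in> carrier P \<Longrightarrow> g (k x) = x"
    using projective_lifts[OF P free_right_module_is_right_module[OF R] M g(1) surj] by blast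
  then show ?thesis using g(1) surj by blast
qed

lemma right_hom_restrict:
  assumes f: "f \<in> right_hom R M M'" and H: "H \<subseteq> carrier M"
  shows "f \<in> right_hom R (M\<lparr>carrier := H\<rparr>) M'"
  using right_hom_closed[OF f] right_hom_add[OF f] right_hom_rsmult[OF f] H
  by (intro right_homI) (auto simp: subset_iff)

text \<open>
  The basis \<open>S\<close> may be of any type here, whereas the definition of projectivity asks for a basis of
  elements of the type of the module itself; the lifting property bridges the two.
\<close>

lemma direct_summand_of_free_projective:
  assumes R: "ring R" and ds: "direct_summands R (free_right_module R S) U V"
  shows "projective R ((free_right_module R S)\<lparr>carrier := U\<rparr>)"
proof -
  let ?F = "free_right_module R S"
  let ?P = "?F\<lparr>carrier := U\<rparr>"
  have F: "right_module R ?F" by (rule free_right_module_is_right_module[OF R])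
  interpret F: right_module R ?F by (rule F)
  have U: "right_submodule R ?F U" using ds by (simp add: direct_summands_def)
  have P: "right_module R ?P" by (rule right_submodule_module[OF F U])
  obtain p where p: "p \<in> right_hom R ?F ?P" "\<And>x. x \<in> U \<Longrightarrow> p x = x"
    using direct_summand_projection[OF F ds] by blast
  show ?thesis
  proof (rule projective_if_lifts[OF P])
    fix A :: "('a, ('c \<Rightarrow> 'a) \<Rightarrow> 'a) right_module" and g
    assume A: "right_module R A" and g: "g \<in> right_hom R A ?P" "g ` carrier A = carrier ?P"
    obtain k where k: "k \<in> right_hom R ?F A" "\<And>x. x \<in> carrier ?F \<Longrightarrow> g (k x) = p x"
      using free_lifts[OF R A P g p(1)] by blast
    have "k \<in> right_hom R ?P A"
      by (rule right_hom_restrict[OF k(1) F.right_submodule_subset[OF U]])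
    moreover have "g (k x) = x" if "x \<in> U" for x
      using k(2)[of x] p(2)[OF that] F.right_submodule_subset[OF U] that by auto
    ultimately show "\<exists>k\<in>right_hom R ?P A. \<forall>x\<in>carrier ?P. g (k x) = x" by auto
  qed
qed

lemma free_ideal_prod_iff:
  assumes R: "ring R" and J: "ideal J R" and x: "x \<in> carrier (free_right_module R S)"
  shows "x \<in> right_module_ideal_prod (free_right_module R S) J \<longleftrightarrow> (\<forall>i. x i \<in> J)"
proof -
  let ?F = "free_right_module R S"
  interpret J: ideal J R by (rule J)
  interpret F: right_module R ?F by (rule free_right_module_is_right_module[OF R])
  have FJ: "right_submodule R ?F (right_module_ideal_prod ?F J)"
    by (rule right_module_ideal_prod_submodule[OF F.right_module_axioms J])
  have coord: "y i \<in> carrier R" if "y \<in> carrier ?F" for y i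
    using that by (cases "i \<in> S") (auto simp: free_right_module_def)
  have "\<forall>y\<in>carrier ?F. (\<forall>i. y i \<in> J) \<longrightarrow> {i. y i \<noteq> \<zero>\<^bsub>R\<^esub>} \<subseteq> T \<longrightarrow> y \<in> right_module_ideal_prod ?F J"
    if "finite T" for T
    using that
  proof (induction T rule: finite_induct)
    case empty
    show ?case
    proof (intro ballI impI)
      fix y assume "y \<in> carrier ?F" "{i. y i \<noteq> \<zero>\<^bsub>R\<^esub>} \<subseteq> {}"
      then have "y = \<zero>\<^bsub>?F\<^esub>" by (auto simp: free_right_module_def)
      then show "y \<in> right_module_ideal_prod ?F J" using F.right_submodule_zero[OF FJ] by simp
    qed
  next
    case (insert i T)
    show ?case
    proof (intro ballI impI)
      fix y assume y: "y \<in> carrier ?F" and yJ: "\<forall>i. y i \<in> J" and supp: "{i. y i \<noteq> \<zero>\<^bsub>R\<^esub>} \<subseteq> insert i T"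
      show "y \<in> right_module_ideal_prod ?F J"
      proof (cases "i \<in> S")
        case False
        then have "{i. y i \<noteq> \<zero>\<^bsub>R\<^esub>} \<subseteq> T" using y supp by (auto simp: free_right_module_def)
        then show ?thesis using insert.IH y yJ by blast
      next
        case True
        let ?z = "y(i := \<zero>\<^bsub>R\<^esub>)"
        have "{j. ?z j \<noteq> \<zero>\<^bsub>R\<^esub>} \<subseteq> {i. y i \<noteq> \<zero>\<^bsub>R\<^esub>}" by auto
        then have z: "?z \<in> carrier ?F" using y True
          by (auto simp: free_right_module_def intro: finite_subset)
        have "{j. ?z j \<noteq> \<zero>\<^bsub>R\<^esub>} \<subseteq> T" "\<forall>j. ?z j \<in> J" using supp yJ J.zero_closed by auto
        then have "?z \<in> right_module_ideal_prod ?F J" using insert.IH z by blast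
        moreover have "free_basis R i \<star>\<^bsub>?F\<^esub> y i \<in> right_module_ideal_prod ?F J"
          using yJ by (intro F.rsmult_in_ideal_prod free_basis_closed[OF R True]) blast
        moreover have "y = free_basis R i \<star>\<^bsub>?F\<^esub> y i \<oplus>\<^bsub>?F\<^esub> ?z"
          using coord[OF y] by (auto simp: free_right_module_def free_basis_def fun_eq_iff)
        ultimately show ?thesis using F.right_submodule_add[OF FJ] by metis
      qed
    qed
  qed
  moreover have "finite {i. x i \<noteq> \<zero>\<^bsub>R\<^esub>}" using x by (simp add: free_right_module_def)
  moreover have "right_module_ideal_prod ?F J \<subseteq> {y \<in> carrier ?F. \<forall>i. y i \<in> J}"
  proof (rule F.right_module_ideal_prod_least)
    show "right_submodule R ?F {y \<in> carrier ?F. \<forall>i. y i \<in> J}"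
      using J.zero_closed J.a_closed J.I_r_closed F.M.zero_closed F.M.a_closed F.rsmult_closed
      by (intro F.right_submoduleI) (auto, auto simp: free_right_module_def)
  next
    fix y a assume y: "y \<in> carrier ?F" and a: "a \<in> J"
    then have "y \<star>\<^bsub>?F\<^esub> a \<in> carrier ?F" using J.a_Hcarr by simp
    moreover have "(y \<star>\<^bsub>?F\<^esub> a) i \<in> J" for i
      using J.I_l_closed[OF a coord[OF y]] by (simp add: free_right_module_def)
    ultimately show "y \<star>\<^bsub>?F\<^esub> a \<in> {y \<in> carrier ?F. \<forall>i. y i \<in> J}" by blast
  qed
  ultimately show ?thesis using x by blast
qed

lemma free_is_reduction:
  assumes N: "ideal N R"
  shows "is_reduction R N (free_right_module R S) (free_right_module (R Quot N) S) (\<lambda>x i. N +>\<^bsub>R\<^esub> x i)"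
proof -
  interpret N: ideal N R by (rule N)
  let ?F = "free_right_module R S" and ?E = "free_right_module (R Quot N) S"
  let ?\<rho> = "\<lambda>x i. N +>\<^bsub>R\<^esub> x i"
  have R: "ring R" by (rule N.ring_axioms)
  have zero: "N +>\<^bsub>R\<^esub> a = \<zero>\<^bsub>R Quot N\<^esub> \<longleftrightarrow> a \<in> N" if "a \<in> carrier R" for a
    using N.a_rcos_self[OF that] N.a_rcos_const by (auto simp: FactRing_def)
  have coord: "y i \<in> carrier R" if "y \<in> carrier ?F" for y i
    using that by (cases "i \<in> S") (auto simp: free_right_module_def)
  have hom: "?\<rho> \<in> right_hom R ?F (inflation R N ?E)"
  proof (rule right_homI)
    fix x assume x: "x \<in> carrier ?F"
    have "N +>\<^bsub>R\<^esub> x i = \<zero>\<^bsub>R Quot N\<^esub>" if "x i = \<zero>\<^bsub>R\<^esub>" for i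
      by (simp only: that N.FactRing_coset_zero)
    then have "{i. N +>\<^bsub>R\<^esub> x i \<noteq> \<zero>\<^bsub>R Quot N\<^esub>} \<subseteq> {i. x i \<noteq> \<zero>\<^bsub>R\<^esub>}" by blast
    moreover have "finite {i. x i \<noteq> \<zero>\<^bsub>R\<^esub>}" using x by (simp add: free_right_module_def)
    ultimately have "finite {i. N +>\<^bsub>R\<^esub> x i \<noteq> \<zero>\<^bsub>R Quot N\<^esub>}" by (rule finite_subset)
    then show "?\<rho> x \<in> carrier (inflation R N ?E)"
      using x N.FactRing_coset_zero N.FactRing_coset_closed by (simp add: free_right_module_def)
  next
    fix x y assume "x \<in> carrier ?F" "y \<in> carrier ?F"
    from coord[OF this(1)] coord[OF this(2)]
    show "?\<rho> (x \<oplus>\<^bsub>?F\<^esub> y) = ?\<rho> x \<oplus>\<^bsub>inflation R N ?E\<^esub> ?\<rho> y"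
      by (simp add: free_right_module_def N.FactRing_coset_add)
  next
    fix x a assume "x \<in> carrier ?F" and a: "a \<in> carrier R"
    from coord[OF this(1)] a
    show "?\<rho> (x \<star>\<^bsub>?F\<^esub> a) = ?\<rho> x \<star>\<^bsub>inflation R N ?E\<^esub> a"
      by (simp add: free_right_module_def N.FactRing_coset_mult)
  qed
  have "carrier ?E \<subseteq> ?\<rho> ` carrier ?F"
  proof
    fix y assume y: "y \<in> carrier ?E"
    define x where "x i = (if y i = \<zero>\<^bsub>R Quot N\<^esub> then \<zero>\<^bsub>R\<^esub> else SOME a. a \<in> carrier R \<and> y i = N +>\<^bsub>R\<^esub> a)" for i
    have "y i \<in> carrier (R Quot N)" for i
      using y N.FactRing_coset_zero N.FactRing_coset_closed[of "\<zero>\<^bsub>R\<^esub>"]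
      by (cases "i \<in> S") (auto simp: free_right_module_def)
    then have "\<exists>a. a \<in> carrier R \<and> y i = N +>\<^bsub>R\<^esub> a" for i by (auto simp: N.FactRing_carrier_iff)
    from someI_ex[OF this] have x: "x i \<in> carrier R" "y i = N +>\<^bsub>R\<^esub> x i" for i
      using N.FactRing_coset_zero by (auto simp: x_def)
    have "{i. x i \<noteq> \<zero>\<^bsub>R\<^esub>} \<subseteq> {i. y i \<noteq> \<zero>\<^bsub>R Quot N\<^esub>}" by (auto simp: x_def)
    moreover have "finite {i. y i \<noteq> \<zero>\<^bsub>R Quot N\<^esub>}" using y by (simp add: free_right_module_def)
    ultimately have "finite {i. x i \<noteq> \<zero>\<^bsub>R\<^esub>}" by (rule finite_subset)
    then have "x \<in> carrier ?F" using x(1) y by (auto simp: free_right_module_def x_def)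
    moreover have "y = ?\<rho> x" using x(2) by blast
    ultimately show "y \<in> ?\<rho> ` carrier ?F" by blast
  qed
  then have "?\<rho> ` carrier ?F = carrier ?E" using right_hom_closed[OF hom] by auto
  moreover have "?\<rho> x = \<zero>\<^bsub>?E\<^esub> \<longleftrightarrow> x \<in> right_module_ideal_prod ?F N" if "x \<in> carrier ?F" for x
    using free_ideal_prod_iff[OF R N that] zero coord[OF that]
    by (simp add: free_right_module_def fun_eq_iff)
  ultimately show ?thesis using hom by (simp add: is_reduction_def)
qed


section \<open>Fitting decomposition and lifting of projective modules\<close>

text \<open>
  The Fitting null component of an endomorphism.
\<close>

definition nil_part :: "('a, 'm) ring_scheme \<Rightarrow> ('a \<Rightarrow> 'a) \<Rightarrow> 'a set" where
  "nil_part M \<phi> = {x \<in> carrier M. \<exists>n. (\<phi> ^^ n) x = \<zero>\<^bsub>M\<^esub>}"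

lemma right_hom_funpow:
  assumes "\<phi> \<in> right_hom R M M" shows "\<phi> ^^ n \<in> right_hom R M M"
  by (induction n) (auto intro: right_homI right_hom_comp[OF _ assms, unfolded o_def] simp: o_def)

lemma right_hom_id_minus:
  assumes M: "right_module R M" and \<phi>: "\<phi> \<in> right_hom R M M"
  shows "(\<lambda>x. x \<ominus>\<^bsub>M\<^esub> \<phi> x) \<in> right_hom R M M"
proof -
  interpret M: right_module R M by (rule M)
  show ?thesis
    using right_hom_closed[OF \<phi>]
    by (intro right_homI)
      (simp_all add: right_hom_add[OF \<phi>] right_hom_rsmult[OF \<phi>] M.M.minus_eq M.M.minus_add M.M.a_ac
        M.rsmult_add_left M.rsmult_minus_left)
qed

context
  fixes R :: "('a, 'r) ring_scheme" and M :: "('a, 'b, 'm) right_module_scheme" and \<phi>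
  assumes M: "right_module R M" and \<phi>: "\<phi> \<in> right_hom R M M"
begin

interpretation M: right_module R M by (rule M)

lemma funpow_zero: "(\<phi> ^^ n) \<zero>\<^bsub>M\<^esub> = \<zero>\<^bsub>M\<^esub>"
  by (rule right_hom_zero[OF M.abelian_group_axioms M.abelian_group_axioms right_hom_funpow[OF \<phi>]])

lemma nil_part_submodule: "right_submodule R M (nil_part M \<phi>)"
proof (rule M.right_submoduleI)
  show "\<zero>\<^bsub>M\<^esub> \<in> nil_part M \<phi>" using funpow_zero by (auto simp: nil_part_def)
next
  fix x y assume "x \<in> nil_part M \<phi>" "y \<in> nil_part M \<phi>"
  then obtain m n where xy: "x \<in> carrier M" "y \<in> carrier M" "(\<phi> ^^ m) x = \<zero>\<^bsub>M\<^esub>" "(\<phi> ^^ n) y = \<zero>\<^bsub>M\<^esub>"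
    by (auto simp: nil_part_def)
  have "(\<phi> ^^ (n + m)) x = \<zero>\<^bsub>M\<^esub>" using xy funpow_zero by (simp add: funpow_add)
  moreover have "(\<phi> ^^ (n + m)) y = \<zero>\<^bsub>M\<^esub>"
    using xy funpow_zero by (simp add: add.commute[of n m] funpow_add)
  ultimately have "(\<phi> ^^ (n + m)) (x \<oplus>\<^bsub>M\<^esub> y) = \<zero>\<^bsub>M\<^esub>"
    using right_hom_add[OF right_hom_funpow[OF \<phi>] xy(1,2)] by simp
  then show "x \<oplus>\<^bsub>M\<^esub> y \<in> nil_part M \<phi>" using xy by (auto simp: nil_part_def)
next
  fix x a assume "x \<in> nil_part M \<phi>" and a: "a \<in> carrier R"
  then obtain n where x: "x \<in> carrier M" "(\<phi> ^^ n) x = \<zero>\<^bsub>M\<^esub>" by (auto simp: nil_part_def)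
  then have "(\<phi> ^^ n) (x \<star>\<^bsub>M\<^esub> a) = \<zero>\<^bsub>M\<^esub>"
    using right_hom_rsmult[OF right_hom_funpow[OF \<phi>] x(1) a] a by simp
  then show "x \<star>\<^bsub>M\<^esub> a \<in> nil_part M \<phi>" using x(1) a by (auto simp: nil_part_def)
qed (auto simp: nil_part_def)

lemma nil_part_reflects:
  assumes "x \<in> carrier M" "\<phi> x \<in> nil_part M \<phi>" shows "x \<in> nil_part M \<phi>"
proof -
  obtain n where "(\<phi> ^^ n) (\<phi> x) = \<zero>\<^bsub>M\<^esub>" using assms by (auto simp: nil_part_def)
  then have "(\<phi> ^^ Suc n) x = \<zero>\<^bsub>M\<^esub>" by (simp add: funpow_swap1)
  then show ?thesis using assms(1) unfolding nil_part_def by blast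
qed

lemma nil_part_closed:
  assumes "x \<in> nil_part M \<phi>" shows "\<phi> x \<in> nil_part M \<phi>"
proof -
  obtain n where n: "x \<in> carrier M" "(\<phi> ^^ n) x = \<zero>\<^bsub>M\<^esub>" using assms by (auto simp: nil_part_def)
  then have "(\<phi> ^^ n) (\<phi> x) = \<zero>\<^bsub>M\<^esub>"
    using right_hom_zero[OF M.abelian_group_axioms M.abelian_group_axioms \<phi>] by (simp add: funpow_swap1[symmetric])
  then show ?thesis using right_hom_closed[OF \<phi> n(1)] by (auto simp: nil_part_def)
qed

lemma nil_part_fixed_point:
  assumes "x \<in> nil_part M \<phi>" "\<phi> x = x" shows "x = \<zero>\<^bsub>M\<^esub>"
proof -
  have "(\<phi> ^^ n) x = x" for n using assms(2) by (induction n) auto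
  then show ?thesis using assms(1) by (auto simp: nil_part_def)
qed

text \<open>
  The preimage is the geometric series \<open>y = x + \<phi> x + \<phi>\<^sup>2 x + \<dots>\<close>, which is finite at \<open>x\<close>. The
  induction on the nilpotency exponent adds one term at a time.
\<close>

lemma nil_part_id_minus_surj:
  assumes "x \<in> nil_part M \<phi>" shows "\<exists>y\<in>nil_part M \<phi>. x = y \<ominus>\<^bsub>M\<^esub> \<phi> y"
proof -
  have "\<forall>x\<in>carrier M. (\<phi> ^^ n) x = \<zero>\<^bsub>M\<^esub> \<longrightarrow> (\<exists>y\<in>nil_part M \<phi>. x = y \<ominus>\<^bsub>M\<^esub> \<phi> y)" for n
  proof (induction n)
    case 0
    then show ?case
      using right_hom_zero[OF M.abelian_group_axioms M.abelian_group_axioms \<phi>]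
        M.right_submodule_zero[OF nil_part_submodule]
      by (auto simp: M.diff_zero intro!: bexI[of _ "\<zero>\<^bsub>M\<^esub>"])
  next
    case (Suc n)
    show ?case
    proof (intro ballI impI)
      fix x assume x: "x \<in> carrier M" and nil: "(\<phi> ^^ Suc n) x = \<zero>\<^bsub>M\<^esub>"
      have xn: "x \<in> nil_part M \<phi>" using x nil unfolding nil_part_def by blast
      have \<phi>x: "\<phi> x \<in> carrier M" by (rule right_hom_closed[OF \<phi> x])
      have "(\<phi> ^^ n) (\<phi> x) = \<zero>\<^bsub>M\<^esub>" using nil by (simp add: funpow_swap1)
      then obtain y where y: "y \<in> nil_part M \<phi>" "\<phi> x = y \<ominus>\<^bsub>M\<^esub> \<phi> y" using Suc.IH \<phi>x by blast
      have yc: "y \<in> carrier M" "\<phi> y \<in> carrier M"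
        using y(1) right_hom_closed[OF \<phi>] by (auto simp: nil_part_def)
      have "(x \<oplus>\<^bsub>M\<^esub> y) \<ominus>\<^bsub>M\<^esub> \<phi> (x \<oplus>\<^bsub>M\<^esub> y) = (x \<ominus>\<^bsub>M\<^esub> \<phi> x) \<oplus>\<^bsub>M\<^esub> (y \<ominus>\<^bsub>M\<^esub> \<phi> y)"
        using x yc \<phi>x right_hom_add[OF \<phi> x yc(1)] by (simp add: M.M.minus_eq M.M.minus_add M.M.a_ac)
      also have "\<dots> = x" unfolding y(2)[symmetric] using x \<phi>x
        by (simp add: M.M.minus_eq M.M.a_assoc M.M.l_neg)
      finally show "\<exists>y\<in>nil_part M \<phi>. x = y \<ominus>\<^bsub>M\<^esub> \<phi> y"
        using M.right_submodule_add[OF nil_part_submodule xn y(1)] by metis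
    qed
  qed
  then show ?thesis using assms by (auto simp: nil_part_def)
qed

end

text \<open>
  Put \<open>d = 1 - e\<close>, and let \<open>A\<close> and \<open>B\<close> be the null components of \<open>d\<close> and \<open>e\<close>. On \<open>A\<close> the map
  \<open>e = 1 - d\<close> is injective, so \<open>A \<inter> B = 0\<close>. The sum \<open>A + B\<close> contains every \<open>x\<close> with \<open>e (d x)\<close> in
  \<open>A + B\<close>: on \<open>A\<close> the map \<open>e\<close> is surjective, and on \<open>B\<close> the map \<open>d\<close> is, so if \<open>e (d x) = e a' + b\<close>,
  then \<open>d x - a'\<close> is in \<open>B\<close>, say equal to \<open>d b'\<close>, and then \<open>d (x - b') = a'\<close> puts \<open>x - b'\<close> in \<open>A\<close>. As
  \<open>e d\<close> maps \<open>M\<close> into \<open>MN\<close>, the sum is everything.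
\<close>

lemma fitting_decomposition:
  assumes M: "right_module R M" and N: "ideal N R" and nil: "right_T_nilpotent R N"
    and e: "e \<in> right_hom R M M"
    and idem: "\<And>x. x \<in> carrier M \<Longrightarrow> e (x \<ominus>\<^bsub>M\<^esub> e x) \<in> right_module_ideal_prod M N"
  shows "direct_summands R M (nil_part M (\<lambda>x. x \<ominus>\<^bsub>M\<^esub> e x)) (nil_part M e)"
proof -
  interpret M: right_module R M by (rule M)
  define d where "d x = x \<ominus>\<^bsub>M\<^esub> e x" for x
  have d: "d \<in> right_hom R M M" using right_hom_id_minus[OF M e] by (simp add: d_def[abs_def])
  have ec: "e x \<in> carrier M" and dc: "d x \<in> carrier M" if "x \<in> carrier M" for x
    using right_hom_closed[OF e that] right_hom_closed[OF d that] .
  have ed: "e x = x \<ominus>\<^bsub>M\<^esub> d x" if "x \<in> carrier M" for x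
    using that ec[OF that] by (simp add: d_def M.M.minus_eq M.M.minus_add M.M.r_neg2 M.M.r_neg1)
  let ?A = "nil_part M d" and ?B = "nil_part M e"
  have A: "right_submodule R M ?A" and B: "right_submodule R M ?B"
    by (rule nil_part_submodule[OF M d], rule nil_part_submodule[OF M e])
  have Ac: "x \<in> carrier M" if "x \<in> ?A" for x using that by (simp add: nil_part_def)
  have Bc: "x \<in> carrier M" if "x \<in> ?B" for x using that by (simp add: nil_part_def)
  have "x = \<zero>\<^bsub>M\<^esub>" if "x \<in> ?A" "(e ^^ n) x = \<zero>\<^bsub>M\<^esub>" for x n
    using that
  proof (induction n arbitrary: x)
    case (Suc n)
    have x: "x \<in> carrier M" by (rule Ac[OF Suc.prems(1)])
    have "e x \<in> ?A"
      unfolding ed[OF x] using Suc.prems(1) nil_part_closed[OF M d] by (intro M.right_submodule_diff[OF A]) auto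
    then have "e x = \<zero>\<^bsub>M\<^esub>" using Suc by (simp add: funpow_swap1)
    then have "d x = x" using x by (simp add: d_def M.diff_zero)
    then show ?case using nil_part_fixed_point[OF M d Suc.prems(1)] by simp
  qed simp
  then have int: "?A \<inter> ?B = {\<zero>\<^bsub>M\<^esub>}"
    using M.right_submodule_zero[OF A] M.right_submodule_zero[OF B] by (auto simp: nil_part_def)
  let ?T = "?A <+>\<^bsub>M\<^esub> ?B"
  note Tiff = set_add_iff[of _ M ?A ?B]
  have T: "right_submodule R M ?T"
  proof (rule M.right_submoduleI)
    show "?T \<subseteq> carrier M" using Ac Bc by (auto simp: Tiff)
    show "\<zero>\<^bsub>M\<^esub> \<in> ?T"
      unfolding Tiff using M.right_submodule_zero[OF A] M.right_submodule_zero[OF B] by (metis M.M.l_zero M.M.zero_closed)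
  next
    fix x y assume "x \<in> ?T" "y \<in> ?T"
    then obtain a b a' b' where ab: "a \<in> ?A" "b \<in> ?B" "x = a \<oplus>\<^bsub>M\<^esub> b" "a' \<in> ?A" "b' \<in> ?B" "y = a' \<oplus>\<^bsub>M\<^esub> b'"
      unfolding Tiff by blast
    then have "x \<oplus>\<^bsub>M\<^esub> y = (a \<oplus>\<^bsub>M\<^esub> a') \<oplus>\<^bsub>M\<^esub> (b \<oplus>\<^bsub>M\<^esub> b')" using Ac Bc by (simp add: M.M.a_ac)
    then show "x \<oplus>\<^bsub>M\<^esub> y \<in> ?T"
      unfolding Tiff using ab M.right_submodule_add[OF A] M.right_submodule_add[OF B] by blast
  next
    fix x r assume "x \<in> ?T" and r: "r \<in> carrier R"
    then obtain a b where ab: "a \<in> ?A" "b \<in> ?B" "x = a \<oplus>\<^bsub>M\<^esub> b" unfolding Tiff by blast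
    then have "x \<star>\<^bsub>M\<^esub> r = a \<star>\<^bsub>M\<^esub> r \<oplus>\<^bsub>M\<^esub> b \<star>\<^bsub>M\<^esub> r" using Ac Bc r by (simp add: M.rsmult_add_left)
    then show "x \<star>\<^bsub>M\<^esub> r \<in> ?T"
      unfolding Tiff using ab r M.right_submodule_rsmult[OF A] M.right_submodule_rsmult[OF B] by blast
  qed
  have "?T = carrier M"
  proof (rule T_nilpotent_exhausts[OF M N nil T right_hom_comp[OF d e]])
    fix x assume x: "x \<in> carrier M" and "(e \<circ> d) x \<in> ?T"
    then obtain a b where a: "a \<in> ?A" and b: "b \<in> ?B" and eq: "e (d x) = a \<oplus>\<^bsub>M\<^esub> b"
      unfolding Tiff by auto
    obtain a' where a': "a' \<in> ?A" "a = e a'"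
      using nil_part_id_minus_surj[OF M d a] ed Ac by metis
    have "e (d x \<ominus>\<^bsub>M\<^esub> a') = b"
      using right_hom_diff[OF M M e dc[OF x] Ac[OF a'(1)]] eq Ac[OF a] Bc[OF b] a'(2)
      by (simp add: M.M.minus_eq M.M.a_ac M.M.r_neg M.M.r_neg2 M.M.r_neg1)
    then have "d x \<ominus>\<^bsub>M\<^esub> a' \<in> ?B"
      using nil_part_reflects[OF M e, of "d x \<ominus>\<^bsub>M\<^esub> a'"] b dc[OF x] Ac[OF a'(1)] by simp
    then obtain b' where b': "b' \<in> ?B" "d x \<ominus>\<^bsub>M\<^esub> a' = d b'"
      using nil_part_id_minus_surj[OF M e] unfolding d_def by blast
    have "d (x \<ominus>\<^bsub>M\<^esub> b') = d x \<ominus>\<^bsub>M\<^esub> (d x \<ominus>\<^bsub>M\<^esub> a')"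
      using right_hom_diff[OF M M d x Bc[OF b'(1)]] b'(2) by simp
    also have "\<dots> = a'" using dc[OF x] Ac[OF a'(1)] by (simp add: M.M.minus_eq M.M.minus_add M.M.r_neg2 M.M.r_neg1)
    finally have "x \<ominus>\<^bsub>M\<^esub> b' \<in> ?A"
      using nil_part_reflects[OF M d, of "x \<ominus>\<^bsub>M\<^esub> b'"] a'(1) x Bc[OF b'(1)] by simp
    moreover have "x = (x \<ominus>\<^bsub>M\<^esub> b') \<oplus>\<^bsub>M\<^esub> b'"
      using x Bc[OF b'(1)] by (simp add: M.M.minus_eq M.M.a_assoc M.M.l_neg)
    ultimately show "x \<in> ?T" unfolding Tiff using b'(1) by blast
  next
    fix x assume x: "x \<in> carrier M"
    have "(e \<circ> d) x \<ominus>\<^bsub>M\<^esub> \<zero>\<^bsub>M\<^esub> = e (x \<ominus>\<^bsub>M\<^esub> e x)"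
      using M.diff_zero[OF ec[OF dc[OF x]]] by (simp add: d_def)
    then show "\<exists>t\<in>?T. (e \<circ> d) x \<ominus>\<^bsub>M\<^esub> t \<in> right_module_ideal_prod M N"
      using idem[OF x] M.right_submodule_zero[OF T] by metis
  qed
  then show ?thesis
    using A B int unfolding direct_summands_def d_def by blast
qed

text \<open>
  Write \<open>X\<close> as a retract \<open>X \<rightarrow> E \<rightarrow> X\<close>, with maps \<open>k\<close> and \<open>g\<close>, of a free module \<open>E\<close> over \<open>R/N\<close>, let \<open>F\<close>
  be the free \<open>R\<close>-module on the same basis with coordinatewise reduction \<open>\<rho>: F \<rightarrow> E\<close>, and let \<open>e\<close>
  lift the idempotent \<open>k g\<close> to \<open>F\<close>. The Fitting summand \<open>A\<close> of \<open>F\<close> on which \<open>e\<close> is invertible is the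
  module sought, and \<open>p = g \<rho>\<close> restricted to \<open>A\<close> is its reduction.
\<close>

lemma projective_lift_exists:
  fixes R :: "('a, 'r) ring_scheme" and X :: "('a set, 'x, 'm) right_module_scheme"
  assumes N: "ideal N R" and nil: "right_T_nilpotent R N" and X: "projective (R Quot N) X"
  shows "\<exists>(P :: ('a, 'x \<Rightarrow> 'a) right_module) \<pi>. projective R P \<and> is_reduction R N P X \<pi>"
proof -
  interpret N: ideal N R by (rule N)
  have R: "ring R" by (rule N.ring_axioms)
  have Q: "ring (R Quot N)" by (rule N.quotient_is_ring)
  have X': "right_module (R Quot N) X" using X by (simp add: projective_def)
  let ?F = "free_right_module R (carrier X)" and ?E = "free_right_module (R Quot N) (carrier X)"
  have F: "right_module R ?F" and E: "right_module (R Quot N) ?E"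
    using free_right_module_is_right_module R Q by blast+
  have IX: "right_module R (inflation R N X)" and IE: "right_module R (inflation R N ?E)"
    using N.inflation_is_right_module X' E by blast+
  interpret F: right_module R ?F by (rule F)
  interpret IX: right_module R "inflation R N X" by (rule IX)
  interpret IE: right_module R "inflation R N ?E" by (rule IE)
  obtain \<rho> where "is_reduction R N ?F ?E \<rho>" using free_is_reduction[OF N] by blast
  then have \<rho>: "\<rho> \<in> right_hom R ?F (inflation R N ?E)" "\<rho> ` carrier ?F = carrier ?E"
    and \<rho>0: "\<And>x. x \<in> carrier ?F \<Longrightarrow> \<rho> x = \<zero>\<^bsub>?E\<^esub> \<longleftrightarrow> x \<in> right_module_ideal_prod ?F N"
    by (auto simp: is_reduction_def)
  obtain g k where g: "g \<in> right_hom (R Quot N) ?E X" and gsurj: "g ` carrier ?E = carrier X"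
    and k: "k \<in> right_hom (R Quot N) X ?E" and gk: "\<And>\<xi>. \<xi> \<in> carrier X \<Longrightarrow> g (k \<xi>) = \<xi>"
    using projective_free_retract[OF X] by blast
  define p where "p = g \<circ> \<rho>"
  have p: "p \<in> right_hom R ?F (inflation R N X)"
    unfolding p_def using g by (intro right_hom_comp[OF \<rho>(1)]) (simp add: N.right_hom_inflation)
  have psurj: "p ` carrier ?F = carrier X" using \<rho>(2) gsurj by (simp only: p_def image_comp[symmetric])
  have "k \<circ> p \<in> right_hom R ?F (inflation R N ?E)"
    using k by (intro right_hom_comp[OF p]) (simp add: N.right_hom_inflation)
  then obtain e where e: "e \<in> right_hom R ?F ?F" and \<rho>e: "\<And>x. x \<in> carrier ?F \<Longrightarrow> \<rho> (e x) = k (p x)"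
    using free_lifts[OF R F IE \<rho>(1), of "k \<circ> p" "carrier X"] \<rho>(2) by auto
  have pc: "p x \<in> carrier X" if "x \<in> carrier ?F" for x using right_hom_closed[OF p that] by simp
  have ec: "e x \<in> carrier ?F" if "x \<in> carrier ?F" for x using right_hom_closed[OF e that] .
  have pe: "p (e x) = p x" if "x \<in> carrier ?F" for x
    using \<rho>e[OF that] gk[OF pc[OF that]] by (simp add: p_def)
  have k0: "k \<zero>\<^bsub>X\<^esub> = \<zero>\<^bsub>?E\<^esub>"
    by (rule right_hom_zero[OF right_module_abelian_group[OF X'] right_module_abelian_group[OF E] k])
  have p0: "p \<zero>\<^bsub>?F\<^esub> = \<zero>\<^bsub>X\<^esub>"
    using right_hom_zero[OF F.abelian_group_axioms IX.abelian_group_axioms p] by simp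
  define d where "d x = x \<ominus>\<^bsub>?F\<^esub> e x" for x
  have dc: "d x \<in> carrier ?F" if "x \<in> carrier ?F" for x using that ec[OF that] by (simp add: d_def)
  have pd: "p (d x) = \<zero>\<^bsub>X\<^esub>" if x: "x \<in> carrier ?F" for x
    using right_hom_diff[OF F IX p x ec[OF x]] pe[OF x] IX.diff_eq_zero_iff[of "p x" "p x"] pc[OF x]
    by (simp add: d_def)
  have "e (x \<ominus>\<^bsub>?F\<^esub> e x) \<in> right_module_ideal_prod ?F N" if "x \<in> carrier ?F" for x
    using \<rho>e[OF dc[OF that]] pd[OF that] k0 \<rho>0[OF ec[OF dc[OF that]]] by (simp add: d_def)
  then have ds: "direct_summands R ?F (nil_part ?F d) (nil_part ?F e)" (is "direct_summands R ?F ?A ?B")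
    using fitting_decomposition[OF F N nil e] unfolding d_def by blast
  define P where "P = ?F\<lparr>carrier := ?A\<rparr>"
  have proj: "projective R P" unfolding P_def by (rule direct_summand_of_free_projective[OF R ds])
  have P: "right_module R P" using proj by (simp add: projective_def)
  have A: "x \<in> carrier ?F" if "x \<in> ?A" for x using that by (simp add: nil_part_def)
  have pP: "p \<in> right_hom R P (inflation R N X)"
    unfolding P_def using A by (intro right_hom_restrict[OF p]) blast
  \<comment> \<open>Since \<open>p e = p\<close>, the map \<open>p\<close> vanishes on \<open>B\<close>, so \<open>A\<close> already covers \<open>X\<close>.\<close>
  have "\<xi> \<in> p ` ?A" if "\<xi> \<in> carrier X" for \<xi>
  proof -
    have "\<xi> \<in> p ` carrier ?F" using that by (simp only: psurj)
    then obtain x where x: "x \<in> carrier ?F" "p x = \<xi>" by (elim imageE) simp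
    have "?A <+>\<^bsub>?F\<^esub> ?B = carrier ?F" using ds by (simp add: direct_summands_def)
    then obtain a b where ab: "a \<in> ?A" "b \<in> ?B" "x = a \<oplus>\<^bsub>?F\<^esub> b"
      using x(1) set_add_iff[of x ?F ?A ?B] by (elim equalityE) blast
    obtain n where b: "b \<in> carrier ?F" "(e ^^ n) b = \<zero>\<^bsub>?F\<^esub>" using ab(2) by (auto simp: nil_part_def)
    have "p ((e ^^ m) b) = p b \<and> (e ^^ m) b \<in> carrier ?F" for m using pe ec b(1) by (induction m) auto
    then have "p b = \<zero>\<^bsub>X\<^esub>" using b(2) p0 by metis
    then have "p x = p a" using right_hom_add[OF p A[OF ab(1)] b(1)] ab(3) pc[OF A[OF ab(1)]] IX.M.r_zero by simp
    then show ?thesis using x(2) ab(1) by blast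
  qed
  then have pPsurj: "p ` carrier P = carrier X" using pc A by (auto simp: P_def)
  have "p x = \<zero>\<^bsub>X\<^esub> \<longleftrightarrow> x \<in> right_module_ideal_prod P N" if x: "x \<in> carrier P" for x
  proof
    assume px: "p x = \<zero>\<^bsub>X\<^esub>"
    have xA: "x \<in> ?A" using x by (simp add: P_def)
    then obtain n where n: "x \<in> carrier ?F" "(d ^^ n) x = \<zero>\<^bsub>?F\<^esub>" by (auto simp: nil_part_def)
    \<comment> \<open>On the kernel of \<open>p\<close> the map \<open>d\<close> does not change \<open>\<rho>\<close>, but a power of \<open>d\<close> kills \<open>x\<close>.\<close>
    have step: "\<rho> (d y) = \<rho> y" if y: "y \<in> carrier ?F" and py: "p y = \<zero>\<^bsub>X\<^esub>" for y
    proof -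
      have "\<rho> (d y) = \<rho> y \<ominus>\<^bsub>inflation R N ?E\<^esub> \<rho> (e y)"
        unfolding d_def by (rule right_hom_diff[OF F IE \<rho>(1) y ec[OF y]])
      also have "\<rho> (e y) = \<zero>\<^bsub>inflation R N ?E\<^esub>" using \<rho>e[OF y] py k0 by simp
      finally show ?thesis using IE.diff_zero[OF right_hom_closed[OF \<rho>(1) y]] by simp
    qed
    have "\<rho> ((d ^^ m) x) = \<rho> x \<and> p ((d ^^ m) x) = \<zero>\<^bsub>X\<^esub> \<and> (d ^^ m) x \<in> carrier ?F" for m
      using px n(1) step pd dc by (induction m) auto
    from this[of n] have "\<rho> x = \<rho> \<zero>\<^bsub>?F\<^esub>" using n(2) by metis
    then have "\<rho> x = \<zero>\<^bsub>?E\<^esub>"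
      using right_hom_zero[OF F.abelian_group_axioms IE.abelian_group_axioms \<rho>(1)] by simp
    then have xFN: "x \<in> right_module_ideal_prod ?F N" using \<rho>0[OF n(1)] by simp
    \<comment> \<open>The projection onto \<open>A\<close> maps \<open>FN\<close> into \<open>AN\<close> and fixes \<open>x\<close>.\<close>
    obtain q where q: "q \<in> right_hom R ?F P" "\<And>y. y \<in> ?A \<Longrightarrow> q y = y"
      using direct_summand_projection[OF F ds] unfolding P_def by blast
    show "x \<in> right_module_ideal_prod P N"
      using right_hom_ideal_prod[OF F P N q(1) xFN] q(2)[OF xA] by simp
  next
    show "p x = \<zero>\<^bsub>X\<^esub>" if "x \<in> right_module_ideal_prod P N"
      by (rule inflation_hom_ideal_prod[OF P N X' pP that])
  qed
  then have "is_reduction R N P X p" using pP pPsurj by (simp add: is_reduction_def)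
  with proj show ?thesis by blast
qed


section \<open>Trace ideals\<close>

lemma regular_simps [simp]:
  "carrier (regular_right_module R) = carrier R" "\<zero>\<^bsub>regular_right_module R\<^esub> = \<zero>\<^bsub>R\<^esub>"
  "x \<oplus>\<^bsub>regular_right_module R\<^esub> y = x \<oplus>\<^bsub>R\<^esub> y" "x \<star>\<^bsub>regular_right_module R\<^esub> a = x \<otimes>\<^bsub>R\<^esub> a"
  by (simp_all add: regular_right_module_def)

lemma ideal_right_submodule:
  assumes I: "ideal I R" shows "right_submodule R (regular_right_module R) I"
proof -
  interpret I: ideal I R by (rule I)
  interpret L: right_module R "regular_right_module R"
    by (rule regular_right_module_is_right_module[OF I.ring_axioms])
  show ?thesis
    using I.a_subset additive_subgroup.zero_closed[OF I.is_additive_subgroup] I.a_closed I.I_r_closed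
    by (intro L.right_submoduleI) auto
qed

lemma trace_ideal_mem:
  "\<lbrakk>f \<in> right_hom R M (regular_right_module R); x \<in> carrier M\<rbrakk> \<Longrightarrow> f x \<in> trace_ideal R M"
  unfolding trace_ideal_def by (blast intro: generate.incl)

lemma trace_ideal_least:
  assumes R: "ring R" and J: "additive_subgroup J R"
    and sub: "\<And>f x. \<lbrakk>f \<in> right_hom R M (regular_right_module R); x \<in> carrier M\<rbrakk> \<Longrightarrow> f x \<in> J"
  shows "trace_ideal R M \<subseteq> J"
proof -
  interpret R: ring R by (rule R)
  interpret J: additive_subgroup J R by (rule J)
  show ?thesis
    unfolding trace_ideal_def using sub J.a_subgroup by (intro R.add.generate_subgroup_incl) blast+
qed

text \<open>
  A dual basis expresses \<open>x\<close> with coefficients \<open>k x i\<close>, the values at \<open>x\<close> of homomorphisms from \<open>P\<close>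
  to \<open>R\<close>, which lie in the trace ideal.
\<close>

lemma projective_eq_trace_prod:
  assumes P: "projective R P" and x: "x \<in> carrier P"
  shows "x \<in> right_module_ideal_prod P (trace_ideal R P)"
proof -
  have M: "right_module R P" using P by (simp add: projective_def)
  interpret P: right_module R P by (rule M)
  have R: "ring R" by (rule P.R.ring_axioms)
  let ?F = "free_right_module R (carrier P)"
  have F: "right_module R ?F" by (rule free_right_module_is_right_module[OF R])
  obtain g k where g: "g \<in> right_hom R ?F P" and k: "k \<in> right_hom R P ?F"
    and gk: "\<And>x. x \<in> carrier P \<Longrightarrow> g (k x) = x"
    using projective_free_retract[OF P] by blast
  have "(\<lambda>y. k y i) \<in> right_hom R P (regular_right_module R)" for i
  proof (rule right_homI)
    fix y assume "y \<in> carrier P"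
    then show "k y i \<in> carrier (regular_right_module R)"
      using right_hom_closed[OF k, of y] by (cases "i \<in> carrier P") (auto simp: free_right_module_def)
  qed (simp_all add: right_hom_add[OF k] right_hom_rsmult[OF k], simp_all add: free_right_module_def)
  then have "\<forall>i. k x i \<in> trace_ideal R P" using trace_ideal_mem x by fast
  then have "k x \<in> right_module_ideal_prod ?F (trace_ideal R P)"
    using free_ideal_prod_iff[OF R trace_ideal_is_ideal[OF M] right_hom_closed[OF k x]] by simp
  then show ?thesis
    using right_hom_ideal_prod[OF F M trace_ideal_is_ideal[OF M] g] gk[OF x] by metis
qed

text \<open>
  With \<open>J\<close> the trace ideal, a homomorphism \<open>f\<close> from \<open>P = PJ\<close> to \<open>R\<close> has image in \<open>f(P) J\<close>, so in \<open>JJ\<close>.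
\<close>

lemma trace_ideal_idempotent:
  assumes P: "projective R P"
  shows "trace_ideal R P \<subseteq> ideal_prod R (trace_ideal R P) (trace_ideal R P)"
proof -
  have M: "right_module R P" using P by (simp add: projective_def)
  interpret P: right_module R P by (rule M)
  have R: "ring R" by (rule P.R.ring_axioms)
  let ?J = "trace_ideal R P"
  have J: "ideal ?J R" by (rule trace_ideal_is_ideal[OF M])
  have JJ: "ideal (ideal_prod R ?J ?J) R" by (rule P.R.ideal_prod_is_ideal[OF J J])
  have L: "right_module R (regular_right_module R)" by (rule regular_right_module_is_right_module[OF R])
  show ?thesis
  proof (rule trace_ideal_least[OF R ideal.axioms(1)[OF JJ]])
    fix f x assume f: "f \<in> right_hom R P (regular_right_module R)" and x: "x \<in> carrier P"
    have "right_module_ideal_prod P ?J \<subseteq> {x \<in> carrier P. f x \<in> ideal_prod R ?J ?J}"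
    proof (rule P.right_module_ideal_prod_least)
      show "right_submodule R P {x \<in> carrier P. f x \<in> ideal_prod R ?J ?J}"
        by (rule right_hom_vimage_submodule[OF M L f ideal_right_submodule[OF JJ]])
    next
      fix y a assume y: "y \<in> carrier P" and a: "a \<in> ?J"
      have ac: "a \<in> carrier R" by (rule ideal.Icarr[OF J a])
      have "f (y \<star>\<^bsub>P\<^esub> a) = f y \<otimes>\<^bsub>R\<^esub> a" using right_hom_rsmult[OF f y ac] by simp
      also have "\<dots> \<in> ideal_prod R ?J ?J" by (rule ideal_prod.prod[OF trace_ideal_mem[OF f y] a])
      finally show "y \<star>\<^bsub>P\<^esub> a \<in> {x \<in> carrier P. f x \<in> ideal_prod R ?J ?J}" using y ac by simp
    qed
    then show "f x \<in> ideal_prod R ?J ?J" using projective_eq_trace_prod[OF P x] by blast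
  qed
qed

text \<open>
  A product \<open>j j'\<close> of elements of \<open>J\<close>, with \<open>j' = i + n\<close>, is the sum of \<open>j i\<close>, which lies in
  \<open>I \<inter> J\<close>, and of \<open>j n\<close>, which lies in \<open>JN\<close>. Hence \<open>J = JJ\<close> makes \<open>J\<close> equal to \<open>(I \<inter> J) + JN\<close>, and
  Nakayama's lemma applies to \<open>J\<close> as a right module.
\<close>

lemma idempotent_ideal_subset:
  assumes N: "ideal N R" and nil: "right_T_nilpotent R N" and I: "ideal I R" and J: "ideal J R"
    and idem: "J \<subseteq> ideal_prod R J J" and mod: "\<And>j. j \<in> J \<Longrightarrow> \<exists>i\<in>I. j \<ominus>\<^bsub>R\<^esub> i \<in> N"
  shows "J \<subseteq> I"
proof -
  interpret N: ideal N R by (rule N)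
  interpret I: ideal I R by (rule I)
  interpret J: ideal J R by (rule J)
  let ?L = "regular_right_module R"
  let ?J = "?L\<lparr>carrier := J\<rparr>"
  have L: "right_module R ?L" by (rule regular_right_module_is_right_module[OF N.ring_axioms])
  have M: "right_module R ?J" by (rule right_submodule_module[OF L ideal_right_submodule[OF J]])
  interpret M: right_module R ?J by (rule M)
  have JN: "right_submodule R ?J (right_module_ideal_prod ?J N)"
    by (rule right_module_ideal_prod_submodule[OF M N])
  have IJ: "right_submodule R ?J (I \<inter> J)"
    using I.I_r_closed J.I_r_closed I.a_closed J.a_closed
      additive_subgroup.zero_closed[OF I.is_additive_subgroup] additive_subgroup.zero_closed[OF J.is_additive_subgroup]
    by (intro M.right_submoduleI) auto
  have dec: "\<exists>h\<in>I \<inter> J. \<exists>n\<in>right_module_ideal_prod ?J N. x = h \<oplus>\<^bsub>R\<^esub> n" if "x \<in> ideal_prod R J J" for x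
    using that
  proof (induction rule: ideal_prod.induct)
    case (prod j j')
    then obtain i where i: "i \<in> I" "j' \<ominus>\<^bsub>R\<^esub> i \<in> N" using mod by blast
    have c: "j \<in> carrier R" "j' \<in> carrier R" "i \<in> carrier R" using prod i(1) by auto
    have "j \<otimes>\<^bsub>R\<^esub> i \<in> I \<inter> J" using prod(1) i(1) c I.I_l_closed J.I_r_closed by blast
    moreover have "j \<otimes>\<^bsub>R\<^esub> (j' \<ominus>\<^bsub>R\<^esub> i) \<in> right_module_ideal_prod ?J N"
      using M.rsmult_in_ideal_prod[of j "j' \<ominus>\<^bsub>R\<^esub> i" N] prod(1) i(2) by simp
    moreover have "j \<otimes>\<^bsub>R\<^esub> j' = j \<otimes>\<^bsub>R\<^esub> i \<oplus>\<^bsub>R\<^esub> j \<otimes>\<^bsub>R\<^esub> (j' \<ominus>\<^bsub>R\<^esub> i)"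
      using c by algebra
    ultimately show ?case by blast
  next
    case (sum s t)
    then obtain h n h' n' where hn: "h \<in> I \<inter> J" "n \<in> right_module_ideal_prod ?J N" "s = h \<oplus>\<^bsub>R\<^esub> n"
      "h' \<in> I \<inter> J" "n' \<in> right_module_ideal_prod ?J N" "t = h' \<oplus>\<^bsub>R\<^esub> n'" by blast
    have c: "h \<in> carrier R" "h' \<in> carrier R" "n \<in> carrier R" "n' \<in> carrier R"
      using hn M.right_submodule_subset[OF JN] J.a_subset by auto
    have "s \<oplus>\<^bsub>R\<^esub> t = (h \<oplus>\<^bsub>R\<^esub> h') \<oplus>\<^bsub>R\<^esub> (n \<oplus>\<^bsub>R\<^esub> n')"
      using c hn(3,6) by (simp add: N.a_ac)
    then show ?case
      using M.right_submodule_add[OF IJ hn(1,4)] M.right_submodule_add[OF JN hn(2,5)] by auto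
  qed
  have "I \<inter> J = carrier ?J"
  proof (rule nakayama[OF M N nil IJ])
    fix j assume "j \<in> carrier ?J"
    then obtain h n where hn: "h \<in> I \<inter> J" "n \<in> right_module_ideal_prod ?J N" "j = h \<oplus>\<^bsub>R\<^esub> n"
      using dec[of j] idem by auto
    have nc: "n \<in> J" "h \<in> J" using hn M.right_submodule_subset[OF JN] by auto
    have "j \<ominus>\<^bsub>?J\<^esub> h = n" using nc hn(3) M.add_diff_cancel_left[of h n] by simp
    then show "\<exists>h\<in>I \<inter> J. j \<ominus>\<^bsub>?J\<^esub> h \<in> right_module_ideal_prod ?J N" using hn by blast
  qed
  then show ?thesis by auto
qed

text \<open>
  Homomorphisms \<open>P \<rightarrow> R\<close> induce homomorphisms \<open>X \<rightarrow> R/N\<close> by the universal property of the reduction,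
  and all of the latter arise in this way because \<open>P\<close> is projective.
\<close>

lemma trace_ideal_reduction:
  assumes P: "projective R P" and N: "ideal N R" and X: "right_module (R Quot N) X"
    and \<pi>: "is_reduction R N P X \<pi>"
  shows "trace_ideal (R Quot N) X = (\<lambda>a. N +>\<^bsub>R\<^esub> a) ` trace_ideal R P"
proof -
  interpret N: ideal N R by (rule N)
  have R: "ring R" by (rule N.ring_axioms)
  have Q: "ring (R Quot N)" by (rule N.quotient_is_ring)
  have M: "right_module R P" using P by (simp add: projective_def)
  interpret J: ideal "trace_ideal R P" R by (rule trace_ideal_is_ideal[OF M])
  let ?L = "regular_right_module R" and ?E = "regular_right_module (R Quot N)"
  let ?c = "\<lambda>a. N +>\<^bsub>R\<^esub> a"
  interpret c: ring_hom_ring R "R Quot N" ?c by (rule N.rcos_ring_hom_ring)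
  have L: "right_module R ?L" and E: "right_module (R Quot N) ?E"
    using regular_right_module_is_right_module R Q by blast+
  have IE: "right_module R (inflation R N ?E)" by (rule N.inflation_is_right_module[OF E])
  have c: "?c \<in> right_hom R ?L (inflation R N ?E)" by (intro right_homI) simp_all
  have csurj: "?c ` carrier ?L = carrier (inflation R N ?E)" by (auto simp: N.FactRing_carrier_iff)
  have \<pi>h: "\<pi> \<in> right_hom R P (inflation R N X)" and \<pi>i: "\<pi> ` carrier P = carrier X"
    using \<pi> by (auto simp: is_reduction_def)
  show ?thesis
  proof
    have cJ: "additive_subgroup (?c ` trace_ideal R P) (R Quot N)"
      using group_hom.subgroup_img_is_subgroup[OF c.a_group_hom J.a_subgroup] by (rule additive_subgroupI)
    show "trace_ideal (R Quot N) X \<subseteq> ?c ` trace_ideal R P"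
    proof (rule trace_ideal_least[OF Q cJ])
      fix h \<xi> assume h: "h \<in> right_hom (R Quot N) X ?E" and "\<xi> \<in> carrier X"
      then obtain x where x: "x \<in> carrier P" "\<xi> = \<pi> x" using \<pi>i by blast
      have "h \<circ> \<pi> \<in> right_hom R P (inflation R N ?E)"
        using h by (intro right_hom_comp[OF \<pi>h]) (simp add: N.right_hom_inflation)
      from projective_lifts[OF P L IE c csurj this]
      obtain f where "f \<in> right_hom R P ?L" "?c (f x) = h \<xi>" using x by auto
      then show "h \<xi> \<in> ?c ` trace_ideal R P" using trace_ideal_mem[of f R P x] x(1) by (metis image_eqI)
    qed
  next
    have vi: "ideal {a \<in> carrier R. ?c a \<in> trace_ideal (R Quot N) X} R"
      by (rule c.ideal_vimage[OF trace_ideal_is_ideal[OF X]])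
    have "trace_ideal R P \<subseteq> {a \<in> carrier R. ?c a \<in> trace_ideal (R Quot N) X}"
    proof (rule trace_ideal_least[OF R ideal.axioms(1)[OF vi]])
      fix f x assume f: "f \<in> right_hom R P ?L" and x: "x \<in> carrier P"
      obtain h where "h \<in> right_hom (R Quot N) X ?E" and h: "\<And>y. y \<in> carrier P \<Longrightarrow> h (\<pi> y) = ?c (f y)"
        using reduction_universal[OF M N X E \<pi> right_hom_comp[OF f c]] by auto
      then have "h (\<pi> x) \<in> trace_ideal (R Quot N) X"
        using trace_ideal_mem[of h "R Quot N" X "\<pi> x"] x \<pi>i by blast
      then show "f x \<in> {a \<in> carrier R. ?c a \<in> trace_ideal (R Quot N) X}"
        using h[OF x] right_hom_closed[OF f x] by simp
    qed
    then show "?c ` trace_ideal R P \<subseteq> trace_ideal (R Quot N) X" by blast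
  qed
qed

lemma idempotent_ideal_eq_trace:
  assumes P: "projective R P" and N: "ideal N R" and nil: "right_T_nilpotent R N"
    and X: "right_module (R Quot N) X" and \<pi>: "is_reduction R N P X \<pi>"
    and I: "ideal I R" and idem: "ideal_prod R I I = I"
    and tr: "(\<lambda>a. N +>\<^bsub>R\<^esub> a) ` (I <+>\<^bsub>R\<^esub> N) = trace_ideal (R Quot N) X"
  shows "I = trace_ideal R P"
proof
  interpret N: ideal N R by (rule N)
  interpret I: ideal I R by (rule I)
  have M: "right_module R P" using P by (simp add: projective_def)
  have J: "ideal (trace_ideal R P) R" by (rule trace_ideal_is_ideal[OF M])
  interpret J: ideal "trace_ideal R P" R by (rule J)
  let ?c = "\<lambda>a. N +>\<^bsub>R\<^esub> a"
  have "?c (i \<oplus>\<^bsub>R\<^esub> n) = ?c i" if "i \<in> I" "n \<in> N" for i n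
  proof -
    have "i \<oplus>\<^bsub>R\<^esub> n = n \<oplus>\<^bsub>R\<^esub> i" using that by (intro N.a_comm) auto
    then have "i \<oplus>\<^bsub>R\<^esub> n \<in> ?c i" using that by (auto simp: a_r_coset_def r_coset_def)
    then show ?thesis using N.a_repr_independence'[of "i \<oplus>\<^bsub>R\<^esub> n" i] that by auto
  qed
  then have "?c ` (I <+>\<^bsub>R\<^esub> N) \<subseteq> ?c ` I" by (auto simp: set_add_iff)
  moreover have "I \<subseteq> I <+>\<^bsub>R\<^esub> N"
  proof
    fix i assume "i \<in> I"
    moreover from this have "i = i \<oplus>\<^bsub>R\<^esub> \<zero>\<^bsub>R\<^esub>" by simp
    ultimately show "i \<in> I <+>\<^bsub>R\<^esub> N"
      unfolding set_add_iff using additive_subgroup.zero_closed[OF N.is_additive_subgroup] by blast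
  qed
  ultimately have "?c ` (I <+>\<^bsub>R\<^esub> N) = ?c ` I" by (simp add: image_mono subset_antisym)
  then have eq: "?c ` I = ?c ` trace_ideal R P" using tr trace_ideal_reduction[OF P N X \<pi>] by simp
  have mod: "\<exists>b\<in>B. a \<ominus>\<^bsub>R\<^esub> b \<in> N" if "?c ` A = ?c ` B" "A \<subseteq> carrier R" "B \<subseteq> carrier R" "a \<in> A" for A B a
  proof -
    have "?c a \<in> ?c ` B" using that by blast
    then obtain b where "b \<in> B" "?c a = ?c b" by blast
    moreover from this have "a \<in> carrier R" "b \<in> carrier R" using that(2,3,4) by auto
    ultimately show ?thesis using N.quotient_eq_iff_same_a_r_cos[OF N, of a b] by auto
  qed
  show "I \<subseteq> trace_ideal R P"
    by (rule idempotent_ideal_subset[OF N nil J I]) (use idem mod[OF eq] I.a_subset J.a_subset in auto)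
  show "trace_ideal R P \<subseteq> I"
    by (rule idempotent_ideal_subset[OF N nil I J trace_ideal_idempotent[OF P]])
      (use mod[OF eq[symmetric]] I.a_subset J.a_subset in auto)
qed


section \<open>Projective modules modulo a T-nilpotent ideal\<close>

theorem lemma3p1:
  fixes R :: "('a, 'r) ring_scheme" and N :: "'a set"
  assumes "ring R" and "ideal N R" and "right_T_nilpotent R N"
  shows
    "(\<forall>X :: ('a set, 'x) right_module. projective (R Quot N) X \<longrightarrow>
       (\<exists>P :: ('a, 'x \<Rightarrow> 'a) right_module.
          projective R P \<and> right_isomorphic (R Quot N) (reduction P N) X) \<and>
       (\<forall>(P :: ('a, 'p) right_module) (P' :: ('a, 'q) right_module).
          projective R P \<and> right_isomorphic (R Quot N) (reduction P N) X \<and>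
          projective R P' \<and> right_isomorphic (R Quot N) (reduction P' N) X \<longrightarrow>
          right_isomorphic R P P') \<and>
       (\<forall>P :: ('a, 'p) right_module.
          projective R P \<and> right_isomorphic (R Quot N) (reduction P N) X \<longrightarrow>
          (finitely_generated (R Quot N) X \<longleftrightarrow> finitely_generated R P) \<and>
          (countably_generated (R Quot N) X \<longleftrightarrow> countably_generated R P)))
     \<and>
     (\<forall>(P :: ('a, 'p) right_module) (P' :: ('a, 'q) right_module) f.
       projective R P \<and> projective R P' \<and> f \<in> right_hom R P P' \<longrightarrow>
       (f \<in> right_iso R P P' \<longleftrightarrow>
        reduction_map P' N f \<in> right_iso (R Quot N) (reduction P N) (reduction P' N)))
     \<and>
     (\<forall>I (X :: ('a set, 'x) right_module).
       ideal I R \<and> ideal_prod R I I = I \<and>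
       projective (R Quot N) X \<and> countably_generated (R Quot N) X \<and>
       (\<lambda>x. N +>\<^bsub>R\<^esub> x) ` (I <+>\<^bsub>R\<^esub> N) = trace_ideal (R Quot N) X \<longrightarrow>
       (\<forall>P :: ('a, 'p) right_module.
          projective R P \<and> countably_generated R P \<and>
          right_isomorphic (R Quot N) (reduction P N) X \<longrightarrow>
          I = trace_ideal R P))"
proof (intro conjI allI impI)
  note isoD = iffD1[OF right_isomorphic_reduction_iff[OF _ assms(2)]]
  have mod: "right_module R P" if "projective R P" for P :: "('a, 'p) right_module"
    using that by (simp add: projective_def)
  have modX: "right_module (R Quot N) X" if "projective (R Quot N) X" for X :: "('a set, 'x) right_module"
    using that by (simp add: projective_def)
  {
    fix X :: "('a set, 'x) right_module" assume X: "projective (R Quot N) X"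
    obtain P :: "('a, 'x \<Rightarrow> 'a) right_module" and \<pi> where P: "projective R P" and "is_reduction R N P X \<pi>"
      using projective_lift_exists[OF assms(2,3) X] by blast
    moreover have "right_module R P" using P by (simp add: projective_def)
    ultimately show "\<exists>P :: ('a, 'x \<Rightarrow> 'a) right_module.
        projective R P \<and> right_isomorphic (R Quot N) (reduction P N) X"
      using right_isomorphic_reduction_iff[OF _ assms(2) modX[OF X]] by blast
  next
    fix X :: "('a set, 'x) right_module" and P :: "('a, 'p) right_module" and P' :: "('a, 'q) right_module"
    assume X: "projective (R Quot N) X"
      and "projective R P \<and> right_isomorphic (R Quot N) (reduction P N) X \<and>
        projective R P' \<and> right_isomorphic (R Quot N) (reduction P' N) X"
    then have P: "projective R P" "right_isomorphic (R Quot N) (reduction P N) X"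
      and P': "projective R P'" "right_isomorphic (R Quot N) (reduction P' N) X" by blast+
    have "right_module R P'" using P'(1) by (simp add: projective_def)
    with isoD[OF mod[OF P(1)] modX[OF X] P(2)] isoD[OF _ modX[OF X] P'(2)]
    obtain \<pi> \<pi>' where "is_reduction R N P X \<pi>" "is_reduction R N P' X \<pi>'" by blast
    then show "right_isomorphic R P P'"
      by (rule right_isomorphic_if_reductions[OF P(1) P'(1) assms(2,3) modX[OF X]])
  next
    fix X :: "('a set, 'x) right_module" and P :: "('a, 'p) right_module"
    assume X: "projective (R Quot N) X"
      and "projective R P \<and> right_isomorphic (R Quot N) (reduction P N) X"
    then have P: "projective R P" "right_isomorphic (R Quot N) (reduction P N) X" by blast+
    obtain \<pi> where "is_reduction R N P X \<pi>" using isoD[OF mod[OF P(1)] modX[OF X] P(2)] by blast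
    from generated_reduction_iff[OF mod[OF P(1)] assms(2,3) modX[OF X] this]
    show "finitely_generated (R Quot N) X \<longleftrightarrow> finitely_generated R P"
      and "countably_generated (R Quot N) X \<longleftrightarrow> countably_generated R P" by auto
  next
    fix P :: "('a, 'p) right_module" and P' :: "('a, 'q) right_module" and f
    assume "projective R P \<and> projective R P' \<and> f \<in> right_hom R P P'"
    then show "f \<in> right_iso R P P' \<longleftrightarrow>
        reduction_map P' N f \<in> right_iso (R Quot N) (reduction P N) (reduction P' N)"
      using right_iso_iff_reduction_map[OF mod _ assms(2,3)] by blast
  next
    fix I and X :: "('a set, 'x) right_module" and P :: "('a, 'p) right_module"
    assume I: "ideal I R \<and> ideal_prod R I I = I \<and>
        projective (R Quot N) X \<and> countably_generated (R Quot N) X \<and>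
        (\<lambda>x. N +>\<^bsub>R\<^esub> x) ` (I <+>\<^bsub>R\<^esub> N) = trace_ideal (R Quot N) X"
      and P: "projective R P \<and> countably_generated R P \<and> right_isomorphic (R Quot N) (reduction P N) X"
    then have X: "right_module (R Quot N) X" using modX by blast
    obtain \<pi> where "is_reduction R N P X \<pi>" using isoD[OF mod X] P by blast
    then show "I = trace_ideal R P"
      using idempotent_ideal_eq_trace[OF _ assms(2,3) X] I P by blast
  }
qed

end
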